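(* Let $1<k\le n$ and let $\|\cdot\|_{(k)}$ be the Ky-Fan $k$-norm on $\mathbb{M}_n(\mathbb{R})$. Suppose $T\colon\mathbb{M}_n(\mathbb{R})\to\mathbb{M}_n(\mathbb{R})$ is a bijective linear map which preserves parallel pairs with respect to $\|\cdot\|_{(k)}$ (i.e., if $A$ is parallel to $B$ then $T(A)$ is parallel to $T(B)$). Then $T$ is a scalar multiple of a linear isometry of $(\mathbb{M}_n(\mathbb{R}),\|\cdot\|_{(k)})$. More precisely, there exist $\gamma>0$ and orthogonal matrices $U,V\in\mathbb{M}_n(\mathbb{R})$ such that $T$ has the form $$X\mapsto\gamma UXV\qquad\text{or}\qquad X\mapsto\gamma UX^tV,$$ except when $(k,n)=(2,4)$, in which case $T$ takes one of the four forms $$X\mapsto\gamma UXV,\qquad X\mapsto\gamma UX^tV,\qquad X\mapsto\gamma P\,\mathbb{L}(UXV)\qquad\text{or}\qquad X\mapsto\gamma P\,\mathbb{L}(UX^tV)$$ for some scalar $\gamma>0$ and orthogonal $U,V,P\in\mathbb{M}_4(\mathbb{R})$, where $\mathbb{L}\colon\mathbb{M}_4(\mathbb{R})\to\mathbb{M}_4(\mathbb{R})$ is the linear map $$\mathbb{L}(X)=\tfrac12\bigl(X+B_1XC_1+B_2XC_2+B_3XC_3\bigr)$$ with ($\otimes$ being the Kronecker product) $$B_1=\begin{pmatrix}1&0\\0&1\end{pmatrix}\otimes\begin{pmatrix}0&-1\\1&0\end{pmatrix},\quad C_1=\begin{pmatrix}1&0\\0&-1\end{pmatrix}\otimes\begin{pmatrix}0&1\\-1&0\end{pmatrix},$$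 $$B_2=\begin{pmatrix}0&1\\-1&0\end{pmatrix}\otimes\begin{pmatrix}-1&0\\0&1\end{pmatrix},\quad C_2=\begin{pmatrix}0&1\\-1&0\end{pmatrix}\otimes\begin{pmatrix}1&0\\0&1\end{pmatrix},$$ $$B_3=\begin{pmatrix}0&-1\\1&0\end{pmatrix}\otimes\begin{pmatrix}0&1\\1&0\end{pmatrix},\quad C_3=\begin{pmatrix}0&1\\1&0\end{pmatrix}\otimes\begin{pmatrix}0&1\\-1&0\end{pmatrix}.$$
   Context: $\mathbb{M}_n(\mathbb{R})$ is the space of $n\times n$ real matrices and $X^t$ is the transpose of $X$. For $A\in\mathbb{M}_n(\mathbb{R})$, $s_1(A)\ge\cdots\ge s_n(A)$ are its singular values, and $\|A\|_{(k)}=s_1(A)+\cdots+s_k(A)$. In a real normed space, $x$ is parallel to $y$ if $\|x+\mu y\|=\|x\|+\|y\|$ for some $\mu\in\{-1,1\}$. *)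

theory Defs
  imports "HOL-Analysis.Analysis"
begin

definition charpoly :: "'a::comm_ring_1^'n^'n \<Rightarrow> 'a poly" where
  "charpoly A = det (mat [:0, 1:] - (\<chi> i j. [:A $ i $ j:]))"

text \<open>
  Singular values: the square roots of the eigenvalues of the positive semidefinite matrix
  \<open>transpose A ** A\<close>, counted with multiplicity, in non-increasing order.
  Since \<open>transpose A ** A\<close> is symmetric, its characteristic polynomial splits over the
  reals, so that the list has length \<open>CARD('n)\<close>.
\<close>

definition singular_values :: "real^'n^'n \<Rightarrow> real list" where
  "singular_values A =
     rev (sorted_list_of_multiset (image_mset sqrt (proots (charpoly (transpose A ** A)))))"

definition ky_fan_norm :: "nat \<Rightarrow> real^'n^'n \<Rightarrow> real" where
  "ky_fan_norm k A = sum_list (take k (singular_values A))"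

text \<open>The norm is a parameter, because the type class norm on matrices is the Frobenius norm.\<close>

definition parallel_wrt :: "('a::real_vector \<Rightarrow> real) \<Rightarrow> 'a \<Rightarrow> 'a \<Rightarrow> bool" where
  "parallel_wrt N x y \<longleftrightarrow> (\<exists>\<mu>\<in>{-1, 1::real}. N (x + \<mu> *\<^sub>R y) = N x + N y)"

text \<open>
  The Kronecker product of two matrices is indexed by pairs; in the usual block notation the
  pairs are listed lexicographically.
\<close>

definition kron :: "'a::times^'n^'m \<Rightarrow> 'a^'q^'p \<Rightarrow> 'a^('n \<times> 'q)^('m \<times> 'p)" where
  "kron A B = (\<chi> r c. A $ fst r $ fst c * B $ snd r $ snd c)"

definition mat2 :: "real \<Rightarrow> real \<Rightarrow> real \<Rightarrow> real \<Rightarrow> real^2^2" where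
  "mat2 a b c d = vector [vector [a, b], vector [c, d]]"

definition B1 :: "real^(2 \<times> 2)^(2 \<times> 2)" where
  "B1 = kron (mat2 1 0 0 1) (mat2 0 (-1) 1 0)"
definition C1 :: "real^(2 \<times> 2)^(2 \<times> 2)" where
  "C1 = kron (mat2 1 0 0 (-1)) (mat2 0 1 (-1) 0)"
definition B2 :: "real^(2 \<times> 2)^(2 \<times> 2)" where
  "B2 = kron (mat2 0 1 (-1) 0) (mat2 (-1) 0 0 1)"
definition C2 :: "real^(2 \<times> 2)^(2 \<times> 2)" where
  "C2 = kron (mat2 0 1 (-1) 0) (mat2 1 0 0 1)"
definition B3 :: "real^(2 \<times> 2)^(2 \<times> 2)" where
  "B3 = kron (mat2 0 (-1) 1 0) (mat2 0 1 1 0)"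
definition C3 :: "real^(2 \<times> 2)^(2 \<times> 2)" where
  "C3 = kron (mat2 0 1 1 0) (mat2 0 1 (-1) 0)"

definition LL :: "real^(2 \<times> 2)^(2 \<times> 2) \<Rightarrow> real^(2 \<times> 2)^(2 \<times> 2)" where
  "LL X = (1/2) *\<^sub>R (X + B1 ** X ** C1 + B2 ** X ** C2 + B3 ** X ** C3)"

definition relabel :: "('m \<Rightarrow> 'n) \<Rightarrow> 'a^'n^'n \<Rightarrow> 'a^'m^'m" where
  "relabel e X = (\<chi> i j. X $ e i $ e j)"

text \<open>
  The map \<open>LL\<close> on matrices over an arbitrary four-element index type, whose indices are
  identified with those of the Kronecker products by the bijection \<open>e\<close>.
\<close>

definition LL_via :: "('n \<Rightarrow> 2 \<times> 2) \<Rightarrow> real^'n^'n \<Rightarrow> real^'n^'n" where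
  "LL_via e X = relabel e (LL (relabel (inv e) X))"

end

theory Submission
  imports Defs
begin

text \<open>
  By the singular value decomposition, the Ky Fan norm is the support function
  \<open>N(A) = max {A \<bullet> W}\<close> of the partial isometries \<open>W\<close> of rank \<open>k\<close>, so \<open>N\<close> is additive on a
  pair \<open>(A, B)\<close> (\<open>aligned\<close>) iff some \<open>W\<close> is maximal for both. Any two points of the segment between
  aligned \<open>A\<close> and \<open>B\<close> are parallel, and for nearby points the sign in the parallelism of the images
  cannot be negative; hence \<open>N \<circ> T\<close> is affine on the segment and \<open>T\<close> preserves alignment. The face
  \<open>{A. A \<bullet> W = N(A)}\<close> spans a space whose dimension is independent of \<open>W\<close> and which determines
  \<open>W\<close> up to sign, and this forces \<open>T\<close> to map faces onto faces.

  Therefore \<open>T\<close> permutes the matrices spanning extreme rays of faces: those of rank one and, for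
  \<open>k < n\<close>, the multiples of orthogonal matrices. Rank one matrices from orthogonal pairs of lines
  have images of the same kind, so \<open>T\<close> either preserves rank one, which gives the two standard
  forms, or sends all rank one matrices to multiples of orthogonal ones. In the latter case
  \<open>2 k \<le> n\<close>, and \<open>n - k \<ge> 3\<close> is refuted by composing an orthogonal image with one, two and three
  reflections; so \<open>(k, n) = (2, 4)\<close>. There the isometry \<open>LL\<close> also sends a matrix of rank one to a
  multiple of an orthogonal one, and composing with it reduces to the first case.
\<close>

section \<open>Matrices\<close>

text \<open>The hypothesis controls \<open>T\<close> only, not its inverse, so a face might a priori
  be mapped onto a proper part of another one. Comparing the dimensions of linear spans rules this
  out, and \<open>1 < k\<close> enters because the span has to determine \<open>W\<close>.
  Afterwards the decisive relation is to be aligned with both \<open>B\<close> and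
  \<open>- B\<close>. Between nonzero rank one matrices it is orthogonality of the left and of the
  right vectors; between a nonzero rank one and an orthogonal matrix it never occurs; two orthogonal
  matrices in this relation agree on a \<open>k\<close>-dimensional subspace and are opposite on
  another one, orthogonal to the first, whence \<open>2 k \<le> n\<close>. The exceptional map comes
  from quaternions: \<open>B1, B2, B3\<close> and \<open>C1, C2, C3\<close> both multiply like the
  imaginary units. The three maps taking \<open>X\<close> to \<open>Bi X Ci\<close> are commuting
  involutions, and the product of two of them is minus the third; this makes \<open>LL\<close> an
  involution.\<close>

declare transpose_matrix_vector [simp del]

definition outer :: "real^'n \<Rightarrow> real^'m \<Rightarrow> real^'m^'n" where
  "outer x y = (\<chi> i j. x $ i * y $ j)"

definition diagm :: "('n \<Rightarrow> real) \<Rightarrow> real^'n^'n" where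
  "diagm d = (\<chi> i j. if i = j then d i else 0)"

lemma inner_matrix: "A \<bullet> B = (\<Sum>i\<in>UNIV. \<Sum>j\<in>UNIV. A $ i $ j * B $ i $ j)" for A B :: "real^'n^'m"
  by (simp add: inner_vec_def)

lemma inner_transpose [simp]: "transpose A \<bullet> transpose B = A \<bullet> B" for A B :: "real^'n^'m"
  unfolding inner_matrix transpose_def by (subst sum.swap) simp

lemma inner_matmul_left: "(A ** B) \<bullet> C = B \<bullet> (transpose A ** C)"
  for A :: "real^'n^'m" and B :: "real^'p^'n"
proof -
  have "(A ** B) \<bullet> C = (\<Sum>i\<in>UNIV. \<Sum>j\<in>UNIV. \<Sum>k\<in>UNIV. A$i$k * B$k$j * C$i$j)"
    by (simp add: inner_matrix matrix_matrix_mult_def sum_distrib_right)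
  also have "\<dots> = (\<Sum>i\<in>UNIV. \<Sum>k\<in>UNIV. \<Sum>j\<in>UNIV. A$i$k * B$k$j * C$i$j)"
    by (rule sum.cong[OF refl], rule sum.swap)
  also have "\<dots> = (\<Sum>k\<in>UNIV. \<Sum>i\<in>UNIV. \<Sum>j\<in>UNIV. A$i$k * B$k$j * C$i$j)"
    by (rule sum.swap)
  also have "\<dots> = (\<Sum>k\<in>UNIV. \<Sum>j\<in>UNIV. \<Sum>i\<in>UNIV. A$i$k * B$k$j * C$i$j)"
    by (rule sum.cong[OF refl], rule sum.swap)
  also have "\<dots> = B \<bullet> (transpose A ** C)"
    by (simp add: inner_matrix matrix_matrix_mult_def sum_distrib_left transpose_def mult_ac)
  finally show ?thesis .
qed

lemma inner_matmul_right: "(A ** B) \<bullet> C = A \<bullet> (C ** transpose B)"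
  for A :: "real^'n^'m" and B :: "real^'p^'n"
  using inner_matmul_left[of "transpose B" "transpose A" "transpose C"]
  by (metis inner_transpose matrix_transpose_mul transpose_transpose)

lemma inner_conj: "(U ** A ** V) \<bullet> X = A \<bullet> (transpose U ** X ** transpose V)"
  for U :: "real^'n^'m" and A :: "real^'p^'n" and V :: "real^'q^'p"
  using inner_matmul_left[of U A "X ** transpose V"] inner_matmul_right[of "U ** A" V X]
  by (simp add: matrix_mul_assoc)

lemma vmult_inner_left: "(A *v x) \<bullet> y = x \<bullet> (transpose A *v y)" for A :: "real^'n^'m"
  using dot_lmul_matrix[of x "transpose A" y] transpose_matrix_vector[of "transpose A" x] by simp

lemma minus_vmult: "(- A) *v y = - (A *v y)" for A :: "real^'n^'m"
  using matrix_vector_mult_diff_rdistrib[of 0 A y] by simp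

lemma outer_nth [simp]: "outer x y $ i $ j = x $ i * y $ j"
  by (simp add: outer_def)

lemma diagm_nth: "diagm d $ i $ j = (if i = j then d i else 0)"
  by (simp add: diagm_def)

lemma transpose_outer [simp]: "transpose (outer x y) = outer y x"
  by (simp add: vec_eq_iff transpose_def)

lemma transpose_diagm [simp]: "transpose (diagm d) = diagm d"
  by (simp add: vec_eq_iff transpose_def diagm_nth)

lemma mult_outer: "A ** outer x y = outer (A *v x) y" for A :: "real^'n^'m"
  by (simp add: vec_eq_iff matrix_matrix_mult_def matrix_vector_mult_def sum_distrib_right sum_distrib_left mult_ac)

lemma outer_mult: "outer x y ** A = outer x (transpose A *v y)" for A :: "real^'m^'n"
  by (simp add: vec_eq_iff matrix_matrix_mult_def matrix_vector_mult_def sum_distrib_left transpose_def mult_ac)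

lemma outer_vmult: "outer x y *v z = (y \<bullet> z) *\<^sub>R x"
  by (simp add: vec_eq_iff matrix_vector_mult_def inner_vec_def sum_distrib_left mult_ac)

lemma outer_mult_outer: "outer a b ** outer c d = (b \<bullet> c) *\<^sub>R outer a d" for b :: "real^'n"
  by (simp add: mult_outer outer_vmult vec_eq_iff)

lemma inner_outer: "outer x y \<bullet> A = x \<bullet> (A *v y)"
  by (simp add: inner_vec_def matrix_vector_mult_def sum_distrib_left mult_ac)

lemma outer_add_left: "outer (x + x') y = outer x y + outer x' y"
  and outer_add_right: "outer x (y + y') = outer x y + outer x y'"
  and outer_scaleR_left: "outer (c *\<^sub>R x) y = c *\<^sub>R outer x y"
  and outer_scaleR_right: "outer x (c *\<^sub>R y) = c *\<^sub>R outer x y"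
  and outer_minus_left: "outer (- x) y = - outer x y"
  and outer_minus_right: "outer x (- y) = - outer x y"
  and outer_diff_left: "outer (x - x') y = outer x y - outer x' y"
  and outer_diff_right: "outer x (y - y') = outer x y - outer x y'"
  by (simp_all add: vec_eq_iff algebra_simps)

lemma outer_0 [simp]: "outer 0 y = 0" "outer x 0 = 0"
  by (simp_all add: vec_eq_iff)

lemma outer_eq_0_iff [simp]: "outer x y = 0 \<longleftrightarrow> x = 0 \<or> y = 0"
  by (auto simp: vec_eq_iff)

lemma inner_axis1 [simp]: "x \<bullet> axis i 1 = x $ i" "axis i 1 \<bullet> x = x $ i" for x :: "real^'n"
  by (simp_all add: inner_axis inner_axis')

lemma matrix_scaleR_left: "(c *\<^sub>R A) ** B = c *\<^sub>R (A ** B)" for A :: "real^'n^'m"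
  by (simp add: vec_eq_iff matrix_matrix_mult_def sum_distrib_left mult_ac)

lemma matrix_scaleR_right: "A ** (c *\<^sub>R B) = c *\<^sub>R (A ** B)" for A :: "real^'n^'m"
  by (simp add: vec_eq_iff matrix_matrix_mult_def sum_distrib_left mult_ac)

lemma matrix_minus_left: "(- A) ** B = - (A ** B)" for A :: "real^'n^'m"
  by (simp add: vec_eq_iff matrix_matrix_mult_def sum_negf)

lemma matrix_minus_right: "A ** (- B) = - (A ** B)" for A :: "real^'n^'m"
  by (simp add: vec_eq_iff matrix_matrix_mult_def sum_negf)

lemma matrix_diff_left: "(A - A') ** B = A ** B - A' ** B" for A :: "real^'n^'m"
  by (simp add: vec_eq_iff matrix_matrix_mult_def sum_subtractf algebra_simps)

lemma matrix_diff_right: "A ** (B - B') = A ** B - A ** B'" for A :: "real^'n^'m"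
  by (simp add: vec_eq_iff matrix_matrix_mult_def sum_subtractf algebra_simps)

lemma matrix_add_left: "(A + A') ** B = A ** B + A' ** B" for A :: "real^'n^'m"
  by (simp add: vec_eq_iff matrix_matrix_mult_def sum.distrib algebra_simps)

lemmas matrix_distribs = matrix_add_ldistrib matrix_add_left matrix_diff_left matrix_diff_right
  matrix_scaleR_left matrix_scaleR_right matrix_minus_left matrix_minus_right

lemma transpose_add [simp]: "transpose (A + B) = transpose A + transpose B"
  and transpose_diff [simp]: "transpose (A - B) = transpose A - transpose B"
  and transpose_minus [simp]: "transpose (- A) = - transpose A"
  and transpose_scaleR [simp]: "transpose (c *\<^sub>R A) = c *\<^sub>R transpose A"
  and transpose_0 [simp]: "transpose (0::real^'n^'m) = 0" for A B :: "real^'n^'m"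
  by (simp_all add: vec_eq_iff transpose_def)

lemma diagm_mult_left: "(diagm d ** A) $ i $ j = d i * A $ i $ j"
proof -
  have "(diagm d ** A) $ i $ j = (\<Sum>k\<in>UNIV. if k = i then d i * A $ k $ j else 0)"
    unfolding matrix_matrix_mult_def vec_lambda_beta by (intro sum.cong refl) (auto simp: diagm_nth)
  then show ?thesis by simp
qed

lemma diagm_mult_right: "(A ** diagm d) $ i $ j = A $ i $ j * d j"
proof -
  have "(A ** diagm d) $ i $ j = (\<Sum>k\<in>UNIV. if k = j then A $ i $ k * d j else 0)"
    unfolding matrix_matrix_mult_def vec_lambda_beta by (intro sum.cong refl) (auto simp: diagm_nth)
  then show ?thesis by simp
qed

lemma diagm_mult_diagm: "diagm d ** diagm e = diagm (\<lambda>i. d i * e i)"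
  by (simp add: vec_eq_iff diagm_mult_left) (simp add: diagm_nth)

lemma diagm_vmult: "(diagm d *v x) $ i = d i * x $ i"
proof -
  have "(diagm d *v x) $ i = (\<Sum>k\<in>UNIV. if k = i then d i * x $ k else 0)"
    unfolding matrix_vector_mult_def vec_lambda_beta by (intro sum.cong refl) (auto simp: diagm_nth)
  then show ?thesis by simp
qed

lemma inner_diagm: "A \<bullet> diagm d = (\<Sum>i\<in>UNIV. A $ i $ i * d i)"
proof -
  have "A \<bullet> diagm d = (\<Sum>i\<in>UNIV. \<Sum>j\<in>UNIV. if j = i then A $ i $ j * d i else 0)"
    unfolding inner_matrix by (intro sum.cong refl) (simp add: diagm_nth)
  then show ?thesis by simp
qed

lemma diagm_1: "diagm (\<lambda>_. 1) = mat 1"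
  by (simp add: vec_eq_iff diagm_nth mat_def)

lemma orthogonal_diagm:
  assumes "\<And>i. \<bar>d i\<bar> = 1"
  shows "orthogonal_matrix (diagm d)"
proof -
  have "d i * d i = 1" for i
    using assms[of i] by (simp add: abs_if split: if_splits)
  then show ?thesis
    by (simp add: orthogonal_matrix diagm_mult_diagm flip: diagm_1)
qed

lemma orthogonal_matrixD:
  assumes "orthogonal_matrix (U :: real^'n^'n)"
  shows "transpose U ** U = mat 1" "U ** transpose U = mat 1"
  using assms by (auto simp: orthogonal_matrix_def)

lemma orthogonal_cancel:
  assumes "orthogonal_matrix (U :: real^'n^'n)"
  shows "transpose U ** (U ** A) = A" "U ** (transpose U ** A) = A"
    "(A ** U) ** transpose U = A" "(A ** transpose U) ** U = A"
  using orthogonal_matrixD[OF assms] matrix_mul_assoc[of "transpose U" U A] matrix_mul_assoc[of U "transpose U" A]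
    matrix_mul_assoc[of A U "transpose U"] matrix_mul_assoc[of A "transpose U" U] by simp_all

lemma orthogonal_minus: "orthogonal_matrix (U :: real^'n^'n) \<Longrightarrow> orthogonal_matrix (- U)"
  by (simp add: orthogonal_matrix matrix_minus_left matrix_minus_right)

lemma orthogonal_inner:
  assumes "orthogonal_matrix (U :: real^'n^'n)"
  shows "(U *v x) \<bullet> (U *v y) = x \<bullet> y"
  using assms by (simp add: vmult_inner_left matrix_vector_mul_assoc orthogonal_matrixD)

lemma orthogonal_norm:
  assumes "orthogonal_matrix (U :: real^'n^'n)"
  shows "norm (U *v x) = norm x"
  by (simp add: norm_eq_sqrt_inner orthogonal_inner[OF assms])

section \<open>The singular value decomposition\<close>

text \<open>On the plane of the axes \<open>p\<close> and \<open>q\<close> the matrices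
  \<open>P\<close> and \<open>J\<close> multiply like 1 and the imaginary unit, and both vanish on
  its complement; the matrix is a rotation of that plane.\<close>

lemma plane_rotation:
  fixes p q :: "'n::finite"
  assumes "p \<noteq> q" "c\<^sup>2 + s\<^sup>2 = 1"
  defines "P \<equiv> outer (axis p 1) (axis p 1) + outer (axis q 1) (axis q 1 :: real^'n)"
  defines "J \<equiv> outer (axis p 1) (axis q 1) - outer (axis q 1) (axis p 1 :: real^'n)"
  shows "orthogonal_matrix (mat 1 + (c - 1) *\<^sub>R P + s *\<^sub>R J)"
proof -
  have [simp]: "axis q (1::real) $ p = 0" "axis p (1::real) $ q = 0"
    using assms(1) by (auto simp: axis_def)
  have PP: "P ** P = P" "P ** J = J" "J ** P = J" "J ** J = - P"
    unfolding P_def J_def by (simp_all add: matrix_distribs outer_mult_outer)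
  have tr: "transpose P = P" "transpose J = - J"
    unfolding P_def J_def by auto
  have "transpose (mat 1 + (c - 1) *\<^sub>R P + s *\<^sub>R J) ** (mat 1 + (c - 1) *\<^sub>R P + s *\<^sub>R J)
      = mat 1 + (c\<^sup>2 + s\<^sup>2 - 1) *\<^sub>R P"
    by (simp add: tr matrix_distribs PP transpose_mat) (simp add: algebra_simps power2_eq_square scaleR_2)
  then show ?thesis by (simp add: assms orthogonal_matrix)
qed

text \<open>First order condition along the plane rotations.\<close>

lemma symmetric_if_max:
  fixes M :: "real^'n^'n"
  assumes max: "\<And>R. orthogonal_matrix R \<Longrightarrow> M \<bullet> R \<le> M \<bullet> mat 1"
  shows "transpose M = M"
proof -
  have "M $ p $ q = M $ q $ p" if pq: "p \<noteq> q" for p q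
  proof -
    define a where "a = M $ p $ p + M $ q $ q"
    define b where "b = M $ p $ q - M $ q $ p"
    have *: "- (t\<^sup>2 * a) + t * b \<le> 0" for t :: real
    proof -
      \<comment> \<open>Rational parametrisation of the circle: up to a positive factor, maximality
        becomes a quadratic inequality in \<open>t\<close>, which forces its linear coefficient to
        vanish.\<close>
      define c where "c = (1 - t\<^sup>2) / (1 + t\<^sup>2)"
      define s where "s = 2 * t / (1 + t\<^sup>2)"
      have pos: "1 + t\<^sup>2 > 0" by (smt (verit) zero_le_power2)
      have "c\<^sup>2 + s\<^sup>2 = ((1 - t\<^sup>2)\<^sup>2 + (2 * t)\<^sup>2) / (1 + t\<^sup>2)\<^sup>2"
        unfolding c_def s_def by (simp add: power_divide add_divide_distrib)
      also have "(1 - t\<^sup>2)\<^sup>2 + (2 * t)\<^sup>2 = (1 + t\<^sup>2)\<^sup>2" by (simp add: power2_eq_square algebra_simps)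
      also have "(1 + t\<^sup>2)\<^sup>2 / (1 + t\<^sup>2)\<^sup>2 = 1" using pos by simp
      finally have "c\<^sup>2 + s\<^sup>2 = 1" .
      from max[OF plane_rotation[OF pq this]]
      have "(c - 1) * a + s * b \<le> 0"
        by (simp add: inner_add_right inner_diff_right inner_commute[of M "outer _ _"] inner_outer a_def b_def
           matrix_vector_mult_basis column_def)
      moreover have "c - 1 = - (2 * t\<^sup>2) / (1 + t\<^sup>2)" using pos by (simp add: c_def field_simps)
      ultimately have "(- (2 * t\<^sup>2) * a + 2 * t * b) / (1 + t\<^sup>2) \<le> 0"
        by (simp add: s_def add_divide_distrib diff_divide_distrib)
      then show ?thesis using pos by (simp add: divide_le_0_iff)
    qed
    have "b = 0"
    proof (rule ccontr)
      assume "b \<noteq> 0"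
      \<comment> \<open>\<open>e\<close> is positive and bounds \<open>a\<close>; for the following
        \<open>t\<close> the linear term is twice the bound for the quadratic one.\<close>
      define e where "e = \<bar>a\<bar> + 1"
      define t where "t = b / (2 * e)"
      have e: "e > 0" by (simp add: e_def add_nonneg_pos)
      have "t * b = b\<^sup>2 / (2 * e)" by (simp add: t_def power2_eq_square)
      moreover have "t\<^sup>2 * a \<le> t\<^sup>2 * e" by (intro mult_left_mono) (auto simp: e_def)
      moreover have "t\<^sup>2 * e = b\<^sup>2 / (4 * e)"
        using e by (simp add: t_def power2_eq_square field_simps)
      moreover have "b\<^sup>2 / (4 * e) < b\<^sup>2 / (2 * e)"
        using \<open>b \<noteq> 0\<close> e by (intro divide_strict_left_mono) (auto intro!: mult_pos_pos)
      ultimately show False using *[of t] by linarith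
    qed
    then show ?thesis by (simp add: b_def)
  qed
  then show ?thesis
    by (simp add: vec_eq_iff transpose_def) metis
qed

lemma compact_orthogonal_matrices: "compact {U :: real^'n^'n. orthogonal_matrix U}"
proof -
  have "closed {U :: real^'n^'n. transpose U ** U = mat 1}"
    unfolding transpose_def matrix_matrix_mult_def
    by (intro closed_Collect_eq continuous_intros)
  moreover have "norm U \<le> sqrt (real CARD('n))" if "transpose U ** U = mat 1" for U :: "real^'n^'n"
  proof -
    have "U \<bullet> U = mat 1 \<bullet> (transpose U ** U)"
      using inner_matmul_left[of U "mat 1" U] by simp
    then show ?thesis
      by (simp add: that norm_eq_sqrt_inner inner_diagm flip: diagm_1) (simp add: diagm_nth)
  qed
  then have "bounded {U :: real^'n^'n. transpose U ** U = mat 1}"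
    unfolding bounded_iff by blast
  ultimately show ?thesis
    by (simp add: compact_eq_bounded_closed orthogonal_matrix)
qed

text \<open>Maximising \<open>A \<bullet> (U ** diagm c ** V)\<close> for distinct positive weights \<open>c\<close> forces the
  matrix \<open>transpose U ** A ** transpose V\<close> to be diagonal.\<close>

lemma svd:
  fixes A :: "real^'n^'n"
  shows "\<exists>U V d. orthogonal_matrix U \<and> orthogonal_matrix V \<and> (\<forall>i. 0 \<le> d i) \<and> A = U ** diagm d ** V"
proof -
  \<comment> \<open>An injection into the naturals provides the distinct weights; adding 1 makes
    them positive.\<close>
  obtain f :: "'n \<Rightarrow> nat" where f: "inj f"
    using finite_imp_inj_to_nat_seg[of "UNIV :: 'n set"] by auto
  define c where "c i = real (f i) + 1" for i
  define S where "S = {U :: real^'n^'n. orthogonal_matrix U}"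
  have "mat 1 \<in> S" by (simp add: S_def orthogonal_matrix_id)
  then have ne: "S \<times> S \<noteq> {}" by auto
  have "compact (S \<times> S)"
    unfolding S_def by (intro compact_Times compact_orthogonal_matrices)
  moreover have "continuous_on (S \<times> S) (\<lambda>(U, V). A \<bullet> (U ** diagm c ** V))"
    unfolding matrix_matrix_mult_def case_prod_beta by (intro continuous_intros)
  ultimately obtain p where p: "p \<in> S \<times> S"
      "\<And>q. q \<in> S \<times> S \<Longrightarrow> (\<lambda>(U, V). A \<bullet> (U ** diagm c ** V)) q \<le> (\<lambda>(U, V). A \<bullet> (U ** diagm c ** V)) p"
    using continuous_attains_sup[OF _ ne] by metis
  obtain U V where pUV: "p = (U, V)" by fastforce
  then have UV: "orthogonal_matrix U" "orthogonal_matrix V" using p(1) by (auto simp: S_def)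
  define B where "B = transpose U ** A ** transpose V"
  have inner_B: "A \<bullet> (U ** X ** V) = B \<bullet> X" for X
    using inner_matmul_left[of "transpose U" A "X ** V"] inner_matmul_right[of "transpose U ** A" "transpose V" X]
    by (simp add: B_def matrix_mul_assoc)
  have "transpose (B ** diagm c) = B ** diagm c"
  proof (rule symmetric_if_max)
    fix R :: "real^'n^'n" assume "orthogonal_matrix R"
    then have "(U ** R, V) \<in> S \<times> S" using UV by (simp add: S_def orthogonal_matrix_mul)
    from p(2)[OF this] have "A \<bullet> (U ** (R ** diagm c) ** V) \<le> A \<bullet> (U ** (mat 1 ** diagm c) ** V)"
      by (simp add: pUV matrix_mul_assoc)
    then show "(B ** diagm c) \<bullet> R \<le> (B ** diagm c) \<bullet> mat 1"
      by (simp only: inner_B inner_matmul_right transpose_diagm)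
  qed
  from arg_cong[OF this, of "\<lambda>M. M $ i $ j" for i j]
  have 1: "B $ i $ j * c j = B $ j $ i * c i" for i j
    by (simp add: transpose_def diagm_mult_right)
  have "transpose (diagm c ** B) = diagm c ** B"
  proof (rule symmetric_if_max)
    fix R :: "real^'n^'n" assume "orthogonal_matrix R"
    then have "(U, R ** V) \<in> S \<times> S" using UV by (simp add: S_def orthogonal_matrix_mul)
    from p(2)[OF this] have "A \<bullet> (U ** (diagm c ** R) ** V) \<le> A \<bullet> (U ** (diagm c ** mat 1) ** V)"
      by (simp add: pUV matrix_mul_assoc)
    then show "(diagm c ** B) \<bullet> R \<le> (diagm c ** B) \<bullet> mat 1"
      by (simp only: inner_B inner_matmul_left transpose_diagm)
  qed
  from arg_cong[OF this, of "\<lambda>M. M $ i $ j" for i j]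
  have 2: "c i * B $ i $ j = c j * B $ j $ i" for i j
    by (simp add: transpose_def diagm_mult_left)
  have off: "B $ i $ j = 0" if "i \<noteq> j" for i j
  proof -
    \<comment> \<open>Combining the two symmetry relations eliminates \<open>B $ j $ i\<close> and
      leaves \<open>B $ i $ j\<close> times the difference of the squares of two distinct positive
      weights.\<close>
    have "B $ i $ j * (c j * c j) = (B $ j $ i * c i) * c j" using 1[of i j] by simp
    also have "\<dots> = c i * (c j * B $ j $ i)" by simp
    also have "\<dots> = c i * (c i * B $ i $ j)" by (simp only: 2[of i j])
    finally have "B $ i $ j * ((c j - c i) * (c j + c i)) = 0" by (simp add: algebra_simps)
    moreover have "c j \<noteq> c i" using f that by (auto simp: c_def inj_def)
    moreover have "c j + c i > 0" by (simp add: c_def add_pos_pos)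
    ultimately show ?thesis by simp
  qed
  \<comment> \<open>The signs of the diagonal are moved into the left orthogonal factor.\<close>
  define s where "s i = (if B $ i $ i < 0 then -1 else 1 :: real)" for i
  define d where "d i = \<bar>B $ i $ i\<bar>" for i
  have "B = diagm s ** diagm d"
    using off by (auto simp: vec_eq_iff diagm_mult_diagm diagm_nth s_def d_def)
  moreover have "A = U ** B ** V"
  proof -
    have "U ** B ** V = ((U ** transpose U) ** A) ** (transpose V ** V)"
      by (simp only: B_def matrix_mul_assoc)
    then show ?thesis using UV by (simp add: orthogonal_matrixD)
  qed
  ultimately have "A = (U ** diagm s) ** diagm d ** V" by (simp add: matrix_mul_assoc)
  moreover have "orthogonal_matrix (U ** diagm s)"
    using UV by (intro orthogonal_matrix_mul orthogonal_diagm) (auto simp: s_def)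
  moreover have "\<forall>i. 0 \<le> d i" by (simp add: d_def)
  ultimately show ?thesis using UV by blast
qed

section \<open>Singular values and Ky Fan norm of a decomposed matrix\<close>

lemma charpoly_orthogonal_conj:
  fixes V M :: "real^'n^'n"
  assumes "orthogonal_matrix V"
  shows "charpoly (transpose V ** M ** V) = charpoly M"
proof -
  \<comment> \<open>The determinant is taken over polynomials: \<open>lift\<close> embeds real
    matrices multiplicatively as matrices of constants, and the scalar matrix of the indeterminate
    commutes with all of them.\<close>
  define lift :: "real^'n^'n \<Rightarrow> real poly^'n^'n" where "lift A = (\<chi> i j. [:A $ i $ j:])" for A
  have sum_const: "(\<Sum>k\<in>K. [:f k:]) = [:\<Sum>k\<in>K. f k:]" for f :: "'n \<Rightarrow> real" and K
    by (induction K rule: infinite_finite_induct) auto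
  have lift_mult: "lift (A ** B) = lift A ** lift B" for A B
    by (simp add: lift_def vec_eq_iff matrix_matrix_mult_def sum_const mult.commute)
  have lift_1: "lift (mat 1) = mat 1"
    by (simp add: lift_def vec_eq_iff mat_def)
  have comm: "mat c ** A = A ** mat c" for c and A :: "real poly^'n^'n"
  proof -
    have "(mat c ** A) $ i $ j = (\<Sum>k\<in>UNIV. if k = i then c * A $ k $ j else 0)" for i j
      unfolding matrix_matrix_mult_def vec_lambda_beta by (intro sum.cong refl) (auto simp: mat_def)
    moreover have "(A ** mat c) $ i $ j = (\<Sum>k\<in>UNIV. if k = j then c * A $ i $ k else 0)" for i j
      unfolding matrix_matrix_mult_def vec_lambda_beta by (intro sum.cong refl) (auto simp: mat_def mult.commute)
    ultimately show ?thesis by (simp add: vec_eq_iff)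
  qed
  have ldiff: "A ** (B - C) = A ** B - A ** C" and rdiff: "(B - C) ** A = B ** A - C ** A"
    for A B C :: "real poly^'n^'n"
    by (simp_all add: vec_eq_iff matrix_matrix_mult_def sum_subtractf algebra_simps)
  have inv: "lift (transpose V) ** lift V = mat 1"
    using assms by (simp add: lift_1 orthogonal_matrixD flip: lift_mult)
  have "mat [:0, 1:] - lift (transpose V ** M ** V) = lift (transpose V) ** (mat [:0, 1:] - lift M) ** lift V"
  proof -
    have "lift (transpose V) ** mat [:0, 1:] ** lift V = mat [:0, 1:] ** (lift (transpose V) ** lift V)"
      by (simp only: comm[symmetric] matrix_mul_assoc)
    then show ?thesis by (simp add: ldiff rdiff lift_mult inv)
  qed
  then have "charpoly (transpose V ** M ** V) = det (lift (transpose V)) * charpoly M * det (lift V)"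
    by (simp add: charpoly_def det_mul lift_def)
  also have "\<dots> = charpoly M * det (lift (transpose V) ** lift V)"
    by (simp add: det_mul)
  finally show ?thesis by (simp add: inv)
qed

lemma proots_charpoly_diagm:
  fixes e :: "'n::finite \<Rightarrow> real"
  shows "proots (charpoly (diagm e)) = image_mset e (mset_set UNIV)"
proof -
  have singletons: "finite A \<Longrightarrow> (\<Sum>i\<in>A. {#e i#}) = image_mset e (mset_set A)" for A
    by (induction A rule: finite_induct) auto
  have "charpoly (diagm e) = (\<Prod>i\<in>UNIV. [:- e i, 1:])"
    unfolding charpoly_def by (subst det_diagonal) (auto simp: mat_def diagm_nth)
  then have "proots (charpoly (diagm e)) = (\<Sum>i\<in>UNIV. {#e i#})"
    by (simp add: proots_prod)
  also have "\<dots> = image_mset e (mset_set UNIV)"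
    by (rule singletons) simp
  finally show ?thesis .
qed

lemma singular_values_svd:
  fixes U V :: "real^'n^'n"
  assumes "orthogonal_matrix U" "orthogonal_matrix V" "\<And>i. 0 \<le> d i"
  shows "singular_values (U ** diagm d ** V) = rev (sorted_list_of_multiset (image_mset d (mset_set UNIV)))"
proof -
  have "transpose (U ** diagm d ** V) ** (U ** diagm d ** V)
      = transpose V ** (diagm d ** (transpose U ** U) ** diagm d) ** V"
    by (simp only: matrix_transpose_mul matrix_mul_assoc transpose_diagm)
  also have "\<dots> = transpose V ** diagm (\<lambda>i. d i * d i) ** V"
    using assms(1) by (simp add: orthogonal_matrixD diagm_mult_diagm)
  finally show ?thesis
    using assms by (simp add: singular_values_def charpoly_orthogonal_conj proots_charpoly_diagm
        image_mset.compositionality comp_def)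
qed

text \<open>When entries coincide, the indices of the \<open>k\<close> largest ones are not unique.
  Sorting selects one such set, and later arguments only use that its entries dominate the
  others.\<close>

lemma ky_fan_norm_svd:
  fixes U V :: "real^'n^'n"
  assumes "orthogonal_matrix U" "orthogonal_matrix V" "\<And>i. 0 \<le> d i" "k \<le> CARD('n)"
  shows "\<exists>I. card I = k \<and> (\<forall>i\<in>I. \<forall>j. j \<notin> I \<longrightarrow> d j \<le> d i) \<and>
    ky_fan_norm k (U ** diagm d ** V) = sum d I"
proof -
  obtain ys where ys: "set ys = (UNIV :: 'n set)" "distinct ys"
    using finite_distinct_list[of "UNIV :: 'n set"] by auto
  define zs where "zs = rev (sort_key d ys)"
  have zs: "set zs = UNIV" "distinct zs" using ys by (auto simp: zs_def)
  then have len: "length zs = CARD('n)" by (metis distinct_card)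
  have "mset zs = mset_set UNIV" using zs by (metis mset_set_set)
  then have "sorted_list_of_multiset (image_mset d (mset_set UNIV)) = sort (map d zs)"
    by (metis mset_map sorted_list_of_multiset_mset)
  also have "\<dots> = map d (sort_key d ys)"
    by (rule properties_for_sort) (simp_all add: zs_def)
  finally have sv: "singular_values (U ** diagm d ** V) = map d zs"
    using assms by (simp add: singular_values_svd zs_def rev_map)
  have "sorted_wrt (\<lambda>x y. d y \<le> d x) zs"
    unfolding zs_def sorted_wrt_rev using sorted_sort_key[of d ys] by (simp add: sorted_map)
  then have "sorted_wrt (\<lambda>x y. d y \<le> d x) (take k zs @ drop k zs)" by simp
  then have top: "d j \<le> d i" if "i \<in> set (take k zs)" "j \<in> set (drop k zs)" for i j
    using that unfolding sorted_wrt_append by blast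
  show ?thesis
  proof (intro exI[of _ "set (take k zs)"] conjI ballI allI impI)
    show "card (set (take k zs)) = k"
      using zs len assms(4) by (simp add: distinct_card)
    show "d j \<le> d i" if "i \<in> set (take k zs)" "j \<notin> set (take k zs)" for i j
      using that top zs by (metis Un_iff UNIV_I append_take_drop_id set_append)
    show "ky_fan_norm k (U ** diagm d ** V) = sum d (set (take k zs))"
      using zs by (simp add: ky_fan_norm_def sv take_map sum_list_distinct_conv_sum_set)
  qed
qed

lemma orthogonal_row_sum:
  assumes "orthogonal_matrix (P :: real^'n^'n)"
  shows "(\<Sum>j\<in>UNIV. (P $ i $ j)\<^sup>2) = 1"
proof -
  have "(P ** transpose P) $ i $ i = 1" using assms by (simp add: orthogonal_matrixD mat_def)
  then show ?thesis by (simp add: matrix_matrix_mult_def transpose_def power2_eq_square)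
qed

lemma orthogonal_col_sum:
  assumes "orthogonal_matrix (P :: real^'n^'n)"
  shows "(\<Sum>i\<in>UNIV. (P $ i $ j)\<^sup>2) = 1"
  using orthogonal_row_sum[OF iffD2[OF orthogonal_matrix_transpose assms], of j] by (simp add: transpose_def)

text \<open>A threshold \<open>m\<close> separates the values on \<open>I\<close> from the others.
  Since \<open>t\<close> and the indicator of \<open>I\<close> have the same total, subtracting
  \<open>m\<close> from \<open>d\<close> does not change the difference of the two sides, and then
  every term is nonpositive.\<close>

lemma sum_le_top_sum:
  fixes d t :: "'n::finite \<Rightarrow> real"
  assumes top: "\<And>i j. i \<in> I \<Longrightarrow> j \<notin> I \<Longrightarrow> d j \<le> d i" and t: "\<And>i. 0 \<le> t i" "\<And>i. t i \<le> 1"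
    and tI: "(\<Sum>i\<in>UNIV. t i) = card I"
  shows "(\<Sum>i\<in>UNIV. d i * t i) \<le> sum d I"
proof -
  obtain m where m: "\<And>i. i \<in> I \<Longrightarrow> m \<le> d i" "\<And>j. j \<notin> I \<Longrightarrow> d j \<le> m"
  proof (cases "I = {}")
    case True
    \<comment> \<open>With \<open>I\<close> empty the threshold only has to bound all values from
      above.\<close>
    then show ?thesis using that[of "Max (range d)"] by simp
  next
    case False
    have "Min (d ` I) \<in> d ` I" using False by (intro Min_in) auto
    then show ?thesis using that[of "Min (d ` I)"] top by auto
  qed
  have "(\<Sum>i\<in>UNIV. d i * t i) - sum d I
      = (\<Sum>i\<in>UNIV. (d i - m) * (t i - (if i \<in> I then 1 else 0)))"
  proof -
    have *: "(\<Sum>i\<in>UNIV. f i * (if i \<in> I then 1 else 0)) = sum f I" for f :: "'n \<Rightarrow> real"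
      by (simp add: if_distrib sum.If_cases cong: if_cong)
    have "(\<Sum>i\<in>UNIV. (d i - m) * (t i - (if i \<in> I then 1 else 0)))
        = (\<Sum>i\<in>UNIV. d i * t i - m * t i - (d i - m) * (if i \<in> I then 1 else 0))"
      by (intro sum.cong refl) (simp add: algebra_simps)
    also have "\<dots> = (\<Sum>i\<in>UNIV. d i * t i) - m * (\<Sum>i\<in>UNIV. t i) - (\<Sum>i\<in>I. d i - m)"
      by (simp only: sum_subtractf * sum_distrib_left[symmetric])
    finally show ?thesis by (simp add: tI sum_subtractf)
  qed
  also have "\<dots> \<le> 0"
    using m t by (intro sum_nonpos) (auto simp: mult_nonneg_nonpos mult_nonpos_nonneg)
  finally show ?thesis by simp
qed

section \<open>The Ky Fan norm as a support function\<close>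

text \<open>The partial isometries of rank \<open>k\<close>: they are the extreme points of the dual unit ball.\<close>

definition pisom :: "nat \<Rightarrow> (real^'n^'n) set" where
  "pisom k = {U ** diagm (indicator J) ** V | U V J.
     orthogonal_matrix U \<and> orthogonal_matrix V \<and> card J = k}"

lemma pisomI: "orthogonal_matrix U \<Longrightarrow> orthogonal_matrix V \<Longrightarrow> card J = k \<Longrightarrow> U ** diagm (indicator J) ** V \<in> pisom k"
  unfolding pisom_def by blast

text \<open>The upper bound in Ky Fan's maximum principle. With the orthogonal factors collected in
  \<open>P\<close> and \<open>Q\<close>, the pairing consists of products
  \<open>P $ i $ j * Q $ j $ i\<close>; replacing them by mean squares yields a weighted sum of the
  \<open>d i\<close> whose weights \<open>t i\<close> lie between 0 and 1 and add up to the
  rank.\<close>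

lemma inner_pisom_le_top_sum:
  fixes U V W :: "real^'n^'n"
  assumes "orthogonal_matrix U" "orthogonal_matrix V" "\<And>i. 0 \<le> d i" "W \<in> pisom (card I)"
    and top: "\<And>i j. i \<in> I \<Longrightarrow> j \<notin> I \<Longrightarrow> d j \<le> d i"
  shows "(U ** diagm d ** V) \<bullet> W \<le> sum d I"
proof -
  obtain U' V' J where W: "W = U' ** diagm (indicator J) ** V'"
      "orthogonal_matrix U'" "orthogonal_matrix V'" "card J = card I"
    using assms(4) unfolding pisom_def by auto
  define P where "P = transpose U ** U'"
  define Q where "Q = V' ** transpose V"
  have PQ: "orthogonal_matrix P" "orthogonal_matrix Q"
    using assms W by (simp_all add: P_def Q_def orthogonal_matrix_mul)
  define t where "t i = (\<Sum>j\<in>J. ((P $ i $ j)\<^sup>2 + (Q $ j $ i)\<^sup>2) / 2)" for i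
  have "(U ** diagm d ** V) \<bullet> W = diagm d \<bullet> (P ** diagm (indicator J) ** Q)"
    by (simp add: W P_def Q_def inner_conj matrix_mul_assoc)
  also have "\<dots> = (\<Sum>i\<in>UNIV. d i * (\<Sum>j\<in>UNIV. (P ** diagm (indicator J)) $ i $ j * Q $ j $ i))"
    by (subst inner_commute) (simp add: inner_diagm matrix_matrix_mult_def mult.commute)
  also have "\<dots> = (\<Sum>i\<in>UNIV. d i * (\<Sum>j\<in>J. P $ i $ j * Q $ j $ i))"
  proof -
    have "(\<Sum>j\<in>UNIV. (P ** diagm (indicator J)) $ i $ j * Q $ j $ i) = (\<Sum>j\<in>J. P $ i $ j * Q $ j $ i)" for i
      by (rule sum.mono_neutral_cong_right) (auto simp: diagm_mult_right)
    then show ?thesis by simp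
  qed
  also have "\<dots> \<le> (\<Sum>i\<in>UNIV. d i * t i)"
  proof (intro sum_mono mult_left_mono assms)
    fix i
    have "a * b \<le> (a\<^sup>2 + b\<^sup>2) / 2" for a b :: real
      using sum_squares_bound[of a b] by simp
    then show "(\<Sum>j\<in>J. P $ i $ j * Q $ j $ i) \<le> t i"
      unfolding t_def by (intro sum_mono)
  qed
  also have "\<dots> \<le> sum d I"
  proof (rule sum_le_top_sum[OF top])
    show "0 \<le> t i" for i by (simp add: t_def sum_nonneg)
    show "t i \<le> 1" for i
    proof -
      have "t i \<le> (\<Sum>j\<in>UNIV. ((P $ i $ j)\<^sup>2 + (Q $ j $ i)\<^sup>2) / 2)"
        unfolding t_def by (intro sum_mono2) auto
      also have "\<dots> = 1"
        using orthogonal_row_sum[OF PQ(1), of i] orthogonal_col_sum[OF PQ(2), of i]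
        by (simp add: sum.distrib flip: sum_divide_distrib)
      finally show ?thesis .
    qed
    have "(\<Sum>i\<in>UNIV. t i) = (\<Sum>j\<in>J. \<Sum>i\<in>UNIV. ((P $ i $ j)\<^sup>2 + (Q $ j $ i)\<^sup>2) / 2)"
      unfolding t_def by (rule sum.swap)
    also have "\<dots> = (\<Sum>j\<in>J. 1)"
      using orthogonal_col_sum[OF PQ(1)] orthogonal_row_sum[OF PQ(2)]
      by (simp add: sum.distrib flip: sum_divide_distrib)
    finally show "(\<Sum>i\<in>UNIV. t i) = real (card I)" using W by simp
  qed auto
  finally show ?thesis .
qed

lemma inner_orthogonal_conj:
  fixes U V :: "real^'n^'n"
  assumes "orthogonal_matrix U" "orthogonal_matrix V"
  shows "(U ** A ** V) \<bullet> (U ** B ** V) = A \<bullet> B"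
proof -
  have "transpose U ** (U ** B ** V) ** transpose V = (transpose U ** U) ** B ** (V ** transpose V)"
    by (simp only: matrix_mul_assoc)
  then have "transpose U ** (U ** B ** V) ** transpose V = B"
    using assms by (simp add: orthogonal_matrixD)
  then show ?thesis by (simp only: inner_conj)
qed

lemma inner_diagm_indicator: "A \<bullet> diagm (indicator J) = (\<Sum>i\<in>J. A $ i $ i)"
  unfolding inner_diagm by (rule sum.mono_neutral_cong_right) auto

lemma ky_fan_attained:
  fixes A :: "real^'n^'n"
  assumes "k \<le> CARD('n)"
  obtains W where "W \<in> pisom k" "A \<bullet> W = ky_fan_norm k A"
proof -
  obtain U V d where *: "orthogonal_matrix U" "orthogonal_matrix V" "\<And>i. 0 \<le> d i" "A = U ** diagm d ** V"
    using svd[of A] by auto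
  obtain I where I: "card I = k" "ky_fan_norm k A = sum d I"
    using ky_fan_norm_svd[of U V d k] * assms by auto
  have "A \<bullet> (U ** diagm (indicator I) ** V) = sum d I"
    unfolding *(4) inner_orthogonal_conj[OF *(1,2)] inner_diagm_indicator by (simp add: diagm_nth)
  then show ?thesis using that[OF pisomI[OF *(1,2) I(1)]] I(2) by simp
qed

lemma inner_le_ky_fan:
  fixes A :: "real^'n^'n"
  assumes "k \<le> CARD('n)" "W \<in> pisom k"
  shows "A \<bullet> W \<le> ky_fan_norm k A"
proof -
  obtain U V d where *: "orthogonal_matrix U" "orthogonal_matrix V" "\<And>i. 0 \<le> d i" "A = U ** diagm d ** V"
    using svd[of A] by auto
  obtain I where I: "card I = k" "ky_fan_norm k A = sum d I" "\<And>i j. i \<in> I \<Longrightarrow> j \<notin> I \<Longrightarrow> d j \<le> d i"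
    using ky_fan_norm_svd[of U V d k] * assms by auto
  have "W \<in> pisom (card I)" using assms(2) I(1) by simp
  then show ?thesis
    using inner_pisom_le_top_sum[of U V d W I] * I by simp
qed

lemma pisom_mult:
  assumes "W \<in> pisom k" "orthogonal_matrix U" "orthogonal_matrix V"
  shows "U ** W ** V \<in> pisom k"
proof -
  obtain U' V' J where W: "W = U' ** diagm (indicator J) ** V'"
      "orthogonal_matrix U'" "orthogonal_matrix V'" "card J = k"
    using assms(1) unfolding pisom_def by auto
  have "U ** W ** V = (U ** U') ** diagm (indicator J) ** (V' ** V)"
    by (simp add: W matrix_mul_assoc)
  then show ?thesis using W assms pisomI orthogonal_matrix_mul by metis
qed

lemma pisom_minus: "W \<in> pisom k \<Longrightarrow> - W \<in> pisom k"
  using pisom_mult[of W k "- mat 1" "mat 1"] by (simp add: orthogonal_minus orthogonal_matrix_id matrix_minus_left)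

lemma pisom_transpose: "W \<in> pisom k \<Longrightarrow> transpose W \<in> pisom k"
proof -
  assume "W \<in> pisom k"
  then obtain U V J where W: "W = U ** diagm (indicator J) ** V"
      "orthogonal_matrix U" "orthogonal_matrix V" "card J = k"
    unfolding pisom_def by auto
  have "transpose W = transpose V ** diagm (indicator J) ** transpose U"
    by (simp add: W(1) matrix_transpose_mul matrix_mul_assoc)
  then show ?thesis using W by (simp add: pisomI)
qed

lemma pisom_inner_self: "W \<in> pisom k \<Longrightarrow> W \<bullet> W = real k"
  unfolding pisom_def by (auto simp: inner_orthogonal_conj inner_diagm_indicator diagm_nth)

text \<open>The equation of partial isometries. Together with the value of
  \<open>W \<bullet> W\<close> it characterises \<open>pisom k\<close>, see
  \<open>pisomI_cubic\<close>.\<close>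

lemma pisom_cubic:
  assumes "W \<in> pisom k"
  shows "W ** transpose W ** W = W"
proof -
  obtain U V J where W: "W = U ** diagm (indicator J) ** V"
      "orthogonal_matrix U" "orthogonal_matrix V"
    using assms(1) unfolding pisom_def by auto
  have "W ** transpose W ** W = U ** diagm (indicator J) ** (V ** transpose V) ** diagm (indicator J)
     ** (transpose U ** U) ** diagm (indicator J) ** V"
    by (simp only: W matrix_transpose_mul matrix_mul_assoc transpose_diagm)
  also have "\<dots> = U ** (diagm (indicator J) ** diagm (indicator J) ** diagm (indicator J)) ** V"
    using W by (simp add: orthogonal_matrixD matrix_mul_assoc)
  also have "\<dots> = W"
    by (simp add: diagm_mult_diagm W flip: indicator_inter_arith)
  finally show ?thesis .
qed

context
  fixes k :: nat
  assumes k_le: "k \<le> CARD('n::finite)"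
begin

lemma ky_fan_eqI:
  fixes A :: "real^'n^'n"
  assumes "\<And>W. W \<in> pisom k \<Longrightarrow> A \<bullet> W \<le> c" "W \<in> pisom k" "A \<bullet> W = c"
  shows "ky_fan_norm k A = c"
  by (metis assms inner_le_ky_fan[OF k_le] ky_fan_attained[OF k_le] order_antisym)

lemma ky_fan_triangle: "ky_fan_norm k (A + B) \<le> ky_fan_norm k A + ky_fan_norm k B" for A B :: "real^'n^'n"
proof -
  obtain W where W: "W \<in> pisom k" "(A + B) \<bullet> W = ky_fan_norm k (A + B)"
    using ky_fan_attained[OF k_le] by blast
  then show ?thesis
    using inner_le_ky_fan[OF k_le W(1), of A] inner_le_ky_fan[OF k_le W(1), of B]
    by (simp add: inner_add_left)
qed

lemma ky_fan_minus [simp]: "ky_fan_norm k (- A) = ky_fan_norm k A" for A :: "real^'n^'n"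
proof -
  have "ky_fan_norm k (- A) \<le> ky_fan_norm k A" for A :: "real^'n^'n"
  proof -
    obtain W where W: "W \<in> pisom k" "(- A) \<bullet> W = ky_fan_norm k (- A)"
      using ky_fan_attained[OF k_le] by blast
    then show ?thesis using inner_le_ky_fan[OF k_le pisom_minus[OF W(1)], of A] by simp
  qed
  from this[of A] this[of "- A"] show ?thesis by simp
qed

lemma ky_fan_scaleR: "ky_fan_norm k (c *\<^sub>R A) = \<bar>c\<bar> * ky_fan_norm k A" for A :: "real^'n^'n"
proof -
  have pos: "ky_fan_norm k (c *\<^sub>R A) = c * ky_fan_norm k A" if "c \<ge> 0" for c
  proof -
    obtain W where W: "W \<in> pisom k" "A \<bullet> W = ky_fan_norm k A"
      using ky_fan_attained[OF k_le] by blast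
    show ?thesis
      by (rule ky_fan_eqI[OF _ W(1)]) (use that W inner_le_ky_fan[OF k_le, of _ A] in \<open>auto intro: mult_left_mono\<close>)
  qed
  show ?thesis
  proof (cases "c \<ge> 0")
    case False
    have "ky_fan_norm k (c *\<^sub>R A) = ky_fan_norm k ((- c) *\<^sub>R A)"
      using ky_fan_minus[of "c *\<^sub>R A"] by simp
    then show ?thesis using pos[of "- c"] False by simp
  qed (simp add: pos)
qed

lemma ky_fan_0 [simp]: "ky_fan_norm k (0 :: real^'n^'n) = 0"
  using ky_fan_scaleR[of 0 0] by simp

lemma ky_fan_nonneg [simp]: "0 \<le> ky_fan_norm k A" for A :: "real^'n^'n"
  using ky_fan_triangle[of A "- A"] by simp

lemma ky_fan_orthogonal:
  fixes A :: "real^'n^'n"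
  assumes "orthogonal_matrix U" "orthogonal_matrix V"
  shows "ky_fan_norm k (U ** A ** V) = ky_fan_norm k A"
proof -
  obtain W where W: "W \<in> pisom k" "A \<bullet> W = ky_fan_norm k A"
    using ky_fan_attained[OF k_le] by blast
  show ?thesis
  proof (rule ky_fan_eqI)
    show "U ** W ** V \<in> pisom k" using assms W by (simp add: pisom_mult)
    show "(U ** A ** V) \<bullet> (U ** W ** V) = ky_fan_norm k A"
      using assms W by (simp add: inner_orthogonal_conj)
    fix W' :: "real^'n^'n" assume "W' \<in> pisom k"
    then have "transpose U ** W' ** transpose V \<in> pisom k" using assms by (simp add: pisom_mult)
    then show "(U ** A ** V) \<bullet> W' \<le> ky_fan_norm k A"
      by (simp add: inner_conj inner_le_ky_fan[OF k_le])
  qed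
qed

lemma ky_fan_transpose [simp]: "ky_fan_norm k (transpose A) = ky_fan_norm k A" for A :: "real^'n^'n"
proof -
  have "ky_fan_norm k (transpose A) \<le> ky_fan_norm k A" for A :: "real^'n^'n"
  proof -
    obtain W where W: "W \<in> pisom k" "transpose A \<bullet> W = ky_fan_norm k (transpose A)"
      using ky_fan_attained[OF k_le] by blast
    then show ?thesis
      using inner_le_ky_fan[OF k_le pisom_transpose[OF W(1)], of A] inner_transpose[of A "transpose W"] by simp
  qed
  from this[of A] this[of "transpose A"] show ?thesis by simp
qed

lemma ky_fan_eq_0_iff [simp]:
  fixes A :: "real^'n^'n"
  assumes "0 < k"
  shows "ky_fan_norm k A = 0 \<longleftrightarrow> A = 0"
proof
  assume 0: "ky_fan_norm k A = 0"
  obtain U V d where *: "orthogonal_matrix U" "orthogonal_matrix V" "\<And>i. 0 \<le> d i" "A = U ** diagm d ** V"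
    using svd[of A] by blast
  have "d i = 0" for i
  proof -
    \<comment> \<open>Any single index extends to a set of \<open>k\<close> indices, so every
      singular value is bounded by the pairing with some partial isometry.\<close>
    obtain J' where "J' \<subseteq> UNIV - {i}" "card J' = k - 1"
      using obtain_subset_with_card_n[of "k - 1" "UNIV - {i}"] diff_le_mono[OF k_le, of 1] by (auto simp: card_Diff_singleton)
    then have J: "card (insert i J') = k" using assms finite_subset[of J' UNIV] by (subst card_insert_disjoint) auto
    have "d i \<le> sum d (insert i J')"
      by (rule member_le_sum) (use * in auto)
    also have "\<dots> = A \<bullet> (U ** diagm (indicator (insert i J')) ** V)"
      unfolding *(4) inner_orthogonal_conj[OF *(1,2)] inner_diagm_indicator by (simp add: diagm_nth)
    also have "\<dots> \<le> 0"
      using inner_le_ky_fan[OF k_le pisomI[OF *(1,2) J], of A] 0 by simp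
    finally show ?thesis using *(3)[of i] by simp
  qed
  then have "diagm d = 0" by (simp add: vec_eq_iff diagm_nth)
  then show "A = 0" by (simp add: *(4))
qed simp

lemma ky_fan_le_norm: "ky_fan_norm k A \<le> norm A * sqrt k" for A :: "real^'n^'n"
proof -
  obtain W where W: "W \<in> pisom k" "A \<bullet> W = ky_fan_norm k A"
    using ky_fan_attained[OF k_le] by blast
  have "norm W = sqrt k" using pisom_inner_self[OF W(1)] by (simp add: norm_eq_sqrt_inner)
  then show ?thesis using W(2) norm_cauchy_schwarz[of A W] by simp
qed

lemma continuous_on_ky_fan [continuous_intros]:
  fixes f :: "'t::topological_space \<Rightarrow> real^'n^'n"
  assumes "continuous_on S f"
  shows "continuous_on S (\<lambda>x. ky_fan_norm k (f x))"
proof -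
  have le: "ky_fan_norm k A - ky_fan_norm k B \<le> sqrt k * dist A B" for A B :: "real^'n^'n"
    using ky_fan_triangle[of "A - B" B] ky_fan_le_norm[of "A - B"] by (simp add: dist_norm mult.commute)
  have "(sqrt k)-lipschitz_on UNIV (\<lambda>A :: real^'n^'n. ky_fan_norm k A)"
  proof (rule lipschitz_onI)
    show "dist (ky_fan_norm k A) (ky_fan_norm k B) \<le> sqrt k * dist A B" for A B :: "real^'n^'n"
      using le[of A B] le[of B A] by (simp add: dist_real_def abs_le_iff dist_commute)
  qed simp
  then have "continuous_on UNIV (\<lambda>A :: real^'n^'n. ky_fan_norm k A)"
    by (rule lipschitz_on_continuous_on)
  then show ?thesis using continuous_on_compose2[OF _ assms] by auto
qed

text \<open>The pairing with a partial isometry is a sum of \<open>k\<close> values of the bilinear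
  form of \<open>A\<close> at unit vectors, and for a contraction none of them exceeds 1.\<close>

lemma ky_fan_le_contraction:
  fixes A :: "real^'n^'n"
  assumes "\<And>x. norm (A *v x) \<le> norm x"
  shows "ky_fan_norm k A \<le> k"
proof -
  obtain W where W: "W \<in> pisom k" "A \<bullet> W = ky_fan_norm k A"
    using ky_fan_attained[OF k_le] by blast
  then obtain U V J where *: "W = U ** diagm (indicator J) ** V"
      "orthogonal_matrix U" "orthogonal_matrix V" "card J = k"
    unfolding pisom_def by auto
  have "A \<bullet> W = (transpose U ** A ** transpose V) \<bullet> diagm (indicator J)"
    by (simp add: inner_conj *)
  also have "\<dots> = (\<Sum>i\<in>J. (transpose U ** A ** transpose V) $ i $ i)"
    by (rule inner_diagm_indicator)
  also have "\<dots> \<le> (\<Sum>i\<in>J. 1)"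
  proof (rule sum_mono)
    fix i
    have "(transpose U ** A ** transpose V) $ i $ i = outer (axis i 1) (axis i 1) \<bullet> (transpose U ** A ** transpose V)"
      by (simp add: inner_outer matrix_vector_mult_basis column_def)
    also have "\<dots> = outer (U *v axis i 1) (transpose V *v axis i 1) \<bullet> A"
      using inner_conj[of "transpose U" A "transpose V" "outer (axis i 1) (axis i 1)"]
      by (simp add: mult_outer outer_mult inner_commute)
    also have "\<dots> \<le> norm (U *v axis i 1) * norm (A *v (transpose V *v axis i 1))"
      unfolding inner_outer by (rule norm_cauchy_schwarz)
    also have "\<dots> \<le> 1"
      using assms[of "transpose V *v axis i 1"] * by (simp add: orthogonal_norm)
    finally show "(transpose U ** A ** transpose V) $ i $ i \<le> 1" .
  qed
  finally show ?thesis using W * by simp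
qed

end

section \<open>Aligned matrices and faces\<close>

definition aligned :: "nat \<Rightarrow> real^'n^'n \<Rightarrow> real^'n^'n \<Rightarrow> bool" where
  "aligned k A B \<longleftrightarrow> ky_fan_norm k (A + B) = ky_fan_norm k A + ky_fan_norm k B"

definition face :: "nat \<Rightarrow> real^'n^'n \<Rightarrow> (real^'n^'n) set" where
  "face k W = {A. A \<bullet> W = ky_fan_norm k A}"

lemma face_iff: "A \<in> face k W \<longleftrightarrow> A \<bullet> W = ky_fan_norm k A"
  by (simp add: face_def)

context
  fixes k :: nat
  assumes k_le: "k \<le> CARD('n::finite)"
begin

lemma face_exists:
  fixes A :: "real^'n^'n"
  obtains W where "W \<in> pisom k" "A \<in> face k W"
  using ky_fan_attained[OF k_le] by (metis face_iff)

lemma aligned_imp_face: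
  fixes A :: "real^'n^'n"
  assumes "aligned k A B" "W \<in> pisom k" "A + B \<in> face k W"
  shows "A \<in> face k W" "B \<in> face k W"
  using assms inner_le_ky_fan[OF k_le assms(2), of A] inner_le_ky_fan[OF k_le assms(2), of B]
  by (auto simp: face_iff aligned_def inner_add_left)

lemma face_add:
  fixes A :: "real^'n^'n"
  assumes "W \<in> pisom k" "A \<in> face k W" "B \<in> face k W"
  shows "A + B \<in> face k W" "aligned k A B"
  using assms inner_le_ky_fan[OF k_le assms(1), of "A + B"] ky_fan_triangle[OF k_le, of A B]
  by (auto simp: face_iff aligned_def inner_add_left)

lemma face_scaleR:
  fixes A :: "real^'n^'n"
  assumes "A \<in> face k W" "c \<ge> 0"
  shows "c *\<^sub>R A \<in> face k W"
  using assms by (simp add: face_iff ky_fan_scaleR[OF k_le])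

lemma aligned_iff_face:
  fixes A :: "real^'n^'n"
  shows "aligned k A B \<longleftrightarrow> (\<exists>W \<in> pisom k. A \<in> face k W \<and> B \<in> face k W)"
proof
  assume "aligned k A B"
  moreover obtain W where "W \<in> pisom k" "A + B \<in> face k W" using face_exists by blast
  ultimately show "\<exists>W \<in> pisom k. A \<in> face k W \<and> B \<in> face k W" using aligned_imp_face by blast
qed (use face_add in blast)

lemma aligned_scaleR:
  fixes A :: "real^'n^'n"
  assumes "aligned k A B" "a \<ge> 0" "b \<ge> 0"
  shows "aligned k (a *\<^sub>R A) (b *\<^sub>R B)"
  using assms face_scaleR unfolding aligned_iff_face by blast

lemma aligned_0: "aligned k 0 A" "aligned k A 0" for A :: "real^'n^'n"
  by (simp_all add: aligned_def k_le)

lemma aligned_if_parallel_preserving: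
  fixes T :: "real^'n^'n \<Rightarrow> real^'n^'n"
  assumes k0: "0 < k" and T: "linear T" "inj T"
    and par: "\<And>A B. parallel_wrt (ky_fan_norm k) A B \<Longrightarrow> parallel_wrt (ky_fan_norm k) (T A) (T B)"
    and AB: "aligned k A B"
  shows "aligned k (T A) (T B)"
proof (cases "A = 0 \<or> B = 0")
  case True
  then show ?thesis using aligned_0 linear_0[OF T(1)] by auto
next
  case False
  let ?N = "ky_fan_norm k"
  define C where "C t = (1 - t) *\<^sub>R A + t *\<^sub>R B" for t :: real
  define g where "g t = ?N (T (C t))" for t
  obtain W where W: "W \<in> pisom k" "A \<in> face k W" "B \<in> face k W"
    using AB aligned_iff_face by blast
  have C_face: "C t \<in> face k W" if "t \<in> {0..1}" for t
    unfolding C_def using that W by (intro face_add face_scaleR) auto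
  \<comment> \<open>On a common face the norm is affine along the segment, hence stays
    positive.\<close>
  have "C t \<noteq> 0" if "t \<in> {0..1}" for t
  proof -
    have "?N (C t) = (1 - t) * ?N A + t * ?N B"
      using C_face[OF that] W by (simp add: face_iff C_def inner_add_left)
    moreover have "?N A > 0" "?N B > 0"
      using False k0 ky_fan_nonneg[OF k_le, of A] ky_fan_nonneg[OF k_le, of B]
        ky_fan_eq_0_iff[OF k_le k0, of A] ky_fan_eq_0_iff[OF k_le k0, of B] by linarith+
    then have "(1 - t) * ?N A + t * ?N B > 0"
      using that by (cases "t = 1") (auto intro!: add_pos_nonneg mult_pos_pos)
    ultimately show ?thesis using ky_fan_0[OF k_le] by force
  qed
  then have g_pos: "g t > 0" if "t \<in> {0..1}" for t
    using that k0 ky_fan_nonneg[OF k_le, of "T (C t)"] ky_fan_eq_0_iff[OF k_le k0, of "T (C t)"] linear_injective_0[OF T(1)] T(2)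
    unfolding g_def by (metis order_le_less)
  have "continuous_on {0..1} g"
    unfolding g_def C_def using T(1)
    by (intro continuous_on_ky_fan[OF k_le] linear_continuous_on_compose[OF _ T(1)] continuous_intros)
  then obtain t0 where t0: "t0 \<in> {0..1}" "\<And>t. t \<in> {0..1} \<Longrightarrow> g t0 \<le> g t"
    using continuous_attains_inf[of "{0..1::real}" g] by auto
  define D where "D = ?N (T (A - B))"
  \<comment> \<open>For parameters \<open>1 / n\<close> apart the difference of the images has norm
    \<open>D / n\<close>. It is smaller than \<open>2 * g t0\<close>, where \<open>g t0\<close> is
    the minimum of \<open>g\<close>, and this excludes the sign -1 in the parallelism of the
    images.\<close>
  obtain n where n: "D / (2 * g t0) < real n" using reals_Archimedean2 by blast
  have D: "D \<ge> 0" by (simp add: D_def k_le)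
  then have n0: "n > 0" using n g_pos[OF t0(1)] by (cases n) (auto simp: divide_less_0_iff)
  have Dn: "D / n < 2 * g t0"
    using n n0 g_pos[OF t0(1)] by (simp add: field_simps)
  have mid: "g s + g t = 2 * g ((s + t) / 2)" if st: "s \<in> {0..1}" "t \<in> {0..1}" "\<bar>s - t\<bar> = 1 / n" for s t
  proof -
    have "aligned k (C s) (C t)" using W C_face st face_add by blast
    then have "parallel_wrt ?N (C s) (C t)"
      unfolding parallel_wrt_def aligned_def by (intro bexI[of _ 1]) auto
    then obtain \<mu> :: real where \<mu>: "\<mu> = -1 \<or> \<mu> = 1" "?N (T (C s) + \<mu> *\<^sub>R T (C t)) = g s + g t"
      using par unfolding parallel_wrt_def g_def by blast
    have "?N (T (C s) - T (C t)) = \<bar>t - s\<bar> * D"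
    proof -
      have "T (C s) - T (C t) = (t - s) *\<^sub>R T (A - B)"
        unfolding C_def using T(1)
        by (simp add: linear_add linear_diff linear_scale algebra_simps)
      then show ?thesis by (simp add: D_def ky_fan_scaleR[OF k_le])
    qed
    then have "?N (T (C s) - T (C t)) < g s + g t"
      using st Dn t0(2)[of s] t0(2)[of t] by (simp add: abs_minus_commute)
    then have "\<mu> = 1" using \<mu> by auto
    then have "?N (T (C s) + T (C t)) = g s + g t" using \<mu> by simp
    moreover have "T (C s) + T (C t) = 2 *\<^sub>R T (C ((s + t) / 2))"
    proof -
      have "C s + C t = 2 *\<^sub>R C ((s + t) / 2)"
      proof -
        have "2 *\<^sub>R C m = (2 - 2 * m) *\<^sub>R A + (2 * m) *\<^sub>R B" for m
          by (simp add: C_def algebra_simps)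
        moreover have "C s + C t = (2 - (s + t)) *\<^sub>R A + (s + t) *\<^sub>R B"
          by (simp add: C_def algebra_simps scaleR_2)
        moreover have "2 * ((s + t) / 2) = s + t" by simp
        ultimately show ?thesis by metis
      qed
      then show ?thesis using T(1) by (metis linear_add linear_scale)
    qed
    ultimately show ?thesis by (simp add: ky_fan_scaleR[OF k_le] g_def)
  qed
  \<comment> \<open>The grid has half the step \<open>1 / n\<close>: the two neighbours of an
    interior grid point are then exactly \<open>1 / n\<close> apart, and \<open>mid\<close> applies
    to them.\<close>
  define a where "a i = g (real i / (2 * n))" for i
  have step: "a i + a (i + 2) = 2 * a (i + 1)" if "i + 2 \<le> 2 * n" for i
  proof -
    have "real (i + 2) \<le> real (2 * n)" using that by (simp only: of_nat_le_iff)
    then have "g (real i / (2 * n)) + g (real (i + 2) / (2 * n)) = 2 * g ((real i / (2 * n) + real (i + 2) / (2 * n)) / 2)"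
      using n0 by (intro mid) (auto simp: field_simps diff_divide_distrib[symmetric])
    moreover have "(real i / (2 * n) + real (i + 2) / (2 * n)) / 2 = real (i + 1) / (2 * n)"
      using n0 by (simp add: field_simps)
    ultimately show ?thesis by (simp only: a_def)
  qed
  \<comment> \<open>Vanishing second differences give an arithmetic progression, whose middle value
    is the mean of its ends; this is alignment of the images.\<close>
  have "a i = a 0 + i * (a 1 - a 0) \<and> a (Suc i) = a 0 + Suc i * (a 1 - a 0)" if "i + 1 \<le> 2 * n" for i
    using that
  proof (induction i)
    case (Suc i)
    then show ?case using step[of i] by (simp add: algebra_simps)
  qed simp
  from this[of "n"] this[of "2 * n - 1"] have "2 * a n = a 0 + a (2 * n)"
    using n0 by (simp add: algebra_simps)
  then have "2 * g (1 / 2) = g 0 + g 1"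
    using n0 by (simp add: a_def)
  moreover have "2 * g (1 / 2) = ?N (2 *\<^sub>R T (C (1 / 2)))"
    by (simp add: g_def ky_fan_scaleR[OF k_le])
  moreover have "2 *\<^sub>R T (C (1 / 2)) = T A + T B"
    using T(1) by (simp add: C_def linear_add linear_scale algebra_simps)
  ultimately show ?thesis by (simp add: aligned_def g_def C_def)
qed

end

section \<open>The inverse map preserves alignment\<close>

text \<open>For a partial isometry \<open>W\<close> of rank \<open>k\<close> this is the linear span of \<open>face k W\<close>.\<close>

definition bisym :: "real^'n^'n \<Rightarrow> (real^'n^'n) set" where
  "bisym W = {A. transpose (transpose W ** A) = transpose W ** A \<and> transpose (A ** transpose W) = A ** transpose W}"

lemma subspace_bisym: "subspace (bisym W)"
  by (auto simp: subspace_def bisym_def matrix_distribs)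

text \<open>Among the partial isometries \<open>W ** R\<close> and \<open>R ** W\<close> with
  orthogonal \<open>R\<close>, the matrix \<open>W\<close> maximises the pairing with
  \<open>A\<close>; the first order condition makes both products symmetric.\<close>

lemma face_subset_bisym:
  fixes W :: "real^'n^'n"
  assumes k_le: "k \<le> CARD('n)" and W: "W \<in> pisom k"
  shows "face k W \<subseteq> bisym W"
proof
  fix A assume A: "A \<in> face k W"
  have "transpose (transpose W ** A) = transpose W ** A"
  proof (rule symmetric_if_max)
    fix R :: "real^'n^'n" assume "orthogonal_matrix R"
    then have "W ** R \<in> pisom k" using pisom_mult[OF W orthogonal_matrix_id, of R] by simp
    then have "A \<bullet> (W ** R) \<le> A \<bullet> W" using A inner_le_ky_fan[OF k_le] by (simp add: face_iff)
    then show "(transpose W ** A) \<bullet> R \<le> (transpose W ** A) \<bullet> mat 1"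
      by (simp add: inner_matmul_left)
  qed
  moreover have "transpose (A ** transpose W) = A ** transpose W"
  proof (rule symmetric_if_max)
    fix R :: "real^'n^'n" assume "orthogonal_matrix R"
    then have "R ** W \<in> pisom k" using pisom_mult[OF W _ orthogonal_matrix_id, of R] by simp
    then have "A \<bullet> (R ** W) \<le> A \<bullet> W" using A inner_le_ky_fan[OF k_le] by (simp add: face_iff)
    then show "(A ** transpose W) \<bullet> R \<le> (A ** transpose W) \<bullet> mat 1"
      by (simp add: inner_matmul_right)
  qed
  ultimately show "A \<in> bisym W" by (simp add: bisym_def)
qed

lemma orthogonal_conj_inverse:
  fixes U V :: "real^'n^'n"
  assumes "orthogonal_matrix U" "orthogonal_matrix V"
  shows "transpose U ** (U ** A ** V) ** transpose V = A" "U ** (transpose U ** A ** transpose V) ** V = A"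
proof -
  have "transpose U ** (U ** A ** V) ** transpose V = (transpose U ** U) ** A ** (V ** transpose V)"
    "U ** (transpose U ** A ** transpose V) ** V = (U ** transpose U) ** A ** (transpose V ** V)"
    by (simp_all only: matrix_mul_assoc)
  then show "transpose U ** (U ** A ** V) ** transpose V = A" "U ** (transpose U ** A ** transpose V) ** V = A"
    using assms by (simp_all add: orthogonal_matrixD)
qed

lemma linear_conj: "linear (\<lambda>A. U ** A ** V)" for U :: "real^'n^'n" and V :: "real^'n^'n"
  by (rule linearI) (simp_all add: matrix_distribs)

lemma inj_conj:
  fixes U V :: "real^'n^'n"
  assumes "orthogonal_matrix U" "orthogonal_matrix V"
  shows "inj (\<lambda>A. U ** A ** V)"
  by (rule inj_on_inverseI[where g = "\<lambda>A. transpose U ** A ** transpose V"])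
     (simp add: orthogonal_conj_inverse assms)

lemma bisym_conj:
  fixes U V W :: "real^'n^'n"
  assumes "orthogonal_matrix U" "orthogonal_matrix V"
  shows "U ** A ** V \<in> bisym (U ** W ** V) \<longleftrightarrow> A \<in> bisym W"
proof -
  have 1: "transpose (U ** W ** V) ** (U ** A ** V) = transpose V ** (transpose W ** A) ** V"
  proof -
    have "transpose (U ** W ** V) ** (U ** A ** V) = transpose V ** (transpose W ** (transpose U ** U) ** A) ** V"
      by (simp only: matrix_transpose_mul matrix_mul_assoc)
    then show ?thesis using assms by (simp add: orthogonal_matrixD)
  qed
  have 2: "(U ** A ** V) ** transpose (U ** W ** V) = U ** (A ** transpose W) ** transpose U"
  proof -
    have "(U ** A ** V) ** transpose (U ** W ** V) = U ** (A ** (V ** transpose V) ** transpose W) ** transpose U"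
      by (simp only: matrix_transpose_mul matrix_mul_assoc)
    then show ?thesis using assms by (simp add: orthogonal_matrixD)
  qed
  have "transpose (Q ** M ** transpose Q) = Q ** M ** transpose Q \<longleftrightarrow> transpose M = M"
    if "orthogonal_matrix Q" for Q M :: "real^'n^'n"
  proof -
    have "transpose (Q ** M ** transpose Q) = Q ** transpose M ** transpose Q"
      by (simp add: matrix_transpose_mul matrix_mul_assoc)
    then show ?thesis
      using inj_conj[of Q "transpose Q"] that by (auto simp: inj_def)
  qed
  from this[of "transpose V" "transpose W ** A"] this[of U "A ** transpose W"]
  show ?thesis using assms unfolding bisym_def mem_Collect_eq 1 2 by simp
qed

lemma bisym_conj_image:
  fixes U V W :: "real^'n^'n"
  assumes "orthogonal_matrix U" "orthogonal_matrix V"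
  shows "bisym (U ** W ** V) = (\<lambda>A. U ** A ** V) ` bisym W"
proof
  show "bisym (U ** W ** V) \<subseteq> (\<lambda>A. U ** A ** V) ` bisym W"
  proof
    fix B assume "B \<in> bisym (U ** W ** V)"
    then have "transpose U ** B ** transpose V \<in> bisym W"
      using bisym_conj[OF assms, of "transpose U ** B ** transpose V" W]
      by (simp add: orthogonal_conj_inverse assms)
    moreover have "B = U ** (transpose U ** B ** transpose V) ** V"
      by (simp add: orthogonal_conj_inverse assms)
    ultimately show "B \<in> (\<lambda>A. U ** A ** V) ` bisym W" by blast
  qed
qed (use bisym_conj[OF assms] in auto)

lemma face_conj:
  fixes U V W :: "real^'n^'n"
  assumes "k \<le> CARD('n)" "orthogonal_matrix U" "orthogonal_matrix V"
  shows "U ** A ** V \<in> face k (U ** W ** V) \<longleftrightarrow> A \<in> face k W"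
  using assms by (simp add: face_iff inner_orthogonal_conj ky_fan_orthogonal)

section \<open>Permutation matrices and the choice of the index set\<close>

definition permm :: "('n \<Rightarrow> 'n) \<Rightarrow> real^'n^'n" where
  "permm \<pi> = (\<chi> i j. if i = \<pi> j then 1 else 0)"

lemma permm_diagm_conj:
  assumes "bij \<pi>"
  shows "permm \<pi> ** diagm d ** transpose (permm \<pi>) = diagm (d \<circ> inv \<pi>)"
proof -
  have "(permm \<pi> ** diagm d ** transpose (permm \<pi>)) $ a $ b = diagm (d \<circ> inv \<pi>) $ a $ b" for a b
  proof -
    have "(permm \<pi> ** diagm d ** transpose (permm \<pi>)) $ a $ b
       = (\<Sum>j\<in>UNIV. (permm \<pi> ** diagm d) $ a $ j * transpose (permm \<pi>) $ j $ b)"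
      by (simp add: matrix_matrix_mult_def)
    also have "\<dots> = (\<Sum>j\<in>UNIV. if j = inv \<pi> a then (if a = b then d (inv \<pi> a) else 0) else 0)"
      using assms by (intro sum.cong refl)
        (auto simp: diagm_mult_right transpose_def permm_def bij_inv_eq_iff inv_f_f[OF bij_is_inj[OF assms]])
    finally show ?thesis by (simp add: diagm_nth)
  qed
  then show ?thesis by (simp add: vec_eq_iff)
qed

lemma orthogonal_permm: "bij \<pi> \<Longrightarrow> orthogonal_matrix (permm \<pi>)"
  using permm_diagm_conj[of \<pi> "\<lambda>_. 1"] matrix_left_right_inverse[of "permm \<pi>" "transpose (permm \<pi>)"]
  by (simp add: orthogonal_matrix comp_def diagm_1)

lemma exists_bij_image_eq:
  fixes I J :: "'n::finite set"
  assumes "card I = card J"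
  obtains \<pi> :: "'n \<Rightarrow> 'n" where "bij \<pi>" "\<pi> ` I = J"
proof -
  obtain f where f: "bij_betw f I J" using assms by (metis finite finite_same_card_bij)
  have "card (- I) = card (- J)" using assms by (simp add: Compl_eq_Diff_UNIV card_Diff_subset)
  then obtain g where g: "bij_betw g (- I) (- J)" by (metis finite finite_same_card_bij)
  define \<pi> where "\<pi> x = (if x \<in> I then f x else g x)" for x
  have "bij_betw \<pi> I J" "bij_betw \<pi> (- I) (- J)"
    using f g bij_betw_cong[of I \<pi> f J] bij_betw_cong[of "- I" \<pi> g "- J"] by (auto simp: \<pi>_def)
  then have "bij_betw \<pi> (I \<union> - I) (J \<union> - J)" "\<pi> ` I = J"
    using bij_betw_combine[of \<pi> I J "- I" "- J"] by (auto simp: bij_betw_def)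
  then show ?thesis using that by simp
qed

lemma diagm_indicator_conj:
  fixes I J :: "'n::finite set"
  assumes "card I = card J"
  obtains P :: "real^'n^'n" where "orthogonal_matrix P" "diagm (indicator J) = P ** diagm (indicator I) ** transpose P"
proof -
  obtain \<pi> :: "'n \<Rightarrow> 'n" where p: "bij \<pi>" "\<pi> ` I = J" using exists_bij_image_eq[OF assms] by blast
  have "indicator I \<circ> inv \<pi> = (indicator J :: 'n \<Rightarrow> real)"
    using p by (auto simp: fun_eq_iff indicator_def bij_inv_eq_iff image_iff) (metis bij_inv_eq_iff)+
  then show ?thesis using that[OF orthogonal_permm[OF p(1)]] permm_diagm_conj[OF p(1)] by metis
qed

text \<open>The partial isometries of one rank form a single orbit under orthogonal factors on both
  sides, so the index set may be prescribed; \<open>dim_bisym_eq\<close> rests on this.\<close>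

lemma pisom_eq:
  fixes W :: "real^'n^'n"
  assumes "W \<in> pisom k" "card J = k"
  obtains U V where "orthogonal_matrix U" "orthogonal_matrix V" "W = U ** diagm (indicator J) ** V"
proof -
  obtain U V I where W: "W = U ** diagm (indicator I) ** V"
      "orthogonal_matrix U" "orthogonal_matrix V" "card I = k"
    using assms(1) unfolding pisom_def by auto
  obtain P :: "real^'n^'n" where P: "orthogonal_matrix P" "diagm (indicator I) = P ** diagm (indicator J) ** transpose P"
    using diagm_indicator_conj[of J I] W(4) assms(2) by auto
  have "W = (U ** P) ** diagm (indicator J) ** (transpose P ** V)"
    by (simp add: W(1) P(2) matrix_mul_assoc)
  then show ?thesis using that W P by (metis orthogonal_matrix_mul orthogonal_matrix_transpose)
qed

lemma diagm_indicator_pisom: "card J = k \<Longrightarrow> diagm (indicator J) \<in> pisom k"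
  using pisomI[OF orthogonal_matrix_id orthogonal_matrix_id, of J k] by simp

lemma dim_bisym_eq:
  fixes W W' :: "real^'n^'n"
  assumes "W \<in> pisom k" "W' \<in> pisom k"
  shows "dim (bisym W) = dim (bisym W')"
proof -
  obtain U' V' J where W': "W' = U' ** diagm (indicator J) ** V'"
      "orthogonal_matrix U'" "orthogonal_matrix V'" "card J = k"
    using assms(2) unfolding pisom_def by auto
  obtain U V where W: "orthogonal_matrix U" "orthogonal_matrix V" "W = U ** diagm (indicator J) ** V"
    using pisom_eq[OF assms(1) W'(4)] by blast
  have "dim ((\<lambda>A. U ** A ** V) ` S) = dim S" if "orthogonal_matrix U" "orthogonal_matrix V"
    for U V :: "real^'n^'n" and S
    by (rule dim_image_eq[OF linear_conj]) (use inj_conj[OF that] in \<open>auto intro: inj_on_subset\<close>)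
  then show ?thesis using W W' by (simp add: bisym_conj_image)
qed

text \<open>Read in blocks along \<open>J\<close> and its complement: the complementary block does
  not occur on the right because it is arbitrary.\<close>

lemma bisym_diagm_indicator:
  "A \<in> bisym (diagm (indicator J)) \<longleftrightarrow>
    (\<forall>i\<in>J. \<forall>j\<in>J. A $ i $ j = A $ j $ i) \<and> (\<forall>i\<in>J. \<forall>j. j \<notin> J \<longrightarrow> A $ i $ j = 0 \<and> A $ j $ i = 0)"
proof -
  let ?c = "indicator J :: 'a \<Rightarrow> real"
  have "A \<in> bisym (diagm ?c) \<longleftrightarrow> (\<forall>i j. ?c j * A $ j $ i = ?c i * A $ i $ j \<and> A $ j $ i * ?c i = A $ i $ j * ?c j)"
    by (auto simp: bisym_def vec_eq_iff transpose_def[of "_ ** _"] diagm_mult_left diagm_mult_right)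
  also have "\<dots> \<longleftrightarrow> (\<forall>i\<in>J. \<forall>j\<in>J. A $ i $ j = A $ j $ i) \<and> (\<forall>i\<in>J. \<forall>j. j \<notin> J \<longrightarrow> A $ i $ j = 0 \<and> A $ j $ i = 0)"
    (is "?L \<longleftrightarrow> ?R")
  proof
    assume L: ?L
    show ?R
    proof (intro conjI ballI allI impI)
      show "A $ i $ j = A $ j $ i" if "i \<in> J" "j \<in> J" for i j using L[rule_format, of i j] that by simp
      show "A $ i $ j = 0" "A $ j $ i = 0" if "i \<in> J" "j \<notin> J" for i j
        using L[rule_format, of i j] that by simp_all
    qed
  next
    assume R: ?R
    show ?L
    proof (intro allI)
      fix i j
      show "?c j * A $ j $ i = ?c i * A $ i $ j \<and> A $ j $ i * ?c i = A $ i $ j * ?c j"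
        using R by (cases "i \<in> J"; cases "j \<in> J") simp_all
    qed
  qed
  finally show ?thesis .
qed

section \<open>Members of a face and its linear span\<close>

lemma norm_pisom_vmult_le:
  assumes "W \<in> pisom k"
  shows "norm (W *v x) \<le> norm x"
proof -
  obtain U V J where W: "W = U ** diagm (indicator J) ** V"
      "orthogonal_matrix U" "orthogonal_matrix V"
    using assms unfolding pisom_def by auto
  have "norm (W *v x) = norm (diagm (indicator J) *v (V *v x))"
    by (simp add: W(1) orthogonal_norm[OF W(2)] flip: matrix_vector_mul_assoc)
  also have "\<dots> \<le> norm (V *v x)"
    unfolding norm_vec_def by (intro L2_set_mono) (auto simp: diagm_vmult indicator_def)
  finally show ?thesis by (simp add: orthogonal_norm[OF W(3)])
qed

lemma ky_fan_outer_le: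
  fixes x y :: "real^'n"
  assumes "k \<le> CARD('n)"
  shows "ky_fan_norm k (outer x y) \<le> norm x * norm y"
proof -
  obtain W where W: "W \<in> pisom k" "outer x y \<bullet> W = ky_fan_norm k (outer x y)"
    using ky_fan_attained[OF assms] by blast
  have "outer x y \<bullet> W \<le> norm x * norm (W *v y)"
    unfolding inner_outer by (rule norm_cauchy_schwarz)
  also have "\<dots> \<le> norm x * norm y"
    by (intro mult_left_mono norm_pisom_vmult_le[OF W(1)]) auto
  finally show ?thesis using W by simp
qed

lemma outer_in_face:
  fixes W :: "real^'n^'n"
  assumes "k \<le> CARD('n)" "W \<in> pisom k" "x \<bullet> (W *v y) = norm x * norm y"
  shows "outer x y \<in> face k W"
  using ky_fan_outer_le[OF assms(1), of x y] inner_le_ky_fan[OF assms(1,2), of "outer x y"] assms(3)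
  by (simp add: face_iff inner_outer)

lemma outer_in_face_diagm:
  fixes x :: "real^'n"
  assumes "card J = k" "\<And>i. i \<notin> J \<Longrightarrow> x $ i = 0"
  shows "outer x x \<in> face k (diagm (indicator J))"
proof (rule outer_in_face)
  have "diagm (indicator J) *v x = x"
    using assms(2) by (auto simp: vec_eq_iff diagm_vmult indicator_def)
  then show "x \<bullet> (diagm (indicator J) *v x) = norm x * norm x"
    by (simp add: dot_square_norm power2_eq_square)
  show "k \<le> CARD('n)" using assms(1) card_mono[of "UNIV :: 'n set" J] by auto
qed (use diagm_indicator_pisom assms in auto)

lemma pisom_in_face:
  fixes W :: "real^'n^'n"
  assumes "k \<le> CARD('n)" "W \<in> pisom k"
  shows "W \<in> face k W"
proof -
  have "ky_fan_norm k W \<le> k"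
    by (rule ky_fan_le_contraction[OF assms(1) norm_pisom_vmult_le[OF assms(2)]])
  then show ?thesis
    using inner_le_ky_fan[OF assms, of W] pisom_inner_self[OF assms(2)] by (simp add: face_iff)
qed

lemma ky_fan_pisom:
  fixes W :: "real^'n^'n"
  assumes "k \<le> CARD('n)" "W \<in> pisom k"
  shows "ky_fan_norm k W = k"
  using pisom_in_face[OF assms] pisom_inner_self[OF assms(2)] by (simp add: face_iff)

lemma pisom_eqI:
  fixes W :: "real^'n^'n"
  assumes "W \<in> pisom k" "W' \<in> pisom k" "W \<bullet> W' = k"
  shows "W = W'"
proof -
  have "(W - W') \<bullet> (W - W') = 0"
    using assms by (simp add: inner_diff_left inner_diff_right pisom_inner_self inner_commute)
  then show ?thesis by simp
qed

text \<open>Adding \<open>W\<close> moves a point of its face to a place that no other face reaches: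
  \<open>W\<close> itself would lie in \<open>face k W'\<close>, and then the inner product of
  \<open>W\<close> and \<open>W'\<close> equals both norm squares.\<close>

lemma pisom_face_unique:
  fixes W :: "real^'n^'n"
  assumes k: "k \<le> CARD('n)" and W: "W \<in> pisom k" "W' \<in> pisom k" and Z: "Z \<in> face k W" "Z + W \<in> face k W'"
  shows "W' = W"
proof -
  have "aligned k Z W" using face_add[OF k W(1) Z(1) pisom_in_face[OF k W(1)]] by blast
  then have "W \<in> face k W'" using aligned_imp_face[OF k _ W(2) Z(2)] by blast
  then have "W \<bullet> W' = k" by (simp add: face_iff ky_fan_pisom[OF k W(1)])
  then show ?thesis using pisom_eqI[OF W] by simp
qed

lemma matrix_expansion:
  fixes A :: "real^'n^'m"
  shows "A = (\<Sum>i\<in>UNIV. \<Sum>j\<in>UNIV. A $ i $ j *\<^sub>R outer (axis i 1) (axis j 1))"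
proof -
  have "(\<Sum>i\<in>UNIV. \<Sum>j\<in>UNIV. A $ i $ j *\<^sub>R outer (axis i 1) (axis j 1)) $ a $ b = A $ a $ b" for a b
  proof -
    have "(\<Sum>i\<in>UNIV. \<Sum>j\<in>UNIV. A $ i $ j *\<^sub>R outer (axis i 1) (axis j 1)) $ a $ b
      = (\<Sum>i\<in>UNIV. \<Sum>j\<in>UNIV. if j = b then (if i = a then A $ a $ b else 0) else 0)"
      unfolding sum_component by (intro sum.cong refl) (auto simp: axis_def)
    then show ?thesis by simp
  qed
  then show ?thesis by (simp add: vec_eq_iff)
qed

text \<open>After normalising \<open>W\<close> to a coordinate projection, matrix units are found in
  the span. On the block of \<open>J\<close> their symmetric combinations come from squares
  \<open>outer x x\<close>; on the complementary block each unit is the difference of two members of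
  the face.\<close>

lemma bisym_subset_span_face:
  fixes W :: "real^'n^'n"
  assumes k: "k \<le> CARD('n)" and W: "W \<in> pisom k"
  shows "bisym W \<subseteq> span (face k W)"
proof -
  obtain U V J where *: "W = U ** diagm (indicator J) ** V"
      "orthogonal_matrix U" "orthogonal_matrix V" "card J = k"
    using W unfolding pisom_def by auto
  let ?D = "diagm (indicator J) :: real^'n^'n"
  let ?S = "span (face k ?D)"
  let ?E = "\<lambda>i j. outer (axis i 1) (axis j 1) :: real^'n^'n"
  have D: "?D \<in> pisom k" using * diagm_indicator_pisom by blast
  have diag: "?E i i \<in> ?S" if "i \<in> J" for i
    using that * by (intro span_base outer_in_face_diagm) (auto simp: axis_def)
  have symm: "?E i j + ?E j i \<in> ?S" if "i \<in> J" "j \<in> J" for i j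
  proof -
    have "outer (axis i 1 + axis j 1) (axis i 1 + axis j 1) \<in> ?S"
      using that * by (intro span_base outer_in_face_diagm) (auto simp: axis_def)
    then have "outer (axis i 1 + axis j 1) (axis i 1 + axis j 1) - ?E i i - ?E j j \<in> ?S"
      using diag that by (intro span_diff) auto
    then show ?thesis by (simp add: outer_add_left outer_add_right algebra_simps)
  qed
  have compl: "?E p q \<in> ?S" if "p \<notin> J" "q \<notin> J" for p q
  proof -
    \<comment> \<open>The transposition of \<open>p\<close> and \<open>q\<close> exhibits
      \<open>?D + ?E p q\<close> as a partial isometry of rank \<open>k + 1\<close>. Being a
      contraction, it has norm at most \<open>k\<close>, and its pairing with \<open>?D\<close>
      attains \<open>k\<close>.\<close>
    define \<pi> where "\<pi> x = (if x = p then q else if x = q then p else x)" for x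
    have "bij \<pi>" by (rule involuntory_imp_bij) (auto simp: \<pi>_def)
    then have P: "orthogonal_matrix (permm \<pi>)" by (rule orthogonal_permm)
    have "?D + ?E p q = mat 1 ** diagm (indicator (insert p J)) ** permm \<pi>"
      using that by (auto simp: vec_eq_iff diagm_mult_left permm_def \<pi>_def diagm_nth axis_def indicator_def)
    then have "?D + ?E p q \<in> pisom (card (insert p J))"
      using pisomI[OF orthogonal_matrix_id P] by metis
    then have "norm ((?D + ?E p q) *v x) \<le> norm x" for x
      by (rule norm_pisom_vmult_le)
    then have "ky_fan_norm k (?D + ?E p q) \<le> k"
      by (rule ky_fan_le_contraction[OF k])
    moreover have "(?D + ?E p q) \<bullet> ?D = k"
      using that * pisom_inner_self[OF D] by (simp add: inner_add_left inner_outer diagm_vmult)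
    ultimately have "?D + ?E p q \<in> face k ?D"
      using inner_le_ky_fan[OF k D, of "?D + ?E p q"] by (simp add: face_iff)
    then have "(?D + ?E p q) - ?D \<in> ?S"
      using pisom_in_face[OF k D] by (intro span_diff span_base)
    then show ?thesis by simp
  qed
  have D_span: "A \<in> ?S" if A: "A \<in> bisym ?D" for A
  proof -
    \<comment> \<open>The entries at \<open>(i, j)\<close> and \<open>(j, i)\<close> are grouped,
      because on the block of \<open>J\<close> off-diagonal units are available only in symmetric
      combination.\<close>
    have "A = (\<Sum>i\<in>UNIV. \<Sum>j\<in>UNIV. A $ i $ j *\<^sub>R ?E i j)"
      by (rule matrix_expansion)
    moreover have "(\<Sum>i\<in>UNIV. \<Sum>j\<in>UNIV. A $ i $ j *\<^sub>R ?E i j)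
        = (1/2) *\<^sub>R (\<Sum>i\<in>UNIV. \<Sum>j\<in>UNIV. A $ i $ j *\<^sub>R ?E i j + A $ j $ i *\<^sub>R ?E j i)"
      using sum.swap[of "\<lambda>i j. A $ i $ j *\<^sub>R ?E i j" UNIV UNIV] by (simp add: sum.distrib scaleR_2)
    ultimately have "A = (1/2) *\<^sub>R (\<Sum>i\<in>UNIV. \<Sum>j\<in>UNIV. A $ i $ j *\<^sub>R ?E i j + A $ j $ i *\<^sub>R ?E j i)"
      by (rule trans)
    moreover have "A $ i $ j *\<^sub>R ?E i j + A $ j $ i *\<^sub>R ?E j i \<in> ?S" for i j
    proof (cases "i \<in> J \<and> j \<in> J")
      case True
      then have "A $ j $ i = A $ i $ j" using A by (simp add: bisym_diagm_indicator)
      then have "A $ i $ j *\<^sub>R ?E i j + A $ j $ i *\<^sub>R ?E j i = A $ i $ j *\<^sub>R (?E i j + ?E j i)"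
        by (simp add: scaleR_add_right)
      then show ?thesis using symm True by (simp add: span_scale)
    next
      case False
      show ?thesis
      proof (cases "i \<in> J \<or> j \<in> J")
        case True
        then have "A $ i $ j = 0" "A $ j $ i = 0" using A False by (auto simp: bisym_diagm_indicator)
        then show ?thesis by (simp add: span_zero)
      qed (use compl in \<open>auto intro: span_add span_scale\<close>)
    qed
    then have "(1/2) *\<^sub>R (\<Sum>i\<in>UNIV. \<Sum>j\<in>UNIV. A $ i $ j *\<^sub>R ?E i j + A $ j $ i *\<^sub>R ?E j i) \<in> ?S"
      by (intro span_scale span_sum)
    ultimately show ?thesis by (rule ssubst)
  qed
  show ?thesis
  proof
    fix B assume "B \<in> bisym W"
    then obtain A where A: "A \<in> bisym ?D" "B = U ** A ** V"
      using bisym_conj_image[OF *(2,3), of ?D] *(1) by auto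
    have "B \<in> (\<lambda>A. U ** A ** V) ` span (face k ?D)" using D_span A by auto
    also have "\<dots> = span ((\<lambda>A. U ** A ** V) ` face k ?D)"
      by (rule linear_span_image[OF linear_conj, symmetric])
    also have "\<dots> \<subseteq> span (face k W)"
      by (intro span_mono) (auto simp: *(1) face_conj[OF k *(2,3)])
    finally show "B \<in> span (face k W)" .
  qed
qed

lemma axis_component: "axis i x $ j = (if j = i then x else 0)"
  by (simp add: axis_def)

lemma transpose_mult_outer_axis:
  "(transpose W ** outer (axis i 1) y) $ a $ b = W $ i $ a * y $ b" for W :: "real^'n^'n"
proof -
  have "(transpose W *v axis i 1) $ a = W $ i $ a"
    unfolding matrix_vector_mult_basis by (simp add: column_def transpose_def)
  then show ?thesis by (simp add: mult_outer)
qed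

text \<open>Elements of the smaller space serve as tests for \<open>W\<close>: diagonal units make
  it diagonal, squares make it constant on \<open>J\<close>, and off-diagonal units of the
  complement annihilate its diagonal there. The cubic equation leaves the values 0, 1 and -1, and
  the norm of \<open>W\<close> selects the two solutions.\<close>

lemma bisym_diagm_subset_imp:
  fixes W :: "real^'n^'n"
  assumes W: "W \<in> pisom k" and k: "1 < k" "card J = k"
    and sub: "bisym (diagm (indicator J)) \<subseteq> bisym W"
  shows "W = diagm (indicator J) \<or> W = - diagm (indicator J)"
proof -
  let ?E = "\<lambda>i j. outer (axis i 1) (axis j 1) :: real^'n^'n"
  have E: "?E i i \<in> bisym W" for i
    by (rule subsetD[OF sub]) (auto simp: bisym_diagm_indicator axis_component)
  have diag: "W $ i $ j = 0" if "i \<noteq> j" for i j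
  proof -
    have "transpose (transpose W ** ?E i i) = transpose W ** ?E i i" using E by (simp add: bisym_def)
    then have "(transpose (transpose W ** ?E i i)) $ i $ j = (transpose W ** ?E i i) $ i $ j" by simp
    then show ?thesis using that
      unfolding transpose_def[of "_ ** _"] by (simp add: transpose_mult_outer_axis axis_component)
  qed
  have const: "W $ i $ i = W $ j $ j" if "i \<in> J" "j \<in> J" for i j
  proof (cases "i = j")
    case False
    have "outer (axis i 1 + axis j 1) (axis i 1 + axis j 1) \<in> bisym W"
      using that by (intro subsetD[OF sub]) (auto simp: bisym_diagm_indicator axis_component)
    then have "transpose (transpose W ** outer (axis i 1 + axis j 1) (axis i 1 + axis j 1)) $ i $ j
      = (transpose W ** outer (axis i 1 + axis j 1) (axis i 1 + axis j 1)) $ i $ j"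
      by (simp add: bisym_def)
    then show ?thesis using False diag[of i j] diag[of j i]
      unfolding transpose_def[of "_ ** _"]
      by (simp add: outer_add_left matrix_add_ldistrib transpose_mult_outer_axis axis_component)
  qed simp
  have off: "W $ p $ p = 0" if "p \<notin> J" "q \<notin> J" "p \<noteq> q" for p q
  proof -
    have "?E p q \<in> bisym W"
      using that by (intro subsetD[OF sub]) (auto simp: bisym_diagm_indicator axis_component)
    then have "transpose (transpose W ** ?E p q) $ p $ q = (transpose W ** ?E p q) $ p $ q"
      by (simp add: bisym_def)
    then show ?thesis using that
      unfolding transpose_def[of "_ ** _"] by (simp add: transpose_mult_outer_axis axis_component)
  qed
  define w where "w i = W $ i $ i" for i
  have W_diag: "W = diagm w"
    using diag by (simp add: vec_eq_iff diagm_nth w_def)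
  have cubes: "diagm (\<lambda>i. w i * w i * w i) = diagm w"
    using pisom_cubic[OF W] unfolding W_diag by (simp add: diagm_mult_diagm)
  have cubic: "W $ i $ i * W $ i $ i * W $ i $ i = W $ i $ i" for i
    using arg_cong[OF cubes, of "\<lambda>M. M $ i $ i"] by (simp only: diagm_nth w_def simp_thms if_True)
  have range: "W $ i $ i = 0 \<or> W $ i $ i = 1 \<or> W $ i $ i = -1" for i
  proof -
    have "W $ i $ i * ((W $ i $ i - 1) * (W $ i $ i + 1)) = 0" using cubic[of i] by (simp add: algebra_simps)
    then show ?thesis by auto
  qed
  have "diagm w \<bullet> diagm w = k" using pisom_inner_self[OF W] unfolding W_diag .
  then have total: "(\<Sum>i\<in>UNIV. (W $ i $ i)\<^sup>2) = k"
    unfolding w_def[symmetric] by (simp add: inner_diagm diagm_nth power2_eq_square)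
  obtain j0 where j0: "j0 \<in> J" using k by (metis card.empty ex_in_conv not_one_less_zero)
  define l where "l = W $ j0 $ j0"
  have l: "W $ i $ i = l" if "i \<in> J" for i using const[OF that j0] by (simp add: l_def)
  have split: "(\<Sum>i\<in>UNIV. (W $ i $ i)\<^sup>2) = k * l\<^sup>2 + (\<Sum>i\<in>-J. (W $ i $ i)\<^sup>2)"
  proof -
    have "(\<Sum>i\<in>UNIV. (W $ i $ i)\<^sup>2) = (\<Sum>i\<in>J. (W $ i $ i)\<^sup>2) + (\<Sum>i\<in>-J. (W $ i $ i)\<^sup>2)"
      by (subst sum.union_disjoint[symmetric]) auto
    then show ?thesis using l k by simp
  qed
  have "l \<noteq> 0"
  proof
    assume l0: "l = 0"
    \<comment> \<open>By \<open>off\<close>, a nonzero entry outside \<open>J\<close> is possible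
      only if the complement is a single index. It then contributes 1 to a total of
      \<open>k\<close>, contradicting \<open>1 < k\<close>.\<close>
    have "(\<Sum>i\<in>-J. (W $ i $ i)\<^sup>2) \<le> 1"
    proof (cases "\<exists>p\<in>-J. W $ p $ p \<noteq> 0")
      case True
      then obtain p where p: "p \<in> - J" "W $ p $ p \<noteq> 0" by blast
      then have "- J = {p}" using off by blast
      then show ?thesis using range[of p] by auto
    qed simp
    then show False using total split l0 k by simp
  qed
  then have l1: "l = 1 \<or> l = -1" using range[of j0] by (simp add: l_def)
  then have "(\<Sum>i\<in>-J. (W $ i $ i)\<^sup>2) = 0" using total split by auto
  then have "W $ i $ i = 0" if "i \<notin> J" for i using that by (simp add: sum_nonneg_eq_0_iff)
  then have "W = l *\<^sub>R diagm (indicator J)"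
    using l diag by (auto simp: vec_eq_iff diagm_nth indicator_def)
  then show ?thesis using l1 by auto
qed

lemma bisym_subset_imp:
  fixes W :: "real^'n^'n"
  assumes W: "W \<in> pisom k" "W' \<in> pisom k" and k: "1 < k" and sub: "bisym W \<subseteq> bisym W'"
  shows "W' = W \<or> W' = - W"
proof -
  obtain U V J where *: "W = U ** diagm (indicator J) ** V"
      "orthogonal_matrix U" "orthogonal_matrix V" "card J = k"
    using W unfolding pisom_def by auto
  define X where "X = transpose U ** W' ** transpose V"
  have X: "X \<in> pisom k" "W' = U ** X ** V"
    using W(2) * by (simp_all add: X_def pisom_mult orthogonal_conj_inverse)
  have "bisym (diagm (indicator J)) \<subseteq> bisym X"
    using sub bisym_conj[OF *(2,3)] unfolding *(1) X(2) by blast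
  then have "X = diagm (indicator J) \<or> X = - diagm (indicator J)"
    by (rule bisym_diagm_subset_imp[OF X(1) k *(4)])
  then show ?thesis using * X(2) by (auto simp: matrix_distribs)
qed

text \<open>For \<open>Z\<close> in the face of \<open>W'\<close> the point \<open>Z + W'\<close>
  lies in no other face. A face containing its preimage is therefore mapped into
  \<open>face k W'\<close>, since the images of all its members are aligned with
  \<open>Z + W'\<close>. Comparing spans shows that this face is the same for all \<open>Z\<close>,
  and the summand \<open>W'\<close> is removed by scaling.\<close>

lemma aligned_inv:
  fixes T S :: "real^'n^'n \<Rightarrow> real^'n^'n"
  assumes k: "1 < k" "k \<le> CARD('n)" and T: "linear T" and S: "linear S"
    and ST: "\<And>X. S (T X) = X" "\<And>X. T (S X) = X"
    and ali: "\<And>A B. aligned k A B \<Longrightarrow> aligned k (T A) (T B)"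
    and AB: "aligned k A B"
  shows "aligned k (S A) (S B)"
proof -
  note k_le = k(2)
  obtain W' where W': "W' \<in> pisom k" "A \<in> face k W'" "B \<in> face k W'"
    using AB aligned_iff_face[OF k_le] by blast
  have ex: "\<exists>W\<in>pisom k. S (Z + W') \<in> face k W \<and> T ` face k W \<subseteq> face k W'" if Z: "Z \<in> face k W'" for Z
  proof -
    obtain W where W: "W \<in> pisom k" "S (Z + W') \<in> face k W"
      using face_exists[OF k_le] by blast
    have "T Y \<in> face k W'" if "Y \<in> face k W" for Y
    proof -
      have "aligned k (T Y) (T (S (Z + W')))"
        using face_add[OF k_le W(1) that W(2)] ali by blast
      then have 1: "aligned k (T Y) (Z + W')" by (simp add: ST)
      obtain W1 where W1: "W1 \<in> pisom k" "T Y + (Z + W') \<in> face k W1"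
        using face_exists[OF k_le] by blast
      have *: "T Y \<in> face k W1" "Z + W' \<in> face k W1" using aligned_imp_face[OF k_le 1 W1] by auto
      then have "W1 = W'" using pisom_face_unique[OF k_le W'(1) W1(1) Z] by blast
      then show ?thesis using * by simp
    qed
    then show ?thesis using W by blast
  qed
  have 0: "0 \<in> face k W'" by (simp add: face_iff k_le)
  obtain W0 where W0: "W0 \<in> pisom k" "S (0 + W') \<in> face k W0" "T ` face k W0 \<subseteq> face k W'"
    using ex[OF 0] by blast
  \<comment> \<open>Inclusion of faces gives inclusion of spans, and equal dimensions turn the
    latter into an equality.\<close>
  have image: "T ` bisym W = bisym W'" if W: "W \<in> pisom k" "T ` face k W \<subseteq> face k W'" for W
  proof (rule subspace_dim_equal)
    show "subspace (T ` bisym W)" by (intro linear_subspace_image[OF T] subspace_bisym)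
    have "T ` bisym W \<subseteq> T ` span (face k W)" using bisym_subset_span_face[OF k_le W(1)] by blast
    also have "\<dots> = span (T ` face k W)" by (rule linear_span_image[OF T, symmetric])
    also have "\<dots> \<subseteq> span (bisym W')"
      using W(2) face_subset_bisym[OF k_le W'(1)] by (intro span_mono) blast
    also have "\<dots> = bisym W'" using subspace_bisym by (simp add: span_eq_iff)
    finally show "T ` bisym W \<subseteq> bisym W'" .
    have "inj T" using ST by (metis injI)
    then have "dim (T ` bisym W) = dim (bisym W)"
      by (intro dim_image_eq[OF T]) (auto intro: inj_on_subset)
    then show "dim (bisym W') \<le> dim (T ` bisym W)" using dim_bisym_eq[OF W(1) W'(1)] by simp
  qed (rule subspace_bisym)
  have W0_all: "S (Z + W') \<in> face k W0" if Z: "Z \<in> face k W'" for Z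
  proof -
    obtain W where W: "W \<in> pisom k" "S (Z + W') \<in> face k W" "T ` face k W \<subseteq> face k W'"
      using ex[OF Z] by blast
    have "S ` T ` bisym W0 = S ` T ` bisym W" using image W W0 by simp
    then have "bisym W0 = bisym W" by (simp add: image_image ST(1))
    then have "W = W0 \<or> W = - W0" using bisym_subset_imp[OF W0(1) W(1) k(1)] by simp
    \<comment> \<open>Otherwise \<open>T W0\<close> and its negative would lie in the same face,
      where the norm is additive.\<close>
    moreover have False if "W = - W0"
    proof -
      have "T (- W0) \<in> face k W'" "T W0 \<in> face k W'"
        using W(3) W0(3) that pisom_in_face[OF k_le W0(1)] pisom_in_face[OF k_le W(1)] by auto
      then have "ky_fan_norm k (T W0) = 0"
        using linear_neg[OF T, of W0] ky_fan_minus[OF k_le, of "T W0"] by (simp add: face_iff)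
      then have "T W0 = 0" using k ky_fan_eq_0_iff[OF k_le, of "T W0"] by simp
      then have "W0 = 0" using ST(1)[of W0] linear_0[OF S] by simp
      then show False using pisom_inner_self[OF W0(1)] k by simp
    qed
    ultimately show ?thesis using W by blast
  qed
  have S_face: "S Z \<in> face k W0" if Z: "Z \<in> face k W'" for Z
  proof -
    \<comment> \<open>For every positive \<open>t\<close> the matrix
      \<open>S Z + t *\<^sub>R S W'\<close> lies in the face, so the defect of \<open>S Z\<close> is
      at most of order \<open>t\<close>.\<close>
    have le: "ky_fan_norm k (S Z) - S Z \<bullet> W0 \<le> t * (2 * ky_fan_norm k (S W'))" if t: "0 < t" for t
    proof -
      have "(1 / t) *\<^sub>R Z \<in> face k W'" using Z t by (intro face_scaleR[OF k_le]) auto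
      then have "t *\<^sub>R S ((1 / t) *\<^sub>R Z + W') \<in> face k W0"
        using face_scaleR[OF k_le W0_all, of "(1 / t) *\<^sub>R Z" t] t by simp
      moreover have "t *\<^sub>R S ((1 / t) *\<^sub>R Z + W') = S Z + t *\<^sub>R S W'"
        using t by (simp add: linear_add[OF S] linear_scale[OF S] scaleR_add_right)
      ultimately have "ky_fan_norm k (S Z + t *\<^sub>R S W') = S Z \<bullet> W0 + t * (S W' \<bullet> W0)"
        by (simp add: face_iff inner_add_left)
      moreover have "ky_fan_norm k (S Z) \<le> ky_fan_norm k (S Z + t *\<^sub>R S W') + t * ky_fan_norm k (S W')"
        using ky_fan_triangle[OF k_le, of "S Z + t *\<^sub>R S W'" "- (t *\<^sub>R S W')"] t
        by (simp add: ky_fan_minus[OF k_le] ky_fan_scaleR[OF k_le])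
      moreover have "t * (S W' \<bullet> W0) \<le> t * ky_fan_norm k (S W')"
        using t inner_le_ky_fan[OF k_le W0(1)] by (intro mult_left_mono) auto
      ultimately show ?thesis by (simp add: algebra_simps)
    qed
    have "ky_fan_norm k (S Z) - S Z \<bullet> W0 \<le> 0"
    proof (rule field_le_epsilon)
      fix e :: real assume e: "0 < e"
      define c where "c = 2 * ky_fan_norm k (S W')"
      have c: "c \<ge> 0" by (simp add: c_def ky_fan_nonneg[OF k_le])
      have "e / (c + 1) * c \<le> e" using e c by (simp add: field_simps)
      then show "ky_fan_norm k (S Z) - S Z \<bullet> W0 \<le> 0 + e"
        using le[of "e / (c + 1)"] e c by (simp add: c_def)
    qed
    then show ?thesis using inner_le_ky_fan[OF k_le W0(1), of "S Z"] by (simp add: face_iff)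
  qed
  show ?thesis using face_add[OF k_le W0(1)] S_face W' by blast
qed

section \<open>Matrices of rank one and orthogonal matrices\<close>

text \<open>As division by 0 gives 0, this is the identity for \<open>w = 0\<close>, and
  orthogonality holds for every \<open>w\<close>.\<close>

definition householder :: "real^'n \<Rightarrow> real^'n^'n" where
  "householder w = mat 1 - (2 / (w \<bullet> w)) *\<^sub>R outer w w"

lemma orthogonal_householder: "orthogonal_matrix (householder w)"
proof -
  have "transpose (householder w) ** householder w
    = mat 1 + (((2 / (w \<bullet> w)) * (2 / (w \<bullet> w)) * (w \<bullet> w)) - 4 / (w \<bullet> w)) *\<^sub>R outer w w"
    by (simp add: householder_def matrix_distribs outer_mult_outer algebra_simps
        flip: scaleR_add_left scaleR_left_diff_distrib)
  also have "\<dots> = mat 1" by (cases "w = 0") simp_all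
  finally show ?thesis by (simp add: orthogonal_matrix)
qed

lemma householder_vmult: "householder w *v x = x - (2 * (w \<bullet> x) / (w \<bullet> w)) *\<^sub>R w"
  by (simp add: householder_def matrix_vector_mult_diff_rdistrib outer_vmult flip: scaleR_matrix_vector_assoc)

lemma householder_swap:
  assumes "norm x = norm y"
  shows "householder (x - y) *v x = y"
proof (cases "x = y")
  case True
  then show ?thesis by (simp add: householder_vmult)
next
  case False
  have "2 * ((x - y) \<bullet> x) = (x - y) \<bullet> (x - y)"
    using assms by (simp add: algebra_simps inner_commute norm_eq_sqrt_inner)
  then show ?thesis using False by (simp add: householder_vmult)
qed

text \<open>Two reflections: \<open>H\<close> moves \<open>axis p 1\<close> to \<open>x\<close>; the
  other one moves \<open>axis q 1\<close> to the pulled back \<open>x'\<close> and fixes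
  \<open>axis p 1\<close>, because it reflects along a vector orthogonal to it.\<close>

lemma orthogonal_matrix_exists_pair:
  fixes x x' :: "real^'n"
  assumes "norm x = 1" "norm x' = 1" "x \<bullet> x' = 0" "p \<noteq> q"
  obtains U where "orthogonal_matrix U" "U *v axis p 1 = x" "U *v axis q 1 = x'"
proof -
  define H where "H = householder (axis p 1 - x)"
  have H: "orthogonal_matrix H" "H *v axis p 1 = x"
    using assms by (simp_all add: H_def orthogonal_householder householder_swap)
  define z where "z = transpose H *v x'"
  have Hz: "H *v z = x'" using H by (simp add: z_def matrix_vector_mul_assoc orthogonal_matrixD)
  have "norm z = 1" using orthogonal_inner[OF H(1), of z z] assms(2) by (simp add: Hz norm_eq_sqrt_inner)
  moreover have "axis p 1 \<bullet> z = 0" using orthogonal_inner[OF H(1), of "axis p 1" z] assms(3) by (simp add: Hz H(2))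
  then have "householder (axis q 1 - z) *v axis p 1 = axis p 1"
    using assms(4) by (simp add: householder_vmult inner_diff_left inner_axis_axis axis_component)
  ultimately have "orthogonal_matrix (H ** householder (axis q 1 - z))"
    "(H ** householder (axis q 1 - z)) *v axis p 1 = x" "(H ** householder (axis q 1 - z)) *v axis q 1 = x'"
    using H Hz by (simp_all add: orthogonal_householder orthogonal_matrix_mul householder_swap flip: matrix_vector_mul_assoc)
  then show ?thesis using that by blast
qed

lemma outer_svd:
  fixes x y :: "real^'n"
  obtains U V where "orthogonal_matrix U" "orthogonal_matrix V"
    "outer x y = (norm x * norm y) *\<^sub>R (U ** outer (axis p 1) (axis p 1) ** V)"
proof -
  have ex: "\<exists>U. orthogonal_matrix U \<and> z = norm z *\<^sub>R (U *v axis p 1)" for z :: "real^'n"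
  proof (cases "z = 0")
    case True
    then show ?thesis using orthogonal_matrix_id by auto
  next
    case False
    then have "norm ((1 / norm z) *\<^sub>R z) = 1" by simp
    then obtain U where "orthogonal_matrix U" "U *v axis p 1 = (1 / norm z) *\<^sub>R z"
      using orthogonal_matrix_exists_basis by blast
    then show ?thesis using False by (intro exI[of _ U]) auto
  qed
  obtain U where U: "orthogonal_matrix U" "x = norm x *\<^sub>R (U *v axis p 1)" using ex by blast
  obtain V where V: "orthogonal_matrix V" "y = norm y *\<^sub>R (V *v axis p 1)" using ex by blast
  have "outer x y = outer (norm x *\<^sub>R (U *v axis p 1)) (norm y *\<^sub>R (V *v axis p 1))"
    using U V by simp
  also have "\<dots> = (norm x * norm y) *\<^sub>R (U ** outer (axis p 1) (axis p 1) ** transpose V)"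
    by (simp add: mult_outer outer_mult outer_scaleR_left outer_scaleR_right)
  finally show ?thesis using that U V by (metis orthogonal_matrix_transpose)
qed

lemma obtain_superset_card:
  fixes I :: "'n::finite set"
  assumes "card I \<le> k" "k \<le> card P" "I \<subseteq> P"
  obtains J where "I \<subseteq> J" "J \<subseteq> P" "card J = k"
proof -
  have "k - card I \<le> card (P - I)" using assms by (simp add: card_Diff_subset)
  then obtain K where K: "K \<subseteq> P - I" "card K = k - card I" by (meson obtain_subset_with_card_n)
  then have "card (I \<union> K) = k" using assms by (subst card_Un_disjoint) auto
  then show ?thesis using that[of "I \<union> K"] K assms by blast
qed

context
  fixes k :: nat
  assumes k1: "1 < k" and k_le: "k \<le> CARD('n::finite)"
begin

lemma ky_fan_outer: "ky_fan_norm k (outer x y) = norm x * norm y" for x y :: "real^'n"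
proof -
  obtain p :: 'n where True by blast
  obtain J where J: "{p} \<subseteq> J" "card J = k"
    using obtain_superset_card[of "{p}" k UNIV] k1 k_le by auto
  obtain U V where UV: "orthogonal_matrix U" "orthogonal_matrix V"
    "outer x y = (norm x * norm y) *\<^sub>R (U ** outer (axis p 1) (axis p 1) ** V)"
    using outer_svd by blast
  have "outer (axis p 1) (axis p 1) \<in> face k (diagm (indicator J) :: real^'n^'n)"
    using J by (intro outer_in_face_diagm) (auto simp: axis_component)
  then have "ky_fan_norm k (outer (axis p 1) (axis p 1 :: real^'n)) = 1"
    using J by (simp add: face_iff inner_outer diagm_vmult)
  then show ?thesis
    unfolding UV(3) by (simp add: ky_fan_scaleR[OF k_le] ky_fan_orthogonal[OF k_le UV(1,2)])
qed

text \<open>Membership forces equality in Cauchy-Schwarz, so that \<open>W *v y\<close> points in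
  the direction of \<open>x\<close>, and in the contraction estimate, so that \<open>y\<close> lies
  where \<open>W\<close> is isometric.\<close>

lemma outer_face_D:
  fixes W :: "real^'n^'n"
  assumes W: "W \<in> pisom k" and o: "outer x y \<in> face k W" and x: "x \<noteq> 0"
  shows "norm x *\<^sub>R (W *v y) = norm y *\<^sub>R x" "transpose W *v (W *v y) = y"
proof -
  have eq: "x \<bullet> (W *v y) = norm x * norm y"
    using o by (simp add: face_iff ky_fan_outer inner_outer)
  have le: "norm (W *v y) \<le> norm y" by (rule norm_pisom_vmult_le[OF W])
  have "norm x * norm y \<le> norm x * norm (W *v y)"
    using norm_cauchy_schwarz[of x "W *v y"] eq by simp
  then have nrm: "norm (W *v y) = norm y" using le x by simp
  then show "norm x *\<^sub>R (W *v y) = norm y *\<^sub>R x"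
    using norm_cauchy_schwarz_eq[of x "W *v y"] eq by simp
  have "norm (transpose W *v (W *v y)) \<le> norm y"
    using norm_pisom_vmult_le[OF pisom_transpose[OF W], of "W *v y"] nrm by simp
  then have "(transpose W *v (W *v y)) \<bullet> (transpose W *v (W *v y)) \<le> y \<bullet> y"
    by (simp add: norm_le)
  moreover have "(transpose W *v (W *v y)) \<bullet> y = y \<bullet> y"
    using nrm dot_lmul_matrix[of "W *v y" W y] by (simp add: transpose_matrix_vector norm_eq)
  ultimately have "(transpose W *v (W *v y) - y) \<bullet> (transpose W *v (W *v y) - y) \<le> 0"
    by (simp add: inner_diff_left inner_diff_right inner_commute)
  then have "(transpose W *v (W *v y) - y) \<bullet> (transpose W *v (W *v y) - y) = 0"
    by (intro order_antisym inner_ge_zero)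
  then show "transpose W *v (W *v y) = y" by (simp only: inner_eq_zero_iff right_minus_eq)
qed

lemma ky_fan_orthogonal_matrix:
  fixes G :: "real^'n^'n"
  assumes "orthogonal_matrix G"
  shows "ky_fan_norm k G = k"
proof -
  obtain J where J: "J \<subseteq> (UNIV :: 'n set)" "card J = k" using obtain_subset_with_card_n[OF k_le] by blast
  have "norm ((mat 1 :: real^'n^'n) *v x) \<le> norm x" for x by simp
  then have "ky_fan_norm k (mat 1 :: real^'n^'n) \<le> k" by (rule ky_fan_le_contraction[OF k_le])
  moreover have "mat 1 \<bullet> (diagm (indicator J) :: real^'n^'n) = k"
    using J by (simp add: inner_diagm_indicator mat_def)
  ultimately have "ky_fan_norm k (mat 1 :: real^'n^'n) = k"
    using inner_le_ky_fan[OF k_le diagm_indicator_pisom[OF J(2)], of "mat 1"] by simp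
  then show ?thesis
    using ky_fan_orthogonal[OF k_le assms orthogonal_matrix_id, of "mat 1"] by simp
qed

text \<open>\<open>transpose W ** W\<close> is the projection onto the initial space of
  \<open>W\<close>. The two sides have norm square \<open>k\<close> and inner product
  \<open>k\<close>, hence coincide: \<open>W\<close> is \<open>G\<close> restricted to that
  space.\<close>

lemma orthogonal_face_D:
  fixes W :: "real^'n^'n"
  assumes W: "W \<in> pisom k" and G: "orthogonal_matrix G" "G \<in> face k W"
  shows "W = G ** (transpose W ** W)"
proof -
  let ?P = "transpose W ** W"
  have P: "W ** transpose ?P = W"
    using pisom_cubic[OF W] by (simp add: matrix_transpose_mul matrix_mul_assoc)
  have OW: "G \<bullet> W = k" using ky_fan_orthogonal_matrix[OF G(1)] G(2) by (simp add: face_iff)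
  have 1: "(G ** ?P) \<bullet> W = k" using inner_matmul_right[of G ?P W] P OW by simp
  have 2: "(G ** ?P) \<bullet> (G ** ?P) = k"
  proof -
    have "(G ** ?P) \<bullet> (G ** ?P) = ?P \<bullet> ?P"
      using inner_orthogonal_conj[OF G(1) orthogonal_matrix_id, of ?P ?P] by simp
    also have "\<dots> = W \<bullet> (W ** ?P)" using inner_matmul_left[of "transpose W" W ?P] by simp
    also have "W ** ?P = W" using pisom_cubic[OF W] by (simp add: matrix_mul_assoc)
    finally show ?thesis using pisom_inner_self[OF W] by simp
  qed
  have "(W - G ** ?P) \<bullet> (W - G ** ?P) = 0"
    using 1 2 pisom_inner_self[OF W] by (simp add: inner_diff_left inner_diff_right inner_commute)
  then show ?thesis by simp
qed

text \<open>A common face with a positive multiple of \<open>Q\<close> makes \<open>Q *v y\<close> a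
  nonnegative multiple of \<open>x\<close>. This cannot hold for both \<open>G\<close> and
  \<open>- G\<close>.\<close>

lemma outer_orthogonal_not_aligned:
  fixes G :: "real^'n^'n"
  assumes "orthogonal_matrix G" "c \<noteq> 0" "x \<noteq> 0" "y \<noteq> 0"
    and al: "aligned k (outer x y) (c *\<^sub>R G)" "aligned k (outer x y) (- (c *\<^sub>R G))"
  shows False
proof -
  have main: "norm x *\<^sub>R (Q *v y) = norm y *\<^sub>R x"
    if "orthogonal_matrix Q" "0 < a" "aligned k (outer x y) (a *\<^sub>R Q)" for Q :: "real^'n^'n" and a
  proof -
    have "aligned k (1 *\<^sub>R outer x y) ((1 / a) *\<^sub>R (a *\<^sub>R Q))"
      using that by (intro aligned_scaleR[OF k_le]) auto
    then have "aligned k (outer x y) Q" using that by simp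
    then obtain W where W: "W \<in> pisom k" "outer x y \<in> face k W" "Q \<in> face k W"
      using aligned_iff_face[OF k_le, of "outer x y" Q] by auto
    have "W *v y = Q *v (transpose W *v (W *v y))"
      using orthogonal_face_D[OF W(1) that(1) W(3)] by (metis matrix_vector_mul_assoc)
    then have "W *v y = Q *v y" using outer_face_D[OF W(1,2) assms(3)] by simp
    then show ?thesis using outer_face_D[OF W(1,2) assms(3)] by simp
  qed
  have "norm x *\<^sub>R (G *v y) = norm y *\<^sub>R x \<and> norm x *\<^sub>R ((- G) *v y) = norm y *\<^sub>R x"
  proof (cases "c > 0")
    case True
    then show ?thesis using main[of G c] main[of "- G" c] al assms(1) orthogonal_minus[OF assms(1)] by simp
  next
    case False
    then show ?thesis using main[of G "- c"] main[of "- G" "- c"] al assms(1,2) orthogonal_minus[OF assms(1)] by simp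
  qed
  moreover have "(- G) *v y = - (G *v y)" by (rule minus_vmult)
  ultimately have "norm y *\<^sub>R x = - (norm y *\<^sub>R x)" by (metis scaleR_minus_right)
  then have "norm y *\<^sub>R x = 0" by (simp add: vec_eq_iff)
  then show False using assms by simp
qed

text \<open>A common \<open>W\<close> carries the right vectors isometrically to the directions of
  the left ones, so both pairs enclose the same angle. Negating one left vector changes only one of
  the two angles, so both cosines vanish.\<close>

lemma outer_aligned_orthogonal:
  fixes x y x' y' :: "real^'n"
  assumes "x \<noteq> 0" "x' \<noteq> 0" "y \<noteq> 0" "y' \<noteq> 0"
    and al: "aligned k (outer x y) (outer x' y')" "aligned k (outer x y) (- outer x' y')"
  shows "x \<bullet> x' = 0" "y \<bullet> y' = 0"
proof -
  have main: "norm y * norm b * (x \<bullet> a) = norm x * norm a * (y \<bullet> b)"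
    if ab: "a \<noteq> 0" "aligned k (outer x y) (outer a b)" for a b :: "real^'n"
  proof -
    obtain W where W: "W \<in> pisom k" "outer x y \<in> face k W" "outer a b \<in> face k W"
      using aligned_iff_face[OF k_le, of "outer x y" "outer a b"] ab(2) by auto
    note 1 = outer_face_D[OF W(1,2) assms(1)] and 2 = outer_face_D[OF W(1,3) ab(1)]
    have "norm y * norm b * (x \<bullet> a) = (norm y *\<^sub>R x) \<bullet> (norm b *\<^sub>R a)" by simp
    also have "\<dots> = norm x * norm a * ((W *v y) \<bullet> (W *v b))"
      by (simp flip: 1(1) 2(1))
    also have "(W *v y) \<bullet> (W *v b) = (transpose W *v (W *v y)) \<bullet> b"
      by (simp add: transpose_matrix_vector dot_lmul_matrix)
    also have "\<dots> = y \<bullet> b" by (simp add: 1)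
    finally show ?thesis .
  qed
  from main[of x' y'] main[of "- x'" y'] al assms
  have "norm x * norm x' * (y \<bullet> y') = 0" "norm y * norm y' * (x \<bullet> x') = 0"
    by (simp_all add: outer_minus_left)
  then show "x \<bullet> x' = 0" "y \<bullet> y' = 0" using assms by simp_all
qed

text \<open>Some \<open>W\<close> carries the directions of \<open>y\<close> and \<open>y'\<close>
  to those of \<open>x\<close> and \<open>x'\<close>; its rank accommodates two directions because
  \<open>1 < k\<close>.\<close>

lemma aligned_outer:
  fixes x y x' y' :: "real^'n"
  assumes "x \<bullet> x' = 0" "y \<bullet> y' = 0"
  shows "aligned k (outer x y) (outer x' y')"
proof (cases "x = 0 \<or> x' = 0 \<or> y = 0 \<or> y' = 0")
  case True
  then show ?thesis using aligned_0[OF k_le] by auto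
next
  case False
  have "\<not> CARD('n) \<le> Suc 0" using k1 k_le by simp
  then obtain p q :: 'n where pq: "p \<noteq> q" using card_le_Suc0_iff_eq[of "UNIV :: 'n set"] by auto
  have "card {p, q} \<le> k" using k1 pq by simp
  from obtain_superset_card[OF this k_le subset_UNIV]
  obtain J where J: "{p, q} \<subseteq> J" "card J = k" by blast
  let ?n = "\<lambda>z :: real^'n. (1 / norm z) *\<^sub>R z"
  have nrm: "norm (?n z) = 1" if "z \<noteq> 0" for z using that by simp
  obtain U where U: "orthogonal_matrix U" "U *v axis p 1 = ?n x" "U *v axis q 1 = ?n x'"
    using orthogonal_matrix_exists_pair[of "?n x" "?n x'"] False nrm assms pq by auto
  obtain V where V: "orthogonal_matrix V" "V *v axis p 1 = ?n y" "V *v axis q 1 = ?n y'"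
    using orthogonal_matrix_exists_pair[of "?n y" "?n y'"] False nrm assms pq by auto
  define W where "W = U ** diagm (indicator J) ** transpose V"
  have W: "W \<in> pisom k" using U V J by (simp add: W_def pisomI)
  have D: "diagm (indicator J) *v axis i 1 = axis i 1" if "i \<in> J" for i :: 'n
    using that by (auto simp: vec_eq_iff diagm_vmult axis_component)
  have Wv: "W *v (V *v axis i 1) = U *v axis i 1" if "i \<in> J" for i
    using V(1) that D by (simp add: W_def matrix_vector_mul_assoc matrix_mul_assoc[symmetric] orthogonal_matrixD)
      (simp add: D matrix_vector_mul_assoc[symmetric])
  have "W *v ?n y = ?n x" "W *v ?n y' = ?n x'" using Wv[of p] Wv[of q] J U V by auto
  then have *: "W *v y = (norm y / norm x) *\<^sub>R x" "W *v y' = (norm y' / norm x') *\<^sub>R x'"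
    using False by (simp_all add: matrix_vector_mult_scaleR field_simps vec_eq_iff)
  have "outer x y \<in> face k W" "outer x' y' \<in> face k W"
    using False by (auto intro!: outer_in_face[OF k_le W] simp: * dot_square_norm power2_eq_square)
  then show ?thesis using face_add[OF k_le W] by blast
qed

end

section \<open>Extremal matrices\<close>

text \<open>The matrices that span an extreme ray of every face containing them.\<close>

definition extremal :: "nat \<Rightarrow> real^'n^'n \<Rightarrow> bool" where
  "extremal k A \<longleftrightarrow> A \<noteq> 0 \<and> (\<forall>X Y. aligned k X Y \<longrightarrow> X + Y = A \<longrightarrow> (\<exists>c. X = c *\<^sub>R A))"

lemma extremal_linear_image:
  fixes T S :: "real^'n^'n \<Rightarrow> real^'n^'n"
  assumes T: "linear T" and S: "linear S" and ST: "\<And>X. S (T X) = X" "\<And>X. T (S X) = X"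
    and al: "\<And>A B. aligned k A B \<Longrightarrow> aligned k (S A) (S B)" and A: "extremal k A"
  shows "extremal k (T A)"
  unfolding extremal_def
proof (intro conjI allI impI)
  show "T A \<noteq> 0" using A ST(1)[of A] linear_0[OF S] by (auto simp: extremal_def)
  fix X Y assume XY: "aligned k X Y" "X + Y = T A"
  then have "S X + S Y = A" by (metis ST(1) linear_add[OF S])
  then obtain c where "S X = c *\<^sub>R A" using A al[OF XY(1)] unfolding extremal_def by blast
  then have "X = c *\<^sub>R T A" by (metis ST(2) linear_scale[OF T])
  then show "\<exists>c. X = c *\<^sub>R T A" by blast
qed

context
  fixes k :: nat
  assumes k1: "1 < k" and k_le: "k \<le> CARD('n::finite)"
begin

lemma aligned_conj:
  fixes X Y :: "real^'n^'n"
  assumes "orthogonal_matrix U" "orthogonal_matrix V"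
  shows "aligned k (U ** X ** V) (U ** Y ** V) \<longleftrightarrow> aligned k X Y"
  using ky_fan_orthogonal[OF k_le assms]
  by (simp add: aligned_def flip: matrix_add_left matrix_add_ldistrib)

lemma extremal_conj:
  fixes A :: "real^'n^'n"
  assumes UV: "orthogonal_matrix U" "orthogonal_matrix V" and A: "extremal k A"
  shows "extremal k (U ** A ** V)"
proof (rule extremal_linear_image[where T = "\<lambda>X. U ** X ** V" and S = "\<lambda>X. transpose U ** X ** transpose V"])
  show "aligned k (transpose U ** X ** transpose V) (transpose U ** Y ** transpose V)"
    if "aligned k X Y" for X Y :: "real^'n^'n"
    using UV that by (subst aligned_conj) auto
qed (use UV A in \<open>simp_all add: linear_conj orthogonal_conj_inverse\<close>)

lemma extremal_scaleR:
  fixes A :: "real^'n^'n"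
  assumes "c \<noteq> 0" "extremal k A"
  shows "extremal k (c *\<^sub>R A)"
proof (rule extremal_linear_image[where T = "\<lambda>X. c *\<^sub>R X" and S = "\<lambda>X. (1 / c) *\<^sub>R X"])
  show "aligned k ((1 / c) *\<^sub>R X) ((1 / c) *\<^sub>R Y)" if "aligned k X Y" for X Y :: "real^'n^'n"
    using that by (simp add: aligned_def ky_fan_scaleR[OF k_le] distrib_left flip: scaleR_add_right)
qed (use assms in \<open>auto intro!: linear_scale_self linear_compose_scale_right linear_ident\<close>)

text \<open>The matrix lies in the face of every \<open>W\<close> in \<open>pisom k\<close> whose
  entry at \<open>(p, p)\<close> is 1, and so does each summand \<open>X\<close> of an aligned
  decomposition. Pairs of such \<open>W\<close> differing by signs show that the other entries of
  \<open>X\<close> vanish.\<close>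

lemma extremal_axis_outer: "extremal k (outer (axis p 1) (axis p 1) :: real^'n^'n)"
  unfolding extremal_def
proof (intro conjI allI impI)
  let ?E = "outer (axis p 1) (axis p 1) :: real^'n^'n"
  show "?E \<noteq> 0" by (simp add: axis_eq_0_iff)
  fix X Y :: "real^'n^'n" assume XY: "aligned k X Y" "X + Y = ?E"
  have in_face: "X \<in> face k W" if W: "W \<in> pisom k" "W $ p $ p = 1" for W
  proof -
    have "?E \<in> face k W"
      using W by (intro outer_in_face[OF k_le])
        (simp_all add: matrix_vector_mult_basis column_def)
    then show ?thesis using aligned_imp_face[OF k_le XY(1) W(1)] XY(2) by simp
  qed
  have sgn: "orthogonal_matrix (diagm (\<lambda>a. if a = i then -1 else 1) :: real^'n^'n)" for i :: 'n
    by (rule orthogonal_diagm) simp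
  have cross: "X $ p $ j = 0 \<and> X $ j $ p = 0" if "j \<noteq> p" for j
  proof -
    have "card {p, j} \<le> k" using k1 that by simp
    from obtain_superset_card[OF this k_le subset_UNIV]
    obtain J where J: "{p, j} \<subseteq> J" "card J = k" by blast
    \<comment> \<open>\<open>X\<close> is tested with \<open>?D\<close> and with \<open>?D\<close>
      after negating row \<open>j\<close>: one makes the entries at \<open>(p, j)\<close> and
      \<open>(j, p)\<close> equal, the other one opposite.\<close>
    let ?D = "diagm (indicator J) :: real^'n^'n"
    let ?s = "diagm (\<lambda>a. if a = j then -1 else 1) :: real^'n^'n"
    have 1: "X \<in> bisym ?D"
      using J that face_subset_bisym[OF k_le diagm_indicator_pisom[OF J(2)]]
      by (intro subsetD[OF _ in_face]) (auto simp: diagm_indicator_pisom diagm_nth)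
    have sD: "?s ** ?D ** mat 1 \<in> pisom k" using J by (intro pisomI sgn orthogonal_matrix_id)
    have "(?s ** ?D ** mat 1) $ p $ p = 1" using J that by (auto simp: diagm_mult_left diagm_nth)
    then have "X \<in> bisym (?s ** ?D)"
      using in_face[OF sD] face_subset_bisym[OF k_le sD] by auto
    then have "transpose (transpose (?s ** ?D) ** X) $ p $ j = (transpose (?s ** ?D) ** X) $ p $ j"
      by (simp add: bisym_def)
    moreover have "transpose (?s ** ?D) = diagm (\<lambda>a. (if a = j then -1 else 1) * indicator J a)"
      by (simp add: diagm_mult_diagm)
    ultimately have "- X $ j $ p = X $ p $ j"
      using J that by (simp add: transpose_def[of "_ ** _"] diagm_mult_left)
    moreover have "X $ j $ p = X $ p $ j" using 1 J by (auto simp: bisym_diagm_indicator)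
    ultimately show ?thesis by simp
  qed
  have rest: "X $ i $ j = 0" if "i \<noteq> p" "j \<noteq> p" for i j
  proof -
    define \<pi> where "\<pi> x = (if x = i then j else if x = j then i else x)" for x
    have "bij \<pi>" by (rule involuntory_imp_bij) (auto simp: \<pi>_def)
    then have P: "orthogonal_matrix (permm \<pi>)" by (rule orthogonal_permm)
    have "card {p, i} \<le> k" using k1 that by simp
    from obtain_superset_card[OF this k_le subset_UNIV]
    obtain J where J: "{p, i} \<subseteq> J" "card J = k" by blast
    \<comment> \<open>\<open>W\<close> and \<open>W'\<close> differ in the single entry
      \<open>(i, j)\<close>, and both pair with \<open>X\<close> to its norm.\<close>
    define W where "W = mat 1 ** diagm (indicator J) ** permm \<pi>"
    define W' where "W' = diagm (\<lambda>a. if a = i then -1 else 1) ** diagm (indicator J) ** permm \<pi>"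
    have W: "W \<in> pisom k" "W' \<in> pisom k"
      unfolding W_def W'_def by (rule pisomI[OF orthogonal_matrix_id P J(2)], rule pisomI[OF sgn P J(2)])
    have W_nth: "W $ a $ b = (if a \<in> J \<and> a = \<pi> b then 1 else 0)"
      and W'_nth: "W' $ a $ b = (if a = i then - W $ a $ b else W $ a $ b)" for a b
      by (auto simp: W_def W'_def diagm_mult_diagm diagm_mult_left permm_def)
    have "W $ p $ p = 1" "W' $ p $ p = 1" using J that by (auto simp: W_nth W'_nth \<pi>_def)
    then have "X \<bullet> (W - W') = 0" using in_face[OF W(1)] in_face[OF W(2)] by (simp add: face_iff inner_diff_right)
    moreover have "W - W' = 2 *\<^sub>R outer (axis i 1) (axis j 1)"
    proof -
      have "i = \<pi> b \<longleftrightarrow> b = j" for b by (auto simp: \<pi>_def)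
      then show ?thesis using J by (auto simp: vec_eq_iff W'_nth W_nth axis_component)
    qed
    ultimately have "outer (axis i 1) (axis j 1) \<bullet> X = 0"
by (simp add: inner_commute)
    then show ?thesis by (simp add: inner_outer matrix_vector_mult_basis column_def)
  qed
  have "X $ i $ j = 0" if "i \<noteq> p \<or> j \<noteq> p" for i j
    using that cross rest by metis
  then have "X = (X $ p $ p) *\<^sub>R ?E"
    by (auto simp: vec_eq_iff axis_component)
  then show "\<exists>c. X = c *\<^sub>R ?E" by blast
qed

lemma extremal_outer:
  fixes x y :: "real^'n"
  assumes "x \<noteq> 0" "y \<noteq> 0"
  shows "extremal k (outer x y)"
proof -
  obtain p :: 'n where True by blast
  obtain U V where UV: "orthogonal_matrix U" "orthogonal_matrix V"
    "outer x y = (norm x * norm y) *\<^sub>R (U ** outer (axis p 1) (axis p 1) ** V)"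
    using outer_svd by blast
  show ?thesis unfolding UV(3)
    using assms by (intro extremal_scaleR extremal_conj UV extremal_axis_outer) auto
qed

text \<open>As \<open>k < card P\<close>, for \<open>i\<close> in \<open>P\<close> some admissible
  \<open>J\<close> contains \<open>i\<close> but not \<open>j\<close>. Its mixed block kills the
  off-diagonal entries, and exchanging \<open>i\<close> for \<open>j\<close> in \<open>J\<close>
  compares the diagonal ones.\<close>

lemma face_indicators_imp:
  fixes X :: "real^'n^'n"
  assumes P: "k < card P" and X: "\<And>J. J \<subseteq> P \<Longrightarrow> card J = k \<Longrightarrow> X \<in> face k (diagm (indicator J))"
  shows "i \<in> P \<Longrightarrow> i \<noteq> j \<Longrightarrow> X $ i $ j = 0 \<and> X $ j $ i = 0" "i \<in> P \<Longrightarrow> j \<in> P \<Longrightarrow> X $ i $ i = X $ j $ j"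
proof -
  have sep: "\<exists>J. J \<subseteq> P \<and> card J = k \<and> i \<in> J \<and> j \<notin> J" if ij: "i \<in> P" "i \<noteq> j" for i j
  proof -
    have "card {i} \<le> k" "k \<le> card (P - {j})" "{i} \<subseteq> P - {j}"
      using k1 P ij by (auto simp: card_Diff_singleton_if)
    from obtain_superset_card[OF this]
    obtain J where "{i} \<subseteq> J" "J \<subseteq> P - {j}" "card J = k" by blast
    then show ?thesis by (intro exI[of _ J]) auto
  qed
  show "X $ i $ j = 0 \<and> X $ j $ i = 0" if ij: "i \<in> P" "i \<noteq> j" for i j
  proof -
    obtain J where J: "J \<subseteq> P" "card J = k" "i \<in> J" "j \<notin> J" using sep[OF ij] by blast
    have "X \<in> bisym (diagm (indicator J))"
      using X[OF J(1,2)] face_subset_bisym[OF k_le diagm_indicator_pisom[OF J(2)]] by blast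
    then show ?thesis using J by (simp add: bisym_diagm_indicator)
  qed
  show "X $ i $ i = X $ j $ j" if ij: "i \<in> P" "j \<in> P" for i j
  proof (cases "i = j")
    case False
    obtain J where J: "J \<subseteq> P" "card J = k" "i \<in> J" "j \<notin> J" using sep[OF ij(1) False] by blast
    define J' where "J' = insert j (J - {i})"
    have J': "J' \<subseteq> P" "card J' = k"
      using J ij k1 by (auto simp: J'_def card_insert_if)
    have "(\<Sum>a\<in>J. X $ a $ a) = (\<Sum>a\<in>J'. X $ a $ a)"
      using X[OF J(1,2)] X[OF J'] by (simp add: face_iff inner_diagm_indicator)
    moreover have "(\<Sum>a\<in>J. X $ a $ a) = X $ i $ i + (\<Sum>a\<in>J - {i}. X $ a $ a)"
      using J by (simp add: sum.remove)
    moreover have "(\<Sum>a\<in>J'. X $ a $ a) = X $ j $ j + (\<Sum>a\<in>J - {i}. X $ a $ a)"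
      using J by (simp add: J'_def)
    ultimately show ?thesis by simp
  qed simp
qed

text \<open>The identity lies in the faces of all coordinate projections of rank \<open>k\<close>,
  and for \<open>k < CARD('n)\<close> these faces have only scalar matrices in common.\<close>

lemma extremal_orthogonal:
  fixes G :: "real^'n^'n"
  assumes "k < CARD('n)" "orthogonal_matrix G"
  shows "extremal k G"
proof -
  have "extremal k (mat 1 :: real^'n^'n)"
    unfolding extremal_def
  proof (intro conjI allI impI)
    show "(mat 1 :: real^'n^'n) \<noteq> 0" by (simp add: vec_eq_iff mat_def)
    fix X Y :: "real^'n^'n" assume XY: "aligned k X Y" "X + Y = mat 1"
    have "X \<in> face k (diagm (indicator J))" if "card J = k" for J
    proof (rule aligned_imp_face(1)[OF k_le XY(1)])
      show "X + Y \<in> face k (diagm (indicator J))"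
        using that ky_fan_orthogonal_matrix[OF k1 k_le orthogonal_matrix_id]
        by (simp add: XY(2) face_iff inner_diagm_indicator mat_def)
    qed (rule diagm_indicator_pisom[OF that])
    note * = face_indicators_imp[of UNIV X, OF assms(1) this]
    obtain p :: 'n where True by blast
    have "X = (X $ p $ p) *\<^sub>R mat 1"
      using * by (auto simp: vec_eq_iff mat_def)
    then show "\<exists>c. X = c *\<^sub>R mat 1" by blast
  qed
  from extremal_conj[OF assms(2) orthogonal_matrix_id this] show ?thesis by simp
qed

text \<open>Outside \<open>I\<close> the entries may be negative; their signs are moved into an
  orthogonal factor before the maximum principle is applied.\<close>

lemma diagm_in_face:
  fixes e :: "'n \<Rightarrow> real"
  assumes I: "card I = k" and e: "\<And>i. i \<in> I \<Longrightarrow> 0 \<le> e i" "\<And>i j. i \<in> I \<Longrightarrow> j \<notin> I \<Longrightarrow> \<bar>e j\<bar> \<le> e i"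
  shows "diagm e \<in> face k (diagm (indicator I))"
proof -
  define s where "s i = (if e i < 0 then -1 else 1 :: real)" for i
  have s: "orthogonal_matrix (diagm s)" by (rule orthogonal_diagm) (simp add: s_def)
  have "diagm e = diagm s ** diagm (\<lambda>i. \<bar>e i\<bar>)"
    by (simp add: vec_eq_iff diagm_mult_diagm diagm_nth s_def)
  then have eq: "diagm e = diagm s ** diagm (\<lambda>i. \<bar>e i\<bar>) ** mat 1" by simp
  obtain W where W: "W \<in> pisom k" "diagm e \<bullet> W = ky_fan_norm k (diagm e)"
    using ky_fan_attained[OF k_le] by blast
  have "diagm e \<bullet> W \<le> (\<Sum>i\<in>I. \<bar>e i\<bar>)"
    unfolding eq using W(1) I e by (intro inner_pisom_le_top_sum s orthogonal_matrix_id) auto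
  then have "ky_fan_norm k (diagm e) \<le> (\<Sum>i\<in>I. e i)" using W e by simp
  moreover have "diagm e \<bullet> diagm (indicator I) = (\<Sum>i\<in>I. e i)"
    by (simp add: inner_diagm_indicator diagm_nth)
  ultimately show ?thesis
    using inner_le_ky_fan[OF k_le diagm_indicator_pisom[OF I], of "diagm e"] by (simp add: face_iff)
qed

text \<open>By \<open>key\<close>, a splitting of \<open>d\<close> into two diagonals of one face
  must be proportional to \<open>d\<close>. Each case offers a splitting for which this forces one
  of the two patterns or is absurd.\<close>

lemma extremal_diagm_cases:
  fixes d :: "'n \<Rightarrow> real"
  assumes ex: "extremal k (diagm d)" and d: "\<And>i. 0 \<le> d i"
  shows "(\<exists>p c. diagm d = c *\<^sub>R outer (axis p 1) (axis p 1)) \<or> (k < CARD('n) \<and> (\<exists>s. \<forall>i. d i = s))"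
proof -
  have key: "\<exists>c. \<forall>i. e i = c * d i"
    if "card I = k" "diagm e \<in> face k (diagm (indicator I))" "diagm (\<lambda>i. d i - e i) \<in> face k (diagm (indicator I))"
    for I and e :: "'n \<Rightarrow> real"
  proof -
    have "aligned k (diagm e) (diagm (\<lambda>i. d i - e i))"
      using face_add[OF k_le diagm_indicator_pisom[OF that(1)] that(2,3)] by blast
    moreover have "diagm e + diagm (\<lambda>i. d i - e i) = diagm d" by (simp add: vec_eq_iff diagm_nth)
    ultimately obtain c where c: "diagm e = c *\<^sub>R diagm d" using ex unfolding extremal_def by blast
    have "e i = c * d i" for i using arg_cong[OF c, of "\<lambda>M. M $ i $ i"] by (simp add: diagm_nth)
    then show ?thesis by blast
  qed
  have rank_one: "\<exists>p c. diagm d = c *\<^sub>R outer (axis p 1) (axis p 1)"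
    if "\<forall>i. (if i = p then a else 0) = c * d i" "a \<noteq> 0" for p a c
  proof -
    have "c \<noteq> 0" using that(1)[rule_format, of p] that(2) by auto
    then have "d i = 0" if "i \<noteq> p" for i using \<open>\<forall>i. _ = _\<close>[rule_format, of i] that by simp
    then have "diagm d = d p *\<^sub>R outer (axis p 1) (axis p 1)"
      by (auto simp: vec_eq_iff diagm_nth axis_component)
    then show ?thesis by blast
  qed
  obtain I where I: "card I = k" "\<And>i j. i \<in> I \<Longrightarrow> j \<notin> I \<Longrightarrow> d j \<le> d i"
    using ky_fan_norm_svd[of "mat 1 :: real^'n^'n" "mat 1" d k] d k_le by (auto simp: orthogonal_matrix_id)
  have fin: "finite (d ` I)" "d ` I \<noteq> {}" using I(1) k1 by auto
  obtain p where p: "p \<in> I" "d p = Max (d ` I)" using Max_in[OF fin] by auto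
  obtain q where q: "q \<in> I" "d q = Min (d ` I)" using Min_in[OF fin] by auto
  have pq: "d i \<le> d p" "d q \<le> d i" if "i \<in> I" for i using that fin p q by auto
  have d_le: "d i \<le> d p" for i using pq(1)[of i] I(2)[OF p(1), of i] by blast
  have dp: "d p > 0"
  proof (rule ccontr)
    assume "\<not> d p > 0"
    then have "d i = 0" for i using d_le[of i] d[of i] by linarith
    then have "diagm d = 0" by (simp add: vec_eq_iff diagm_nth)
    then show False using ex by (simp add: extremal_def)
  qed
  show ?thesis
  proof (cases "k = CARD('n)")
    case True
    then have I_UNIV: "I = UNIV" using I(1) card_seteq[of UNIV I] by simp
    \<comment> \<open>With \<open>I\<close> the whole index set, nonnegativity is all that the face
      demands of a diagonal, so a single entry can be split off.\<close>
    have "\<exists>c. \<forall>i. (if i = p then d p else 0) = c * d i"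
    proof (rule key[OF I(1)])
      show "diagm (\<lambda>i. if i = p then d p else 0) \<in> face k (diagm (indicator I))"
        by (rule diagm_in_face[OF I(1)]) (use d I_UNIV in auto)
      show "diagm (\<lambda>i. d i - (if i = p then d p else 0)) \<in> face k (diagm (indicator I))"
        by (rule diagm_in_face[OF I(1)]) (use d I_UNIV in auto)
    qed
    then show ?thesis using rank_one[of p "d p"] dp by auto
  next
    case kn: False
    show ?thesis
    proof (cases "d q < d p")
      case True
      \<comment> \<open>The excess of the largest over the smallest entry on \<open>I\<close> can be
        removed at \<open>p\<close> without leaving the face.\<close>
      have "\<exists>c. \<forall>i. (if i = p then d p - d q else 0) = c * d i"
      proof (rule key[OF I(1)])
        show "diagm (\<lambda>i. if i = p then d p - d q else 0) \<in> face k (diagm (indicator I))"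
          using True p by (intro diagm_in_face[OF I(1)]) auto
        show "diagm (\<lambda>i. d i - (if i = p then d p - d q else 0)) \<in> face k (diagm (indicator I))"
        proof (rule diagm_in_face[OF I(1)])
          fix a b assume ab: "a \<in> I" "b \<notin> I"
          then have "b \<noteq> p" using p by auto
          then show "\<bar>d b - (if b = p then d p - d q else 0)\<bar> \<le> d a - (if a = p then d p - d q else 0)"
            using d[of b] I(2)[OF ab] I(2)[OF q(1) ab(2)] by auto
        qed (use d in auto)
      qed
      then show ?thesis using rank_one[of p "d p - d q"] True by auto
    next
      case False
      then have const: "d i = d p" if "i \<in> I" for i using pq[OF that] by simp
      have "d j = d p" for j
      proof (rule ccontr)
        assume j: "d j \<noteq> d p"
        then have jI: "j \<notin> I" using const by blast
        have jp: "d j < d p" using j d_le[of j] by simp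
        \<comment> \<open>Half of \<open>d\<close>, with the entry at \<open>j\<close> raised to
          half the maximum; the entry at \<open>j\<close> of the other summand stays within the same
          bound in absolute value.\<close>
        have "\<exists>c. \<forall>i. (if i = j then d p / 2 else d i / 2) = c * d i"
        proof (rule key[OF I(1)])
          show "diagm (\<lambda>i. if i = j then d p / 2 else d i / 2) \<in> face k (diagm (indicator I))"
            using jI d d_le const by (intro diagm_in_face[OF I(1)]) (auto split: if_splits)
          show "diagm (\<lambda>i. d i - (if i = j then d p / 2 else d i / 2)) \<in> face k (diagm (indicator I))"
          proof (rule diagm_in_face[OF I(1)])
            fix a b assume ab: "a \<in> I" "b \<notin> I"
            have "\<bar>d b - (if b = j then d p / 2 else d b / 2)\<bar> \<le> d p / 2"
              using d[of b] d_le[of b] by (auto simp: abs_if)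
            then show "\<bar>d b - (if b = j then d p / 2 else d b / 2)\<bar> \<le> d a - (if a = j then d p / 2 else d a / 2)"
              using ab jI const[OF ab(1)] by auto
          qed (use jI d in auto)
        qed
        then obtain c where c: "\<And>i. (if i = j then d p / 2 else d i / 2) = c * d i" by blast
        have "p \<noteq> j" using p jI by blast
        then have half: "c = 1 / 2" using c[of p] dp by (simp add: field_simps)
        show False using c[of j] jp unfolding half by simp
      qed
      then show ?thesis using kn k_le by auto
    qed
  qed
qed

lemma extremal_cases:
  fixes A :: "real^'n^'n"
  assumes "extremal k A"
  shows "(\<exists>x y. x \<noteq> 0 \<and> y \<noteq> 0 \<and> A = outer x y) \<or>
    (k < CARD('n) \<and> (\<exists>c G. c > 0 \<and> orthogonal_matrix G \<and> A = c *\<^sub>R G))"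
proof -
  obtain U V d where *: "orthogonal_matrix U" "orthogonal_matrix V" "\<And>i. 0 \<le> d i" "A = U ** diagm d ** V"
    using svd[of A] by auto
  have "extremal k (transpose U ** A ** transpose V)" using assms * by (intro extremal_conj) auto
  then have ex: "extremal k (diagm d)" by (simp add: *(4) orthogonal_conj_inverse[OF *(1,2)])
  then have d0: "diagm d \<noteq> 0" by (simp add: extremal_def)
  from extremal_diagm_cases[OF ex *(3)] show ?thesis
  proof
    assume "\<exists>p c. diagm d = c *\<^sub>R outer (axis p 1) (axis p 1)"
    then obtain p c where pc: "diagm d = c *\<^sub>R outer (axis p 1) (axis p 1)" by blast
    have A: "A = outer (c *\<^sub>R (U *v axis p 1)) (transpose V *v axis p 1)"
      by (simp add: *(4) pc matrix_distribs mult_outer outer_mult outer_scaleR_left)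
    moreover have "A \<noteq> 0" using assms by (simp add: extremal_def)
    ultimately show ?thesis by (metis outer_eq_0_iff)
  next
    assume "k < CARD('n) \<and> (\<exists>s. \<forall>i. d i = s)"
    then obtain s where s: "k < CARD('n)" "d = (\<lambda>i. s)" by auto
    have "diagm d = s *\<^sub>R mat 1" by (simp add: s(2) vec_eq_iff diagm_nth mat_def)
    then have "A = s *\<^sub>R (U ** V)" "s \<noteq> 0" using d0 by (auto simp: *(4) matrix_distribs)
    moreover have "s \<ge> 0" using *(3) s(2) by simp
    ultimately show ?thesis using s(1) * by (metis orthogonal_matrix_mul order_le_less)
  qed
qed

end

section \<open>Maps preserving matrices of rank one\<close>

definition munit :: "'n \<Rightarrow> 'n \<Rightarrow> real^'n^'n" where
  "munit i j = outer (axis i 1) (axis j 1)"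

lemma munit_nth: "munit i j $ a $ b = (if a = i \<and> b = j then 1 else 0)"
  by (simp add: munit_def axis_component)

lemma transpose_munit [simp]: "transpose (munit i j) = munit j i"
  by (simp add: munit_def)

lemma matrix_mult_0 [simp]: "A ** 0 = 0" "0 ** B = 0" for A :: "real^'n^'m" and B :: "real^'n^'m"
  by (simp_all add: vec_eq_iff matrix_matrix_mult_def)

text \<open>The image of the all-ones matrix is the coefficient matrix \<open>c\<close>, so its rank
  one factorisation separates the two indices of \<open>c\<close>.\<close>

lemma linear_diagonal_form:
  fixes T :: "real^'n^'n \<Rightarrow> real^'n^'n"
  assumes T: "linear T" and diag: "\<And>i j. T (munit i j) = c i j *\<^sub>R munit i j"
    and rk: "\<exists>a b. T (outer (\<chi> i. 1) (\<chi> i. 1)) = outer a b"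
  shows "\<exists>a b. \<forall>X. T X = diagm a ** X ** diagm b"
proof -
  have TX: "T X $ i $ j = c i j * X $ i $ j" for X i j
  proof -
    have "T X = T (\<Sum>i\<in>UNIV. \<Sum>j\<in>UNIV. X $ i $ j *\<^sub>R munit i j)"
      unfolding munit_def by (subst matrix_expansion[of X]) (rule refl)
    also have "\<dots> = (\<Sum>i\<in>UNIV. \<Sum>j\<in>UNIV. X $ i $ j *\<^sub>R c i j *\<^sub>R munit i j)"
      by (simp add: linear_sum[OF T] linear_scale[OF T] diag)
    also have "\<dots> = (\<Sum>i\<in>UNIV. \<Sum>j\<in>UNIV. (\<chi> i j. c i j * X $ i $ j) $ i $ j *\<^sub>R munit i j)"
      by (simp add: mult.commute)
    also have "\<dots> = (\<chi> i j. c i j * X $ i $ j)"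
      unfolding munit_def by (rule matrix_expansion[symmetric])
    finally show ?thesis by simp
  qed
  obtain a b where ab: "T (outer (\<chi> i. 1) (\<chi> i. 1)) = outer a b" using rk by blast
  have c: "c i j = a $ i * b $ j" for i j
    using TX[of "outer (\<chi> i. 1) (\<chi> i. 1)" i j] by (simp add: ab)
  have "T X = diagm (\<lambda>i. a $ i) ** X ** diagm (\<lambda>i. b $ i)" for X
    by (simp add: vec_eq_iff TX c diagm_mult_left diagm_mult_right)
  then show ?thesis by blast
qed

text \<open>All 2 by 2 minors of the image of a rank one matrix vanish. This confines the image of
  \<open>munit i j\<close> to a multiple of \<open>munit i j\<close> or of \<open>munit j i\<close>,
  and the minors for sums sharing a row or a column carry the choice from one unit to the
  next.\<close>

lemma rank_one_preserver_fixing_diagonal: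
  fixes T :: "real^'n^'n \<Rightarrow> real^'n^'n"
  assumes T: "linear T" "inj T" and rk: "\<And>x y. \<exists>u v. T (outer x y) = outer u v"
    and diag: "\<And>i. T (munit i i) = r i *\<^sub>R munit i i" "\<And>i. r i \<noteq> 0"
  shows "(\<exists>a b. \<forall>X. T X = diagm a ** X ** diagm b) \<or> (\<exists>a b. \<forall>X. T X = diagm a ** transpose X ** diagm b)"
proof -
  have minor: "T (outer x y) $ a $ b * T (outer x y) $ c $ d = T (outer x y) $ a $ d * T (outer x y) $ c $ b"
    for x y a b c d
    using rk[of x y] by auto
  have nz: "T (munit i j) \<noteq> 0" for i j
  proof
    assume "T (munit i j) = 0"
    then have "munit i j = 0" using T linear_injective_0 by blast
    then show False by (simp add: munit_def axis_eq_0_iff)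
  qed
  define al where "al i j = T (munit i j) $ i $ j" for i j
  define be where "be i j = T (munit i j) $ j $ i" for i j
  \<comment> \<open>The same minor, taken for the images of \<open>munit i j\<close> and of
    \<open>munit i i + munit i j\<close>, changes by \<open>r i\<close> times the entry in
    question.\<close>
  have off1: "T (munit i j) $ a $ b = 0" if "a \<noteq> i" "b \<noteq> i" "i \<noteq> j" for i j a b
  proof -
    let ?B = "T (munit i j)"
    have "T (outer (axis i 1) (axis i 1 + axis j 1)) = r i *\<^sub>R munit i i + ?B"
      by (simp add: outer_add_right linear_add[OF T(1)] diag flip: munit_def)
    then have "(r i + ?B $ i $ i) * ?B $ a $ b = ?B $ i $ b * ?B $ a $ i"
      using minor[of "axis i 1" "axis i 1 + axis j 1" i i a b] that by (simp add: munit_nth)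
    moreover have "?B $ i $ i * ?B $ a $ b = ?B $ i $ b * ?B $ a $ i"
      using minor[of "axis i 1" "axis j 1" i i a b] by (simp add: munit_def)
    ultimately show ?thesis using diag(2)[of i] by (simp add: algebra_simps)
  qed
  have off2: "T (munit i j) $ a $ b = 0" if "a \<noteq> j" "b \<noteq> j" "i \<noteq> j" for i j a b
  proof -
    let ?B = "T (munit i j)"
    have "T (outer (axis i 1 + axis j 1) (axis j 1)) = r j *\<^sub>R munit j j + ?B"
      by (simp add: outer_add_left linear_add[OF T(1)] diag flip: munit_def)
    then have "(r j + ?B $ j $ j) * ?B $ a $ b = ?B $ j $ b * ?B $ a $ j"
      using minor[of "axis i 1 + axis j 1" "axis j 1" j j a b] that by (simp add: munit_nth)
    moreover have "?B $ j $ j * ?B $ a $ b = ?B $ j $ b * ?B $ a $ j"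
      using minor[of "axis i 1" "axis j 1" j j a b] by (simp add: munit_def)
    ultimately show ?thesis using diag(2)[of j] by (simp add: algebra_simps)
  qed
  have form: "T (munit i j) = al i j *\<^sub>R munit i j + be i j *\<^sub>R munit j i" if ij: "i \<noteq> j" for i j
  proof -
    have "T (munit i j) $ a $ b = (al i j *\<^sub>R munit i j + be i j *\<^sub>R munit j i) $ a $ b" for a b
    proof (cases "(a = i \<and> b = j) \<or> (a = j \<and> b = i)")
      case True
      then show ?thesis using ij by (auto simp: munit_nth al_def be_def)
    next
      case False
      then have "(a \<noteq> i \<and> b \<noteq> i) \<or> (a \<noteq> j \<and> b \<noteq> j)" using ij by auto
      then have "T (munit i j) $ a $ b = 0" using off1[of a i b j] off2[of a j b i] ij by auto
      moreover have "munit i j $ a $ b = 0" "munit j i $ a $ b = 0"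
        using False by (auto simp: munit_nth)
      ultimately show ?thesis by simp
    qed
    then show ?thesis by (simp add: vec_eq_iff)
  qed
  have excl: "al i j = 0 \<or> be i j = 0" if "i \<noteq> j" for i j
    using minor[of "axis i 1" "axis j 1" i j j i] that form[OF that]
    by (simp add: munit_nth flip: munit_def)
  have nonzero: "al i j \<noteq> 0 \<or> be i j \<noteq> 0" if "i \<noteq> j" for i j
    using nz[of i j] form[OF that] by auto
  have row: "be i l = 0" if "al i j \<noteq> 0" "i \<noteq> j" "i \<noteq> l" for i j l
  proof (cases "j = l")
    case True
    then show ?thesis using excl[of i j] that by simp
  next
    case False
    have "T (outer (axis i 1) (axis j 1 + axis l 1)) = T (munit i j) + T (munit i l)"
      by (simp add: outer_add_right linear_add[OF T(1)] flip: munit_def)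
    then show ?thesis
      using minor[of "axis i 1" "axis j 1 + axis l 1" i j l i] that False
      by (simp add: form munit_nth)
  qed
  have col: "be l j = 0" if "al i j \<noteq> 0" "i \<noteq> j" "l \<noteq> j" for i j l
  proof (cases "i = l")
    case True
    then show ?thesis using excl[of i j] that by simp
  next
    case False
    have "T (outer (axis i 1 + axis l 1) (axis j 1)) = T (munit i j) + T (munit l j)"
      by (simp add: outer_add_left linear_add[OF T(1)] flip: munit_def)
    then show ?thesis
      using minor[of "axis i 1 + axis l 1" "axis j 1" i j j l] that False
      by (simp add: form munit_nth)
  qed
  \<comment> \<open>Otherwise \<open>munit i j\<close> and \<open>munit j i\<close> would have
    proportional images, against injectivity.\<close>
  have swap: "be j i = 0" if "al i j \<noteq> 0" "i \<noteq> j" for i j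
  proof (rule ccontr)
    assume b: "be j i \<noteq> 0"
    then have "al j i = 0" "be i j = 0" using excl[of i j] excl[of j i] that by auto
    then have "T (munit i j) = al i j *\<^sub>R munit i j" "T (munit j i) = be j i *\<^sub>R munit i j"
      using form that by auto
    then have "T (be j i *\<^sub>R munit i j) = T (al i j *\<^sub>R munit j i)"
      by (simp add: linear_scale[OF T(1)])
    then have "be j i *\<^sub>R munit i j = al i j *\<^sub>R munit j i" using T(2) by (simp add: inj_eq)
    from arg_cong[OF this, of "\<lambda>M. M $ i $ j"] show False using that b by (simp add: munit_nth)
  qed
  have all: "be l m = 0" if ij: "al i j \<noteq> 0" "i \<noteq> j" and lm: "l \<noteq> m" for i j l m
  proof -
    have step: "al l m \<noteq> 0" if "be l m = 0" "l \<noteq> m" for l m using nonzero[of l m] that by simp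
    show ?thesis
    \<comment> \<open>One index is changed at a time. For \<open>l = j\<close> replacing the row
      index first would end on the diagonal, so \<open>swap\<close> leads to \<open>(j, i)\<close>
      instead.\<close>
    proof (cases "l = j")
      case True
      have "al j i \<noteq> 0" using step[OF swap[OF ij]] ij by simp
      then show ?thesis using row[of j i m] ij lm True by auto
    next
      case False
      then have "al l j \<noteq> 0" using step[OF col[OF ij False]] False by simp
      then show ?thesis using row[of l j m] False lm by auto
    qed
  qed
  show ?thesis
  proof (cases "\<exists>i j. i \<noteq> j \<and> al i j \<noteq> 0")
    case True
    then obtain i0 j0 where ij0: "al i0 j0 \<noteq> 0" "i0 \<noteq> j0" by auto
    have be0: "be i j = 0" if "i \<noteq> j" for i j using all[OF ij0 that] .
    have "T (munit i j) = (if i = j then r i else al i j) *\<^sub>R munit i j" for i j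
      using form[of i j] be0[of i j] diag(1)[of i] by auto
    from linear_diagonal_form[OF T(1) this rk] show ?thesis by (rule disjI1)
  next
    case False
    \<comment> \<open>Now all off-diagonal \<open>al\<close> vanish; composing with the transpose
      exchanges the roles of \<open>al\<close> and \<open>be\<close>.\<close>
    let ?T = "\<lambda>X. T (transpose X)"
    have "linear ?T" by (intro linearI) (simp_all add: linear_add[OF T(1)] linear_scale[OF T(1)])
    moreover have "?T (munit i j) = (if i = j then r i else be j i) *\<^sub>R munit i j" for i j
    proof (cases "i = j")
      case ij: False
      then have "al j i = 0" using False by metis
      then show ?thesis using form[of j i] ij by simp
    qed (use diag(1) in simp)
    moreover have "\<exists>u v. ?T (outer x y) = outer u v" for x y using rk[of y x] by simp
    ultimately have "\<exists>a b. \<forall>X. ?T X = diagm a ** X ** diagm b"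
      by (rule linear_diagonal_form)
    then obtain a b where ab: "\<forall>X. ?T X = diagm a ** X ** diagm b" by blast
    have "T X = diagm a ** transpose X ** diagm b" for X
      using ab[rule_format, of "transpose X"] by simp
    then show ?thesis by blast
  qed
qed

lemma orthogonal_of_orthogonal_family:
  fixes u :: "'n \<Rightarrow> real^'n"
  assumes "\<And>i. u i \<noteq> 0" "\<And>i j. i \<noteq> j \<Longrightarrow> u i \<bullet> u j = 0"
  obtains U where "orthogonal_matrix U" "\<And>i. transpose U *v u i = norm (u i) *\<^sub>R axis i 1"
proof -
  define U where "U = (\<chi> a i. u i $ a / norm (u i))"
  have "(transpose U ** U) $ i $ j = (u i \<bullet> u j) / (norm (u i) * norm (u j))" for i j
    by (simp add: U_def matrix_matrix_mult_def transpose_def inner_vec_def sum_divide_distrib)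
  moreover have "(u i \<bullet> u j) / (norm (u i) * norm (u j)) = (if i = j then 1 else 0)" for i j
    using assms(1)[of j] assms(2)[of i j] by (simp add: dot_square_norm power2_eq_square)
  ultimately have "transpose U ** U = mat 1" by (simp add: vec_eq_iff mat_def)
  then have "orthogonal_matrix U" by (simp add: orthogonal_matrix)
  moreover have "transpose U *v u i = norm (u i) *\<^sub>R axis i 1" for i
  proof -
    have "(transpose U *v u i) $ j = (u j \<bullet> u i) / norm (u j)" for j
      by (simp add: U_def matrix_vector_mult_def transpose_def inner_vec_def sum_divide_distrib)
    then show ?thesis
      using assms(1)[of i] assms(2)[of _ i]
      by (simp add: vec_eq_iff axis_component dot_square_norm power2_eq_square)
  qed
  ultimately show ?thesis using that by blast
qed

lemma diagm_eq_scaled_orthogonal: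
  fixes a :: "'n::finite \<Rightarrow> real"
  assumes "\<And>i j. (a i)\<^sup>2 = (a j)\<^sup>2" "diagm a \<noteq> 0"
  obtains c Q where "c > 0" "orthogonal_matrix Q" "diagm a = c *\<^sub>R Q"
proof -
  obtain p :: 'n where True by blast
  define m where "m = \<bar>a p\<bar>"
  have abs: "\<bar>a i\<bar> = m" for i
    using assms(1)[of i p] by (simp add: m_def power2_eq_iff abs_eq_iff)
  have "m \<noteq> 0"
  proof
    assume "m = 0"
    then have "a i = 0" for i using abs[of i] by simp
    then have "diagm a = 0" by (simp add: vec_eq_iff diagm_nth)
    then show False using assms(2) by simp
  qed
  then have m: "m > 0" by (simp add: m_def)
  then have "orthogonal_matrix (diagm (\<lambda>i. a i / m))"
    by (intro orthogonal_diagm) (simp add: abs abs_divide)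
  moreover have "diagm a = m *\<^sub>R diagm (\<lambda>i. a i / m)"
    using m by (simp add: vec_eq_iff diagm_nth)
  ultimately show ?thesis using that m by blast
qed

context
  fixes k :: nat
  assumes k1: "1 < k" and k_le: "k \<le> CARD('n::finite)"
begin

lemma aligned_outer_pm:
  fixes x y x' y' :: "real^'n"
  assumes "x \<bullet> x' = 0" "y \<bullet> y' = 0"
  shows "aligned k (outer x y) (outer x' y')" "aligned k (outer x y) (- outer x' y')"
  using aligned_outer[OF k1 k_le assms] aligned_outer[OF k1 k_le, of x "- x'" y y'] assms
  by (simp_all add: outer_minus_left)

text \<open>The sum and the difference of two axis vectors are orthogonal, and alignment with both
  signs forces their images to be orthogonal as well. The inner product of these images is a
  difference of two squared diagonal entries.\<close>

lemma diagonal_form_is_conformal: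
  fixes a b :: "'n \<Rightarrow> real" and T :: "real^'n^'n \<Rightarrow> real^'n^'n"
  assumes T: "\<And>x y. T (outer x y) = outer (diagm a *v x) (diagm b *v y)"
    and inj: "\<And>X. T X = 0 \<Longrightarrow> X = 0" and T_minus: "\<And>X. T (- X) = - T X"
    and al: "\<And>A B. aligned k A B \<Longrightarrow> aligned k (T A) (T B)"
  obtains c P d Q where "c > 0" "d > 0" "orthogonal_matrix P" "orthogonal_matrix Q"
    "diagm a = c *\<^sub>R P" "diagm b = d *\<^sub>R Q"
proof -
  have T_nz: "diagm a *v x \<noteq> 0 \<and> diagm b *v x \<noteq> 0" if "x \<noteq> 0" for x
    using inj[of "outer x x"] that by (auto simp: T)
  have "(a i)\<^sup>2 = (a j)\<^sup>2 \<and> (b i)\<^sup>2 = (b j)\<^sup>2" for i j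
  proof (cases "i = j")
    case False
    define x where "x = (axis i 1 + axis j 1 :: real^'n)"
    define x' where "x' = (axis i 1 - axis j 1 :: real^'n)"
    have nz: "x \<noteq> 0" "x' \<noteq> 0"
    proof -
      have "x $ i = 1" "x' $ i = 1" using False by (simp_all add: x_def x'_def axis_component)
      then show "x \<noteq> 0" "x' \<noteq> 0" by auto
    qed
    have "x \<bullet> x' = 0" using False
      by (simp add: x_def x'_def inner_add_left inner_diff_right inner_axis_axis axis_component)
    note * = aligned_outer_pm[OF this this, THEN al]
    have "(diagm c *v x) \<bullet> (diagm c *v x') = (c i)\<^sup>2 - (c j)\<^sup>2" for c :: "'n \<Rightarrow> real"
    proof -
      have D: "diagm c *v axis l 1 = c l *\<^sub>R axis l 1" for l
        by (auto simp: vec_eq_iff diagm_vmult axis_component)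
      show ?thesis using False
        by (simp add: x_def x'_def matrix_vector_right_distrib matrix_vector_mult_diff_distrib D
            inner_add_left inner_diff_right inner_axis_axis axis_component power2_eq_square)
    qed
    moreover have "(diagm a *v x) \<bullet> (diagm a *v x') = 0" "(diagm b *v x) \<bullet> (diagm b *v x') = 0"
      using outer_aligned_orthogonal[OF k1 k_le, of "diagm a *v x" "diagm a *v x'" "diagm b *v x" "diagm b *v x'"]
        * T_nz nz by (simp_all add: T T_minus)
    ultimately show ?thesis by simp
  qed simp
  moreover have "diagm a \<noteq> 0" "diagm b \<noteq> 0"
    using T_nz[of "axis undefined 1"] by (auto simp: axis_eq_0_iff)
  ultimately show ?thesis
    using diagm_eq_scaled_orthogonal[of a] diagm_eq_scaled_orthogonal[of b] that by metis
qed

text \<open>Alignment with both signs makes the left and the right vectors of the images of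
  \<open>munit i i\<close> orthogonal families. Rotating these to the axes leaves a map that fixes
  every \<open>munit i i\<close> up to a factor.\<close>

lemma rank_one_preserver_form:
  fixes T :: "real^'n^'n \<Rightarrow> real^'n^'n"
  assumes T: "linear T" "inj T" and rk: "\<And>x y. \<exists>u v. T (outer x y) = outer u v"
    and al: "\<And>A B. aligned k A B \<Longrightarrow> aligned k (T A) (T B)"
  shows "\<exists>\<gamma>>0. \<exists>U V. orthogonal_matrix U \<and> orthogonal_matrix V \<and>
        ((\<forall>X. T X = \<gamma> *\<^sub>R (U ** X ** V)) \<or> (\<forall>X. T X = \<gamma> *\<^sub>R (U ** transpose X ** V)))"
proof -
  have inj0: "X = 0" if "T X = 0" for X using T that linear_injective_0 by blast
  have "\<exists>u v. T (munit i i) = outer u v" for i using rk by (simp add: munit_def)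
  then obtain u v where uv: "\<And>i. T (munit i i) = outer (u i) (v i)" by metis
  have nz: "u i \<noteq> 0" "v i \<noteq> 0" for i
    using inj0[of "munit i i"] uv[of i] by (auto simp: munit_def axis_eq_0_iff)
  have orth: "u i \<bullet> u j = 0 \<and> v i \<bullet> v j = 0" if "i \<noteq> j" for i j
  proof -
    have "axis i 1 \<bullet> (axis j 1 :: real^'n) = 0" using that by (simp add: axis_component)
    note * = aligned_outer_pm[OF this this, THEN al]
    show ?thesis
      using outer_aligned_orthogonal[OF k1 k_le, of "u i" "u j" "v i" "v j"] nz *
      by (simp add: uv linear_neg[OF T(1)] flip: munit_def)
  qed
  obtain U where U: "orthogonal_matrix U" "\<And>i. transpose U *v u i = norm (u i) *\<^sub>R axis i 1"
    using orthogonal_of_orthogonal_family[of u] nz orth by auto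
  obtain V where V: "orthogonal_matrix V" "\<And>i. transpose V *v v i = norm (v i) *\<^sub>R axis i 1"
    using orthogonal_of_orthogonal_family[of v] nz orth by auto
  define T' where "T' X = transpose U ** T X ** V" for X
  have T': "linear T'"
    unfolding T'_def by (intro linearI) (simp_all add: linear_add[OF T(1)] linear_scale[OF T(1)] matrix_distribs)
  have T_eq: "T X = U ** T' X ** transpose V" for X
    using orthogonal_conj_inverse(2)[OF U(1), of "transpose V" "T X"] V(1) by (simp add: T'_def)
  have T'_inj0: "X = 0" if "T' X = 0" for X
    using T_eq[of X] that inj0[of X] by (simp add: matrix_mult_0)
  then have T'_inj: "inj T'" using linear_injective_0[OF T'] by blast
  have T'_rk: "\<exists>u v. T' (outer x y) = outer u v" for x y
  proof -
    obtain u v where "T (outer x y) = outer u v" using rk by blast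
    then have "T' (outer x y) = outer (transpose U *v u) (transpose V *v v)"
      by (simp add: T'_def mult_outer outer_mult)
    then show ?thesis by blast
  qed
  have T'_diag: "T' (munit i i) = (norm (u i) * norm (v i)) *\<^sub>R munit i i" for i
    by (simp add: T'_def uv mult_outer outer_mult U(2) V(2) outer_scaleR_left outer_scaleR_right matrix_scaleR_left)
       (simp add: munit_def)
  have T'_al: "aligned k (T' A) (T' B)" if "aligned k A B" for A B
    unfolding T'_def using U V al[OF that] by (subst aligned_conj[OF k1 k_le]) auto
  have T'_minus: "T' (- X) = - T' X" for X using linear_neg[OF T'] .
  have "(\<exists>a b. \<forall>X. T' X = diagm a ** X ** diagm b) \<or> (\<exists>a b. \<forall>X. T' X = diagm a ** transpose X ** diagm b)"
    by (rule rank_one_preserver_fixing_diagonal[OF T' T'_inj T'_rk T'_diag]) (use nz in auto)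
  then show ?thesis
  proof (elim disjE exE)
    fix a b :: "'n \<Rightarrow> real" assume ab: "\<forall>X. T' X = diagm a ** X ** diagm b"
    then have o: "T' (outer x y) = outer (diagm a *v x) (diagm b *v y)" for x y
      by (simp add: mult_outer outer_mult)
    obtain c P d Q where *: "c > 0" "d > 0" "orthogonal_matrix P" "orthogonal_matrix Q"
      "diagm a = c *\<^sub>R P" "diagm b = d *\<^sub>R Q"
    proof (rule diagonal_form_is_conformal[where T = T' and a = a and b = b])
      show "T' (outer x y) = outer (diagm a *v x) (diagm b *v y)" for x y by (rule o)
      show "X = 0" if "T' X = 0" for X using that by (rule T'_inj0)
      show "T' (- X) = - T' X" for X by (rule T'_minus)
      show "aligned k (T' A) (T' B)" if "aligned k A B" for A B using that by (rule T'_al)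
    qed (rule that)
    have "T X = (c * d) *\<^sub>R ((U ** P) ** X ** (Q ** transpose V))" for X
      using ab by (simp add: T_eq * matrix_distribs matrix_mul_assoc)
    then show ?thesis
      using * U V by (intro exI[of _ "c * d"] conjI exI[of _ "U ** P"] exI[of _ "Q ** transpose V"])
        (auto intro: orthogonal_matrix_mul)
  next
    fix a b :: "'n \<Rightarrow> real" assume ab: "\<forall>X. T' X = diagm a ** transpose X ** diagm b"
    have o: "(T' \<circ> transpose) (outer x y) = outer (diagm a *v x) (diagm b *v y)" for x y
      using ab by (simp add: mult_outer outer_mult)
    obtain c P d Q where *: "c > 0" "d > 0" "orthogonal_matrix P" "orthogonal_matrix Q"
      "diagm a = c *\<^sub>R P" "diagm b = d *\<^sub>R Q"
    proof (rule diagonal_form_is_conformal[where T = "T' \<circ> transpose" and a = a and b = b])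
      show "X = 0" if "(T' \<circ> transpose) X = 0" for X
        using T'_inj0[of "transpose X"] that transpose_iff[of X 0] by simp
      show "aligned k ((T' \<circ> transpose) A) ((T' \<circ> transpose) B)" if "aligned k A B" for A B
        using that T'_al[of "transpose A" "transpose B"] ky_fan_transpose[OF k_le]
        by (simp add: aligned_def flip: transpose_add)
      show "(T' \<circ> transpose) (outer x y) = outer (diagm a *v x) (diagm b *v y)" for x y by (rule o)
      show "(T' \<circ> transpose) (- X) = - (T' \<circ> transpose) X" for X by (simp add: T'_minus)
    qed (rule that)
    have "T X = (c * d) *\<^sub>R ((U ** P) ** transpose X ** (Q ** transpose V))" for X
      using ab by (simp add: T_eq * matrix_distribs matrix_mul_assoc)
    then show ?thesis
      using * U V by (intro exI[of _ "c * d"] conjI exI[of _ "U ** P"] exI[of _ "Q ** transpose V"])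
        (auto intro: orthogonal_matrix_mul)
  qed
qed

end

section \<open>The image of the matrices of rank one\<close>

text \<open>The assumptions are symmetric in \<open>T\<close> and its inverse \<open>S\<close> and
  survive composition with isometries, so normalised maps become new instances.\<close>

locale aligned_iso =
  fixes k :: nat and T S :: "real^'n^'n \<Rightarrow> real^'n^'n"
  assumes k1: "1 < k" and k_le: "k \<le> CARD('n)"
    and linT: "linear T" and linS: "linear S"
    and ST: "\<And>X. S (T X) = X" and TS: "\<And>X. T (S X) = X"
    and alT: "\<And>A B. aligned k A B \<Longrightarrow> aligned k (T A) (T B)"
    and alS: "\<And>A B. aligned k A B \<Longrightarrow> aligned k (S A) (S B)"
begin

lemma aligned_T_iff: "aligned k (T A) (T B) \<longleftrightarrow> aligned k A B"
  using alT[of A B] alS[of "T A" "T B"] by (auto simp: ST)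

lemma T_nonzero: "X \<noteq> 0 \<Longrightarrow> T X \<noteq> 0"
  using ST[of X] linear_0[OF linS] by auto

lemma S_nonzero: "X \<noteq> 0 \<Longrightarrow> S X \<noteq> 0"
  using TS[of X] linear_0[OF linT] by auto

lemma inj_T: "inj T"
  using ST by (rule inj_on_inverseI)

lemma extremal_T: "extremal k A \<Longrightarrow> extremal k (T A)"
  by (rule extremal_linear_image[OF linT linS ST TS alS])

lemma extremal_S: "extremal k A \<Longrightarrow> extremal k (S A)"
  by (rule extremal_linear_image[OF linS linT TS ST alT])

lemma image_outer_cases:
  assumes "x \<noteq> 0" "y \<noteq> 0"
  shows "(\<exists>u v. u \<noteq> 0 \<and> v \<noteq> 0 \<and> T (outer x y) = outer u v) \<or>
    (k < CARD('n) \<and> (\<exists>c G. c > 0 \<and> orthogonal_matrix G \<and> T (outer x y) = c *\<^sub>R G))"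
  using extremal_cases[OF k1 k_le extremal_T[OF extremal_outer[OF k1 k_le assms]]] .

text \<open>The orthogonal pairs are aligned with both signs, which their images inherit;
  \<open>outer_orthogonal_not_aligned\<close> forbids this for images of different kinds.\<close>

lemma image_outer_propagate:
  assumes nz: "x \<noteq> 0" "y \<noteq> 0" "x' \<noteq> 0" "y' \<noteq> 0" and orth: "x \<bullet> x' = 0" "y \<bullet> y' = 0"
    and ex: "\<exists>u v. T (outer x y) = outer u v"
  shows "\<exists>u v. T (outer x' y') = outer u v"
proof (rule ccontr)
  assume "\<nexists>u v. T (outer x' y') = outer u v"
  then obtain c G where cG: "c > 0" "orthogonal_matrix G" "T (outer x' y') = c *\<^sub>R G"
    using image_outer_cases[OF nz(3,4)] by auto
  obtain u v where uv: "T (outer x y) = outer u v" using ex by blast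
  then have nz': "u \<noteq> 0" "v \<noteq> 0" using T_nonzero[of "outer x y"] nz by auto
  have "aligned k (outer u v) (c *\<^sub>R G)" "aligned k (outer u v) (- (c *\<^sub>R G))"
    using alT[OF aligned_outer_pm(1)[OF k1 k_le orth]] alT[OF aligned_outer_pm(2)[OF k1 k_le orth]]
    by (simp_all add: uv cG(3) linear_neg[OF linT])
  then show False
    using outer_orthogonal_not_aligned[OF k1 k_le cG(2) _ nz', of c] cG(1) by simp
qed

text \<open>From \<open>1 < k < CARD('n)\<close> the dimension is at least 3, which leaves a
  direction outside the span of two vectors.\<close>

lemma exists_common_orthogonal:
  fixes x x' :: "real^'n"
  assumes "k < CARD('n)"
  obtains z where "z \<noteq> 0" "x \<bullet> z = 0" "x' \<bullet> z = 0"
proof -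
  have "dim {x, x'} \<le> card {x, x'}" by (rule dim_le_card') simp
  also have "\<dots> \<le> 2" by (simp add: card_insert_if)
  also have "\<dots> < DIM(real^'n)" using k1 assms by simp
  finally obtain z where "z \<noteq> 0" "\<And>y. y \<in> span {x, x'} \<Longrightarrow> orthogonal z y"
    using orthogonal_to_subspace_exists[of "{x, x'}"] by blast
  then show ?thesis using that[of z] span_base[of x "{x, x'}"] span_base[of x' "{x, x'}"]
    by (simp add: orthogonal_def inner_commute)
qed

text \<open>For \<open>k < CARD('n)\<close> any two pairs \<open>(x, y)\<close> and
  \<open>(x', y')\<close> are linked by a pair orthogonal to both; for \<open>k = CARD('n)\<close>
  rank one is the only kind of extremal matrix.\<close>

lemma rank_one_dichotomy:
  "(\<forall>x y. \<exists>u v. T (outer x y) = outer u v) \<or>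
   (k < CARD('n) \<and> (\<forall>x y. x \<noteq> 0 \<longrightarrow> y \<noteq> 0 \<longrightarrow> (\<exists>c G. c > 0 \<and> orthogonal_matrix G \<and> T (outer x y) = c *\<^sub>R G)))"
proof (cases "\<exists>x y. x \<noteq> 0 \<and> y \<noteq> 0 \<and> (\<exists>u v. T (outer x y) = outer u v)")
  case False
  have ax: "axis undefined 1 \<noteq> (0 :: real^'n)" by (simp add: axis_eq_0_iff)
  then have kn: "k < CARD('n)"
    using image_outer_cases[OF ax ax] False by blast
  have "\<exists>c G. c > 0 \<and> orthogonal_matrix G \<and> T (outer x y) = c *\<^sub>R G" if "x \<noteq> 0" "y \<noteq> 0" for x y
    using image_outer_cases[OF that] False that by metis
  then show ?thesis using kn by blast
next
  case True
  then obtain x y where xy: "x \<noteq> 0" "y \<noteq> 0" "\<exists>u v. T (outer x y) = outer u v" by blast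
  have "\<exists>u v. T (outer x' y') = outer u v" for x' y'
  proof (cases "x' = 0 \<or> y' = 0")
    case True
    then have "T (outer x' y') = outer 0 0" using linear_0[OF linT] by auto
    then show ?thesis by blast
  next
    case nz: False
    show ?thesis
    proof (cases "k < CARD('n)")
      case True
      obtain z where z: "z \<noteq> 0" "x \<bullet> z = 0" "x' \<bullet> z = 0" using exists_common_orthogonal[OF True] by blast
      obtain w where w: "w \<noteq> 0" "y \<bullet> w = 0" "y' \<bullet> w = 0" using exists_common_orthogonal[OF True] by blast
      have "\<exists>u v. T (outer z w) = outer u v"
        by (rule image_outer_propagate[OF xy(1,2) z(1) w(1) z(2) w(2) xy(3)])
      moreover have "z \<bullet> x' = 0" "w \<bullet> y' = 0" using z(3) w(3) by (simp_all add: inner_commute)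
      ultimately show ?thesis using image_outer_propagate[OF z(1) w(1)] nz by auto
    next
      case False
      then show ?thesis using image_outer_cases[of x' y'] nz by auto
    qed
  qed
  then show ?thesis by blast
qed

lemma face_pisom_unique:
  fixes W W' :: "real^'n^'n"
  assumes "W \<in> pisom k" "W' \<in> pisom k" "W \<in> face k W'"
  shows "W' = W"
  using pisom_eqI[OF assms(1,2)] assms ky_fan_pisom[OF k_le assms(1)] by (simp add: face_iff)

lemma aligned_pisom_iff:
  fixes W X :: "real^'n^'n"
  assumes W: "W \<in> pisom k"
  shows "aligned k X W \<longleftrightarrow> X \<in> face k W"
proof
  assume "aligned k X W"
  then obtain W' where W': "W' \<in> pisom k" "X \<in> face k W'" "W \<in> face k W'"
    using aligned_iff_face[OF k_le, of X W] by auto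
  then show "X \<in> face k W" using face_pisom_unique[OF W W'(1,3)] by simp
next
  assume "X \<in> face k W"
  then show "aligned k X W" using face_add[OF k_le W _ pisom_in_face[OF k_le W]] by blast
qed

text \<open>A partial isometry in the face opposite to \<open>T W\<close> is unique, since the preimages of two
  such partial isometries both lie in the face of \<open>W\<close> and are therefore aligned.\<close>

lemma face_image:
  assumes W: "W \<in> pisom k"
  obtains W' where "W' \<in> pisom k" "\<And>X. T X \<in> face k W' \<longleftrightarrow> X \<in> face k W"
proof -
  have pull: "X \<in> face k W" if "W' \<in> pisom k" "T W \<in> face k W'" "T X \<in> face k W'" for W' X
  proof -
    have "aligned k (T X) (T W)" using face_add[OF k_le that(1,3,2)] by blast
    then show ?thesis by (simp add: aligned_T_iff aligned_pisom_iff[OF W])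
  qed
  obtain W' where W': "W' \<in> pisom k" "T W \<in> face k W'" using face_exists[OF k_le] by blast
  have unique: "W'' = W'" if W'': "W'' \<in> pisom k" "T W \<in> face k W''" for W''
  proof -
    have "S W' \<in> face k W" "S W'' \<in> face k W"
      using pull[OF W', of "S W'"] pull[OF W'', of "S W''"] pisom_in_face[OF k_le W'(1)] pisom_in_face[OF k_le W''(1)]
      by (simp_all add: TS)
    then have "aligned k (S W'') (S W')" using face_add[OF k_le W] by blast
    then have "aligned k W'' W'" using alT[of "S W''" "S W'"] by (simp add: TS)
    then show ?thesis using aligned_pisom_iff[OF W'(1)] face_pisom_unique[OF W''(1) W'(1)] by simp
  qed
  have "T X \<in> face k W' \<longleftrightarrow> X \<in> face k W" for X
  proof
    assume "X \<in> face k W"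
    then have "aligned k (T X) (T W)" by (simp add: aligned_T_iff aligned_pisom_iff[OF W])
    then obtain W'' where "W'' \<in> pisom k" "T X \<in> face k W''" "T W \<in> face k W''"
      using aligned_iff_face[OF k_le, of "T X" "T W"] by auto
    then show "T X \<in> face k W'" using unique by blast
  qed (use pull[OF W'] in blast)
  then show ?thesis using that[OF W'(1)] by blast
qed

end

text \<open>\<open>G\<close> and \<open>H\<close> agree on the range of the projection
  \<open>P\<close> and are opposite on that of \<open>Q\<close>. The two ranges are orthogonal, so
  \<open>P + Q\<close> is a projection of trace \<open>2 * k\<close>.\<close>

lemma orthogonal_aligned_pm_card:
  fixes G H :: "real^'n^'n"
  assumes k1: "1 < k" and k_le: "k \<le> CARD('n)"
    and GH: "orthogonal_matrix G" "orthogonal_matrix H"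
    and al: "aligned k G H" "aligned k G (- H)"
  shows "2 * k \<le> CARD('n)"
proof -
  obtain W where W: "W \<in> pisom k" "G \<in> face k W" "H \<in> face k W"
    using al(1) aligned_iff_face[OF k_le, of G H] by auto
  obtain W' where W': "W' \<in> pisom k" "G \<in> face k W'" "- H \<in> face k W'"
    using al(2) aligned_iff_face[OF k_le, of G "- H"] by auto
  define P where "P = transpose W ** W"
  define Q where "Q = transpose W' ** W'"
  have GP: "G ** P = H ** P"
    using orthogonal_face_D[OF k1 k_le W(1) GH(1) W(2)] orthogonal_face_D[OF k1 k_le W(1) GH(2) W(3)] by (simp add: P_def)
  have GQ: "G ** Q = - (H ** Q)"
    using orthogonal_face_D[OF k1 k_le W'(1) GH(1) W'(2)] orthogonal_face_D[OF k1 k_le W'(1) orthogonal_minus[OF GH(2)] W'(3)]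
    by (simp add: Q_def matrix_minus_left)
  have sym: "transpose P = P" "transpose Q = Q" by (simp_all add: P_def Q_def matrix_transpose_mul)
  have idem: "transpose X ** X ** (transpose X ** X) = transpose X ** X" if "X \<in> pisom k" for X :: "real^'n^'n"
  proof -
    have "transpose X ** X ** (transpose X ** X) = transpose X ** (X ** transpose X ** X)" by (simp only: matrix_mul_assoc)
    then show ?thesis using pisom_cubic[OF that] by simp
  qed
  have PP: "P ** P = P" "Q ** Q = Q" using idem W W' by (simp_all add: P_def Q_def)
  \<comment> \<open>Evaluating this product through \<open>G\<close> and through \<open>H\<close>
    shows that it is its own negative.\<close>
  have "P ** Q = transpose (G ** P) ** (G ** Q)"
  proof -
    have "transpose (G ** P) ** (G ** Q) = transpose P ** (transpose G ** G) ** Q"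
      by (simp only: matrix_transpose_mul matrix_mul_assoc)
    then show ?thesis using GH(1) by (simp add: orthogonal_matrixD sym)
  qed
  also have "\<dots> = - (transpose (H ** P) ** (H ** Q))" by (simp add: GP GQ matrix_minus_right)
  also have "transpose (H ** P) ** (H ** Q) = P ** Q"
  proof -
    have "transpose (H ** P) ** (H ** Q) = transpose P ** (transpose H ** H) ** Q"
      by (simp only: matrix_transpose_mul matrix_mul_assoc)
    then show ?thesis using GH(2) by (simp add: orthogonal_matrixD sym)
  qed
  finally have PQ: "P ** Q = 0" by (simp add: vec_eq_iff)
  then have QP: "Q ** P = 0" using sym by (metis matrix_transpose_mul transpose_0)
  define R where "R = P + Q"
  have R: "R ** R = R" "transpose R = R"
    by (simp_all add: R_def matrix_distribs PP PQ QP sym)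
  \<comment> \<open>A diagonal entry of a symmetric idempotent is the norm square of its row, hence
    at least its own square.\<close>
  have Rii: "R $ i $ i \<le> 1" for i
  proof -
    have "R $ i $ i = (\<Sum>j\<in>UNIV. R $ i $ j * R $ j $ i)"
      using arg_cong[OF R(1), of "\<lambda>M. M $ i $ i"] by (simp add: matrix_matrix_mult_def)
    also have "\<dots> = (\<Sum>j\<in>UNIV. (R $ i $ j)\<^sup>2)"
      using R(2) by (intro sum.cong refl) (metis (no_types) power2_eq_square transpose_def vec_lambda_beta)
    also have "\<dots> \<ge> (R $ i $ i)\<^sup>2" by (rule member_le_sum) auto
    finally have "(R $ i $ i)\<^sup>2 \<le> R $ i $ i" .
    moreover have "R $ i $ i < (R $ i $ i)\<^sup>2" if "1 < R $ i $ i"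
      using mult_strict_left_mono[of 1 "R $ i $ i" "R $ i $ i"] that by (simp add: power2_eq_square)
    ultimately show ?thesis by (meson not_le)
  qed
  have tr: "mat 1 \<bullet> (transpose X ** X) = k" if "X \<in> pisom k" for X :: "real^'n^'n"
    using inner_matmul_left[of X "mat 1" X] pisom_inner_self[OF that] by simp
  have "real (2 * k) = mat 1 \<bullet> R"
    using tr[OF W(1)] tr[OF W'(1)] by (simp add: R_def P_def Q_def inner_add_right)
  also have "\<dots> = (\<Sum>i\<in>UNIV. R $ i $ i)"
    by (subst inner_commute) (simp add: inner_diagm flip: diagm_1)
  also have "\<dots> \<le> (\<Sum>i\<in>(UNIV :: 'n set). 1)" by (intro sum_mono Rii)
  finally have "real (2 * k) \<le> real CARD('n)" by simp
  then show ?thesis by (simp only: of_nat_le_iff)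
qed

text \<open>If both preimages had rank one, say \<open>w w\<^sup>t\<close> and \<open>w' w'\<^sup>t\<close>, then \<open>(w + w') (w + w')\<^sup>t\<close>
  would be a third aligned summand of twice their sum, but the sum of the images lies in a
  two-dimensional face.\<close>

lemma (in aligned_iso) rank_one_not_to_reflected_diagonals:
  fixes s :: "'n \<Rightarrow> real"
  assumes J: "card J = k" "k < CARD('n) - 1" and s: "\<And>i. \<bar>s i\<bar> = 1"
    and o: "S (diagm s) = outer u v" "S (diagm (s(r := - s r))) = outer u' v'"
    and f: "S (diagm s) \<in> face k (diagm (indicator J))" "S (diagm (s(r := - s r))) \<in> face k (diagm (indicator J))"
  shows False
proof -
  let ?D = "diagm (indicator J) :: real^'n^'n"
  let ?s' = "s(r := - s r)"
  have D: "?D \<in> pisom k" by (rule diagm_indicator_pisom[OF J(1)])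
  have DD: "?D ** ?D = ?D" by (simp add: diagm_mult_diagm flip: indicator_inter_arith)
  \<comment> \<open>In the face of a coordinate projection the two vectors of a rank one matrix are
    positive multiples of each other, so rescaling makes it a square.\<close>
  have square: "\<exists>w. outer u v = outer w w \<and> (\<forall>i. i \<notin> J \<longrightarrow> w $ i = 0)"
    if "outer u v \<in> face k ?D" "outer u v \<noteq> 0" for u v :: "real^'n"
  proof -
    have nz: "u \<noteq> 0" "v \<noteq> 0" using that(2) by auto
    note * = outer_face_D[OF k1 k_le D that(1) nz(1)]
    have Dv: "?D *v v = v"
      using *(2) by (simp add: matrix_vector_mul_assoc DD)
    define c where "c = sqrt (norm u / norm v)"
    have c: "c * c = norm u / norm v" by (simp add: c_def)
    have "norm u *\<^sub>R v = norm v *\<^sub>R u" using *(1) Dv by simp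
    then have "(1 / norm v) *\<^sub>R norm u *\<^sub>R v = (1 / norm v) *\<^sub>R norm v *\<^sub>R u" by (simp only:)
    then have u: "u = (norm u / norm v) *\<^sub>R v" using nz by simp
    have "outer (c *\<^sub>R v) (c *\<^sub>R v) = outer ((c * c) *\<^sub>R v) v"
      by (simp add: outer_scaleR_left outer_scaleR_right)
    then have "outer u v = outer (c *\<^sub>R v) (c *\<^sub>R v)"
      by (subst u) (simp only: c)
    moreover have "(c *\<^sub>R v) $ i = 0" if "i \<notin> J" for i
      using arg_cong[OF Dv, of "\<lambda>x. x $ i"] that by (simp add: diagm_vmult)
    ultimately show ?thesis by blast
  qed
  have diag_nz: "diagm t \<noteq> 0" if "\<And>i. \<bar>t i\<bar> = 1" for t :: "'n \<Rightarrow> real"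
  proof
    assume "diagm t = 0"
    then have "diagm t $ r $ r = 0" by simp
    then show False using that[of r] by (simp add: diagm_nth)
  qed
  have s': "\<bar>?s' i\<bar> = 1" for i using s by simp
  obtain w where w: "S (diagm s) = outer w w" "\<And>i. i \<notin> J \<Longrightarrow> w $ i = 0"
    using square[of u v] f(1) S_nonzero[of "diagm s"] diag_nz[of s] s o(1) by auto
  obtain w' where w': "S (diagm ?s') = outer w' w'" "\<And>i. i \<notin> J \<Longrightarrow> w' $ i = 0"
    using square[of u' v'] f(2) S_nonzero[of "diagm ?s'"] diag_nz[of ?s'] s' o(2) by auto
  have T_w: "T (outer w w) = diagm s" "T (outer w' w') = diagm ?s'"
    using TS[of "diagm s"] TS[of "diagm ?s'"] by (simp_all add: w w')
  have "card (UNIV - {r}) = CARD('n) - 1" by (simp add: card_Diff_singleton)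
  then have "UNIV - {r} \<noteq> {}" using J k1 by force
  then obtain l where l: "l \<noteq> r" by blast
  have indep: "x *\<^sub>R w \<noteq> y *\<^sub>R w'" if "x \<noteq> 0" for x y
  proof
    assume eq: "x *\<^sub>R w = y *\<^sub>R w'"
    have "(x * x) *\<^sub>R outer w w = outer (x *\<^sub>R w) (x *\<^sub>R w)" by (simp add: outer_scaleR_left outer_scaleR_right)
    also have "\<dots> = (y * y) *\<^sub>R outer w' w'" by (simp add: eq outer_scaleR_left outer_scaleR_right)
    finally have "T ((x * x) *\<^sub>R outer w w) = T ((y * y) *\<^sub>R outer w' w')" by simp
    then have "(x * x) *\<^sub>R diagm s = (y * y) *\<^sub>R diagm ?s'" by (simp add: linear_scale[OF linT] T_w)
    from arg_cong[OF this, of "\<lambda>M. M $ l $ l"] arg_cong[OF this, of "\<lambda>M. M $ r $ r"]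
    have "(x * x) * s l = (y * y) * s l" "(x * x) * s r = - ((y * y) * s r)" using l by (simp_all add: diagm_nth)
    moreover have "s l \<noteq> 0" "s r \<noteq> 0" using s[of l] s[of r] by auto
    ultimately have "(x * x + y * y) * s r = 0" "s r \<noteq> 0" by (simp_all add: algebra_simps)
    then have "x * x + y * y = 0" by simp
    then show False using that by (simp add: sum_squares_eq_zero_iff)
  qed
  define X where "X = outer (w + w') (w + w')"
  define Y where "Y = outer (w - w') (w - w')"
  have "X \<in> face k ?D" "Y \<in> face k ?D"
    unfolding X_def Y_def using w(2) w'(2) J(1) by (auto intro!: outer_in_face_diagm)
  then have XY: "aligned k (T X) (T Y)" using alT face_add[OF k_le D] by blast
  have "X + Y = 2 *\<^sub>R outer w w + 2 *\<^sub>R outer w' w'"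
    by (simp add: X_def Y_def outer_add_left outer_add_right outer_diff_left outer_diff_right scaleR_2)
  then have TXY: "T X + T Y = 2 *\<^sub>R diagm s + 2 *\<^sub>R diagm ?s'"
    by (metis T_w linear_add[OF linT] linear_scale[OF linT])
  \<comment> \<open>Multiplication by \<open>diagm s\<close> turns the sum of the images into 4
    times the projection omitting \<open>r\<close>, which lies in the face of every
    \<open>k\<close>-subset avoiding \<open>r\<close>. As \<open>k < CARD('n) - 1\<close>,
    \<open>face_indicators_imp\<close> applies to these subsets.\<close>
  define Z where "Z = diagm s ** T X"
  define Z' where "Z' = diagm s ** T Y"
  have so: "orthogonal_matrix (diagm s)" by (rule orthogonal_diagm[OF s])
  have ZZ': "aligned k Z Z'"
    using XY aligned_conj[OF k1 k_le so orthogonal_matrix_id, of "T X" "T Y"] by (simp add: Z_def Z'_def)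
  have ss: "s i * s i = 1" for i using s[of i] by (auto simp: abs_if split: if_splits)
  have sum: "Z + Z' = diagm (\<lambda>i. if i = r then 0 else 4)"
  proof -
    have "Z + Z' = diagm s ** (T X + T Y)" by (simp add: Z_def Z'_def matrix_add_ldistrib)
    also have "\<dots> = 2 *\<^sub>R diagm (\<lambda>i. s i * s i) + 2 *\<^sub>R diagm (\<lambda>i. s i * ?s' i)"
      by (simp only: TXY matrix_distribs diagm_mult_diagm)
    also have "\<dots> = diagm (\<lambda>i. if i = r then 0 else 4)"
      using ss by (simp add: vec_eq_iff diagm_nth)
    finally show ?thesis .
  qed
  have Z_face: "Z \<in> face k (diagm (indicator I))" if I: "I \<subseteq> UNIV - {r}" "card I = k" for I
  proof (rule aligned_imp_face(1)[OF k_le ZZ' diagm_indicator_pisom[OF I(2)]])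
    show "Z + Z' \<in> face k (diagm (indicator I))"
      unfolding sum using I by (intro diagm_in_face[OF k1 k_le]) auto
  qed
  have kc: "k < card (UNIV - {r})" using J(2) by (simp add: card_Diff_singleton)
  have Z_off: "Z $ i $ j = 0 \<and> Z $ j $ i = 0" if "i \<noteq> r" "i \<noteq> j" for i j
    by (rule face_indicators_imp(1)[of k "UNIV - {r}"]) (use k1 k_le kc Z_face that in auto)
  have Z_diag: "Z $ i $ i = Z $ l $ l" if "i \<noteq> r" for i
    by (rule face_indicators_imp(2)[of k "UNIV - {r}"]) (use k1 k_le kc Z_face that l in auto)
  define a where "a = Z $ l $ l"
  define b where "b = Z $ r $ r"
  \<comment> \<open>A diagonal that is constant away from \<open>r\<close> is a combination of the
    identity and the reflection in axis \<open>r\<close>; hence \<open>T X\<close> combines the two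
    given images.\<close>
  have "Z = ((a + b) / 2) *\<^sub>R mat 1 + ((a - b) / 2) *\<^sub>R diagm (\<lambda>i. if i = r then -1 else 1)"
  proof -
    have "Z $ i $ j = 0" if "i \<noteq> j" for i j
      using Z_off[of i j] Z_off[of j i] that by (cases "i = r") auto
    moreover have "Z $ i $ i = a" if "i \<noteq> r" for i
      using Z_diag[OF that] by (simp add: a_def)
    ultimately show ?thesis
      by (auto simp: vec_eq_iff mat_def diagm_nth b_def field_simps)
  qed
  then have "diagm s ** Z = ((a + b) / 2) *\<^sub>R diagm s + ((a - b) / 2) *\<^sub>R (diagm s ** diagm (\<lambda>i. if i = r then -1 else 1))"
    by (simp add: matrix_distribs)
  moreover have "diagm s ** diagm (\<lambda>i. if i = r then -1 else 1) = diagm ?s'"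
    by (simp add: vec_eq_iff diagm_mult_diagm diagm_nth)
  moreover have "diagm s ** Z = T X"
    using so orthogonal_cancel(1)[of "diagm s" "T X"] by (simp add: Z_def)
  ultimately have TX: "T X = T (((a + b) / 2) *\<^sub>R outer w w + ((a - b) / 2) *\<^sub>R outer w' w')"
    by (simp add: linear_add[OF linT] linear_scale[OF linT] T_w)
  obtain \<alpha> \<beta> where "X = \<alpha> *\<^sub>R outer w w + \<beta> *\<^sub>R outer w' w'"
    using injD[OF inj_T TX] by blast
  then have eq: "outer w w' + outer w' w = (\<alpha> - 1) *\<^sub>R outer w w + (\<beta> - 1) *\<^sub>R outer w' w'"
    by (simp add: X_def outer_add_left outer_add_right algebra_simps)
  \<comment> \<open>In the plane of \<open>w\<close> and \<open>w'\<close>, and orthogonal to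
    \<open>w\<close>: applying both sides of \<open>eq\<close> to \<open>z\<close> makes a nonzero
    multiple of \<open>w\<close> a multiple of \<open>w'\<close>.\<close>
  define z where "z = (w \<bullet> w) *\<^sub>R w' - (w \<bullet> w') *\<^sub>R w"
  have zw: "w \<bullet> z = 0" by (simp add: z_def inner_diff_right)
  have ww: "w \<bullet> w \<noteq> 0" using indep[of 1 0] by auto
  have z0: "z \<noteq> 0"
  proof
    assume "z = 0"
    then have e: "(w \<bullet> w') *\<^sub>R w = (w \<bullet> w) *\<^sub>R w'" by (simp add: z_def)
    then have "w \<bullet> w' = 0" using indep[of "w \<bullet> w'" "w \<bullet> w"] by blast
    then have "w' = 0" using e ww by simp
    then have "T (outer w' w') = 0" using linear_0[OF linT] by simp
    then show False using T_w diag_nz[of ?s'] s' by simp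
  qed
  have "z \<bullet> z = (w \<bullet> w) * (w' \<bullet> z)"
    using zw by (subst (1) z_def) (simp add: inner_diff_left)
  then have w'z: "w' \<bullet> z \<noteq> 0" using z0 by auto
  have "(outer w w' + outer w' w) *v z = ((\<alpha> - 1) *\<^sub>R outer w w + (\<beta> - 1) *\<^sub>R outer w' w') *v z"
    by (simp add: eq)
  then have "(w' \<bullet> z) *\<^sub>R w = ((\<beta> - 1) * (w' \<bullet> z)) *\<^sub>R w'"
    by (simp add: matrix_vector_mult_add_rdistrib outer_vmult zw flip: scaleR_matrix_vector_assoc)
  then show False using indep[OF w'z] by blast
qed

text \<open>\<open>f\<close> compares two diagonal entries of the preimage. It is
  \<open>1 / a\<close> at the identity and 0 at a sign pattern whose preimage is a multiple of an
  orthogonal matrix. Patterns differing in one place cannot both have preimages of rank one, so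
  \<open>f\<close> is 0 after one sign change. By linearity it is \<open>- 1 / a\<close> and
  \<open>- 2 / a\<close> after two and three, so these two adjacent patterns both have preimages of
  rank one.\<close>

lemma (in aligned_iso) not_to_scalar:
  assumes J: "card J = k" "i \<in> J" "j \<in> J" "i \<noteq> j" "3 \<le> card (- J)"
    and a: "a > 0" "T (munit i i) = a *\<^sub>R mat 1"
    and face: "\<And>X. T X \<in> face k (diagm (indicator J)) \<longleftrightarrow> X \<in> face k (diagm (indicator J))"
  shows False
proof -
  let ?D = "diagm (indicator J) :: real^'n^'n"
  have "card (- J) = CARD('n) - k" using J(1) by (simp add: Compl_eq_Diff_UNIV card_Diff_subset)
  then have kn: "k < CARD('n)" "k < CARD('n) - 1" using J(5) by linarith+
  obtain K where K: "K \<subseteq> - J" "card K = 3" using obtain_subset_with_card_n[OF J(5)] by blast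
  obtain p q r where "K = {p, q, r}" and pqr: "p \<noteq> q" "p \<noteq> r" "q \<noteq> r"
    using K(2) by (auto simp: card_Suc_eq numeral_3_eq_3)
  then have out: "p \<notin> J" "q \<notin> J" "r \<notin> J" using K(1) by auto
  define f where "f B = S B $ i $ i - S B $ j $ j" for B
  have f_lin: "f (x *\<^sub>R A + y *\<^sub>R B) = x * f A + y * f B" for x y A B
    by (simp add: f_def linear_add[OF linS] linear_scale[OF linS] algebra_simps)
  define \<sigma> where "\<sigma> I l = (if l \<in> I then -1 else 1 :: real)" for I :: "'n set" and l
  have S1: "S (mat 1) = (1 / a) *\<^sub>R munit i i"
  proof -
    have "a *\<^sub>R S (mat 1) = munit i i"
      using a ST[of "munit i i"] linear_scale[OF linS, of a "mat 1"] by simp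
    then have "(1 / a) *\<^sub>R a *\<^sub>R S (mat 1) = (1 / a) *\<^sub>R munit i i" by (simp only:)
    then show ?thesis using a by simp
  qed
  have f1: "f (mat 1) = 1 / a" using J(4) by (simp add: f_def S1 munit_nth)
  have abs_\<sigma>: "\<bar>\<sigma> I l\<bar> = 1" for I l by (simp add: \<sigma>_def)
  have face_\<sigma>: "S (diagm (\<sigma> I)) \<in> face k ?D" if "I \<subseteq> - J" for I
  proof -
    have "diagm (\<sigma> I) \<in> face k ?D"
      using that by (intro diagm_in_face[OF k1 k_le J(1)]) (auto simp: \<sigma>_def)
    then show ?thesis using face[of "S (diagm (\<sigma> I))"] by (simp add: TS)
  qed
  have cases: "(\<exists>u v. S (diagm (\<sigma> I)) = outer u v) \<or> f (diagm (\<sigma> I)) = 0" if I: "I \<subseteq> - J" for I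
  proof -
    have "extremal k (S (diagm (\<sigma> I)))"
      by (intro extremal_S extremal_orthogonal[OF k1 k_le kn(1)] orthogonal_diagm abs_\<sigma>)
    from extremal_cases[OF k1 k_le this] show ?thesis
    proof (elim disjE conjE exE)
      fix c G assume cG: "0 < c" "orthogonal_matrix G" "S (diagm (\<sigma> I)) = c *\<^sub>R G"
      then have "G \<in> face k ?D"
        using face_scaleR[OF k_le face_\<sigma>[OF I], of "1 / c"] by simp
      from orthogonal_face_D[OF k1 k_le diagm_indicator_pisom[OF J(1)] cG(2) this]
      have Dl: "?D $ l $ l = (G ** (?D ** ?D)) $ l $ l" for l by simp
      have "G $ l $ l = 1" if "l \<in> J" for l
        using that Dl[of l] by (simp add: diagm_mult_diagm diagm_mult_right diagm_nth)
      then have "f (diagm (\<sigma> I)) = 0" using J by (simp add: f_def cG)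
      then show ?thesis by blast
    qed blast
  qed
  have no: False
    if I: "I \<subseteq> - J" "l \<notin> I" "l \<notin> J" and o: "S (diagm (\<sigma> I)) = outer u v" "S (diagm (\<sigma> (insert l I))) = outer u' v'"
    for I l u v u' v'
  proof -
    have e: "\<sigma> (insert l I) = (\<sigma> I)(l := - \<sigma> I l)" using I by (auto simp: \<sigma>_def fun_eq_iff)
    have "insert l I \<subseteq> - J" using I by auto
    note face_\<sigma>[OF this]
    then show False
      using rank_one_not_to_reflected_diagonals[of J "\<sigma> I" u v l u' v'] J(1) kn(2) abs_\<sigma> o face_\<sigma>[OF I(1)]
      by (simp add: e)
  qed
  have \<sigma>0: "diagm (\<sigma> {}) = mat 1" by (simp add: \<sigma>_def[abs_def] diagm_1)
  have "S (diagm (\<sigma> {})) = outer ((1 / a) *\<^sub>R axis i 1) (axis i 1)"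
    by (simp add: \<sigma>0 S1 munit_def outer_scaleR_left)
  then have single: "f (diagm (\<sigma> {l})) = 0" if "l \<notin> J" for l
    using no[of "{}" l] cases[of "{l}"] that by auto
  have add: "f (diagm (\<sigma> (insert l I))) = f (diagm (\<sigma> I)) - 1 / a" if "l \<notin> I" "l \<notin> J" for l I
  proof -
    \<comment> \<open>Each sign change adds the same kind of correction, a single reflection minus
      the identity, on which \<open>f\<close> is \<open>- 1 / a\<close>.\<close>
    have "diagm (\<sigma> (insert l I)) = 1 *\<^sub>R diagm (\<sigma> I) + 1 *\<^sub>R (1 *\<^sub>R diagm (\<sigma> {l}) + (-1) *\<^sub>R mat 1)"
      using that by (auto simp: vec_eq_iff diagm_nth \<sigma>_def mat_def)
    then show ?thesis by (simp only: f_lin single[OF that(2)] f1) simp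
  qed
  have "f (diagm (\<sigma> {q, p})) = - 1 / a"
    using add[of q "{p}"] pqr out single by simp
  moreover have "f (diagm (\<sigma> {r, q, p})) = - 2 / a"
    using add[of r "{q, p}"] pqr out calculation by simp
  moreover have "{q, p} \<subseteq> - J" "{r, q, p} \<subseteq> - J" using out by auto
  ultimately obtain u v u' v' where
    "S (diagm (\<sigma> {q, p})) = outer u v" "S (diagm (\<sigma> {r, q, p})) = outer u' v'"
    using cases[of "{q, p}"] cases[of "{r, q, p}"] a(1) by auto
  then show False using no[of "{q, p}" r] out pqr by auto
qed

text \<open>The images of two diagonal units give \<open>2 * k \<le> CARD('n)\<close>, and
  \<open>not_to_scalar\<close> leaves at most two indices outside \<open>J\<close>. Thus
  \<open>k\<close> is at most \<open>CARD('n) - k\<close>, which is at most 2.\<close>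

lemma (in aligned_iso) all_orthogonal_imp_exceptional:
  assumes II: "\<And>x y. x \<noteq> 0 \<Longrightarrow> y \<noteq> 0 \<Longrightarrow> \<exists>c G. c > 0 \<and> orthogonal_matrix G \<and> T (outer x y) = c *\<^sub>R G"
  shows "k = 2 \<and> CARD('n) = 4"
proof -
  obtain J where J: "J \<subseteq> (UNIV :: 'n set)" "card J = k" using obtain_subset_with_card_n[OF k_le] by blast
  have "\<not> card J \<le> Suc 0" using J k1 by simp
  then obtain i j where ij: "i \<in> J" "j \<in> J" "i \<noteq> j" using card_le_Suc0_iff_eq[of J] by auto
  have ax: "axis l 1 \<noteq> (0 :: real^'n)" for l by (simp add: axis_eq_0_iff)
  obtain a G where aG: "a > 0" "orthogonal_matrix G" "T (munit i i) = a *\<^sub>R G"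
    using II[OF ax ax] unfolding munit_def by blast
  obtain b H where bH: "b > 0" "orthogonal_matrix H" "T (munit j j) = b *\<^sub>R H"
    using II[OF ax ax] unfolding munit_def by blast
  have "axis i 1 \<bullet> (axis j 1 :: real^'n) = 0" using ij by (simp add: axis_component)
  note * = aligned_outer_pm[OF k1 k_le this this, THEN alT]
  then have "aligned k (a *\<^sub>R G) (b *\<^sub>R H)" "aligned k (a *\<^sub>R G) (b *\<^sub>R (- H))"
    using aG bH by (simp_all add: linear_neg[OF linT] flip: munit_def)
  then have "aligned k ((1 / a) *\<^sub>R a *\<^sub>R G) ((1 / b) *\<^sub>R b *\<^sub>R H)" "aligned k ((1 / a) *\<^sub>R a *\<^sub>R G) ((1 / b) *\<^sub>R b *\<^sub>R (- H))"
    using aG bH aligned_scaleR[OF k_le, of _ _ "1 / a" "1 / b"] by (simp_all only: zero_le_divide_1_iff less_imp_le)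
  then have "2 * k \<le> CARD('n)"
    using orthogonal_aligned_pm_card[OF k1 k_le aG(2) bH(2)] aG bH by simp
  moreover have "\<not> 3 \<le> card (- J)"
  proof
    assume m: "3 \<le> card (- J)"
    let ?D = "diagm (indicator J) :: real^'n^'n"
    have D: "?D \<in> pisom k" by (rule diagm_indicator_pisom[OF J(2)])
    obtain W where W: "W \<in> pisom k" "\<And>X. T X \<in> face k W \<longleftrightarrow> X \<in> face k ?D"
      using face_image[OF D] by blast
    obtain U V where UV: "orthogonal_matrix U" "orthogonal_matrix V" "W = U ** ?D ** V"
      using pisom_eq[OF W(1) J(2)] by blast
    have "munit i i \<in> face k ?D"
      unfolding munit_def using ij J(2) by (intro outer_in_face_diagm) (auto simp: axis_component)
    then have "a *\<^sub>R G \<in> face k W" using W(2)[of "munit i i"] by (simp add: aG)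
    then have "G \<in> face k W" using face_scaleR[OF k_le, of "a *\<^sub>R G" W "1 / a"] aG by simp
    from orthogonal_face_D[OF k1 k_le W(1) aG(2) this]
    have WG: "W = G ** (transpose W ** W)" .
    have WW: "transpose W ** W = transpose V ** ?D ** V"
    proof -
      have "transpose W ** W = transpose V ** (?D ** (transpose U ** U) ** ?D) ** V"
        by (simp only: UV(3) matrix_transpose_mul matrix_mul_assoc transpose_diagm)
      then show ?thesis using UV(1) by (simp add: orthogonal_matrixD diagm_mult_diagm flip: indicator_inter_arith)
    qed
    \<comment> \<open>\<open>P\<close> and \<open>transpose V\<close> carry \<open>W\<close> to
      \<open>?D\<close> and \<open>G\<close> to the identity at once, which is possible because
      \<open>W\<close> is \<open>G\<close> on its initial space.\<close>
    define P where "P = V ** transpose G"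
    have P: "orthogonal_matrix P" using UV aG by (simp add: P_def orthogonal_matrix_mul)
    have V': "orthogonal_matrix (transpose V)" using UV by simp
    have PW: "P ** W ** transpose V = ?D"
    proof -
      have "P ** W ** transpose V = V ** (transpose G ** G) ** transpose V ** ?D ** (V ** transpose V)"
        by (subst WG) (simp only: P_def WW matrix_mul_assoc)
      then show ?thesis using UV aG by (simp add: orthogonal_matrixD)
    qed
    define T' where "T' X = P ** T X ** transpose V" for X
    define S' where "S' X = S (transpose P ** X ** V)" for X
    have iso: "aligned_iso k T' S'"
    proof (rule aligned_iso.intro)
      show "linear T'" "linear S'" unfolding T'_def S'_def
        by (intro linearI; simp add: linear_add[OF linT] linear_scale[OF linT] linear_add[OF linS] linear_scale[OF linS] matrix_distribs)+
      show "S' (T' X) = X" for X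
        using orthogonal_conj_inverse(1)[OF P V', of "T X"] by (simp add: S'_def T'_def ST)
      show "T' (S' X) = X" for X
        using orthogonal_conj_inverse(2)[OF P V', of X] by (simp add: S'_def T'_def TS)
      show "aligned k (T' A) (T' B)" if "aligned k A B" for A B
        using alT[OF that] by (simp add: T'_def aligned_conj[OF k1 k_le P V'])
      show "aligned k (S' A) (S' B)" if "aligned k A B" for A B
        unfolding S'_def using that P UV by (intro alS) (simp add: aligned_conj[OF k1 k_le])
    qed (use k1 k_le in auto)
    have "T' X \<in> face k ?D \<longleftrightarrow> X \<in> face k ?D" for X
      using face_conj[OF k_le P V', of "T X" W] W(2)[of X] by (simp add: T'_def PW)
    moreover have "T' (munit i i) = a *\<^sub>R mat 1"
    proof -
      have "P ** G ** transpose V = V ** (transpose G ** G) ** transpose V"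
        by (simp only: P_def matrix_mul_assoc)
      then show ?thesis using aG UV by (simp add: T'_def matrix_distribs orthogonal_matrixD)
    qed
    ultimately show False
      using aligned_iso.not_to_scalar[OF iso J(2) ij m aG(1)] by blast
  qed
  moreover have "card (- J) = CARD('n) - k" using J(2) by (simp add: Compl_eq_Diff_UNIV card_Diff_subset)
  ultimately show ?thesis using k1 by linarith
qed

section \<open>The exceptional isometry\<close>

text \<open>The singular values satisfy the same cubic equation and are nonnegative, hence 0 or 1,
  and the norm counts the ones. This gives membership without exhibiting a decomposition.\<close>

lemma pisomI_cubic:
  fixes W :: "real^'n^'n"
  assumes cubic: "W ** transpose W ** W = W" and norm: "W \<bullet> W = real k"
  shows "W \<in> pisom k"
proof -
  obtain U V d where *: "orthogonal_matrix U" "orthogonal_matrix V" "\<And>i. 0 \<le> d i" "W = U ** diagm d ** V"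
    using svd[of W] by auto
  have "W ** transpose W ** W = U ** diagm d ** (V ** transpose V) ** diagm d ** (transpose U ** U) ** diagm d ** V"
    by (simp only: *(4) matrix_transpose_mul matrix_mul_assoc transpose_diagm)
  also have "\<dots> = U ** (diagm d ** diagm d ** diagm d) ** V"
    using * by (simp add: orthogonal_matrixD matrix_mul_assoc)
  also have "\<dots> = U ** diagm (\<lambda>i. d i * d i * d i) ** V" by (simp only: diagm_mult_diagm)
  finally have "U ** diagm (\<lambda>i. d i * d i * d i) ** V = U ** diagm d ** V" using cubic *(4) by simp
  then have cubes: "diagm (\<lambda>i. d i * d i * d i) = diagm d"
    using injD[OF inj_conj[OF *(1,2)]] by blast
  have "d i = 0 \<or> d i = 1" for i
  proof -
    have "d i * d i * d i = d i" using arg_cong[OF cubes, of "\<lambda>M. M $ i $ i"] by (simp only: diagm_nth simp_thms if_True)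
    then have "d i * ((d i - 1) * (d i + 1)) = 0" by (simp add: algebra_simps)
    then show ?thesis using *(3)[of i] by auto
  qed
  then have d: "d = indicator {i. d i = 1}" by (auto simp: indicator_def fun_eq_iff)
  obtain J where J: "W = U ** diagm (indicator J) ** V" using *(4) d by metis
  have "real (card J) = real k"
    using norm by (simp add: J inner_orthogonal_conj[OF *(1,2)] inner_diagm_indicator diagm_nth)
  then show ?thesis using pisomI[OF *(1,2), of J k] J by simp
qed

section \<open>Relabelling of the indices\<close>

lemma relabel_nth [simp]: "relabel e X $ i $ j = X $ e i $ e j"
  by (simp add: relabel_def)

lemma relabel_add: "relabel e (A + B) = relabel e A + relabel e B"
  and relabel_scaleR: "relabel e (c *\<^sub>R A) = c *\<^sub>R relabel e A" for A B :: "real^'m^'m"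
  by (simp_all add: vec_eq_iff)

lemma relabel_mult:
  fixes A B :: "real^'m^'m" and e :: "'n::finite \<Rightarrow> 'm::finite"
  assumes "bij e"
  shows "relabel e (A ** B) = relabel e A ** relabel e B"
  using sum.reindex_bij_betw[OF assms, of "\<lambda>k. A $ e i $ k * B $ k $ e j" for i j]
  by (simp add: vec_eq_iff matrix_matrix_mult_def)

lemma relabel_inner:
  fixes A B :: "real^'m^'m" and e :: "'n::finite \<Rightarrow> 'm::finite"
  assumes "bij e"
  shows "relabel e A \<bullet> relabel e B = A \<bullet> B"
proof -
  have "relabel e A \<bullet> relabel e B = (\<Sum>i\<in>UNIV. \<Sum>j\<in>UNIV. A $ e i $ j * B $ e i $ j)"
    using sum.reindex_bij_betw[OF assms, of "\<lambda>k. A $ e i $ k * B $ e i $ k" for i]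
    by (simp add: inner_matrix)
  then show ?thesis
    using sum.reindex_bij_betw[OF assms, of "\<lambda>i. \<Sum>j\<in>UNIV. A $ i $ j * B $ i $ j"]
    by (simp add: inner_matrix)
qed

lemma relabel_transpose: "relabel e (transpose A) = transpose (relabel e A)"
  by (simp add: vec_eq_iff transpose_def)

lemma relabel_inverse: "bij e \<Longrightarrow> relabel e (relabel (inv e) X) = X" "bij e \<Longrightarrow> relabel (inv e) (relabel e Y) = Y"
  by (simp_all add: vec_eq_iff bij_is_inj bij_is_surj surj_f_inv_f)

text \<open>A change of index type is not multiplication by orthogonal matrices, but the cubic
  equation transfers, since relabelling respects products and transposes.\<close>

lemma relabel_pisom:
  fixes e :: "'n::finite \<Rightarrow> 'm::finite"
  assumes e: "bij e" and W: "W \<in> pisom k"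
  shows "relabel e W \<in> pisom k"
proof (rule pisomI_cubic)
  show "relabel e W ** transpose (relabel e W) ** relabel e W = relabel e W"
    using pisom_cubic[OF W] by (simp flip: relabel_mult[OF e] relabel_transpose)
  show "relabel e W \<bullet> relabel e W = real k"
    using pisom_inner_self[OF W] by (simp add: relabel_inner[OF e])
qed

lemma ky_fan_relabel:
  fixes X :: "real^'m^'m" and e :: "'n::finite \<Rightarrow> 'm::finite"
  assumes e: "bij e" and k: "k \<le> CARD('m)"
  shows "ky_fan_norm k (relabel e X) = ky_fan_norm k X"
proof -
  have k': "k \<le> CARD('n)" using k bij_betw_same_card[OF e] by simp
  obtain W where W: "W \<in> pisom k" "X \<bullet> W = ky_fan_norm k X" using ky_fan_attained[OF k] by blast
  show ?thesis
  proof (rule ky_fan_eqI[OF k'])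
    show "relabel e W \<in> pisom k" by (rule relabel_pisom[OF e W(1)])
    show "relabel e X \<bullet> relabel e W = ky_fan_norm k X" by (simp add: relabel_inner[OF e] W)
    fix W' :: "real^'n^'n" assume "W' \<in> pisom k"
    then have "relabel (inv e) W' \<in> pisom k" by (rule relabel_pisom[OF bij_imp_bij_inv[OF e]])
    then have "X \<bullet> relabel (inv e) W' \<le> ky_fan_norm k X" by (rule inner_le_ky_fan[OF k])
    then show "relabel e X \<bullet> W' \<le> ky_fan_norm k X"
      using relabel_inner[OF e, of X "relabel (inv e) W'"] by (simp add: relabel_inverse[OF e])
  qed
qed

section \<open>Quaternion relations and the map \<open>LL\<close>\<close>

lemma sum_22: "(\<Sum>k\<in>UNIV. f k) = f (1, 1) + f (1, 2) + f (2, 1) + f (2, 2)" for f :: "2 \<times> 2 \<Rightarrow> real"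
proof -
  have "(\<Sum>k\<in>UNIV. f k) = (\<Sum>i\<in>UNIV. \<Sum>j\<in>UNIV. f (i, j))"
    by (simp add: sum.cartesian_product)
  then show ?thesis by (simp add: sum_2)
qed

lemma kron_mult: "kron A B ** kron C D = kron (A ** C) (B ** D)" for A B C D :: "real^2^2"
  by (simp add: vec_eq_iff kron_def matrix_matrix_mult_def sum_22 sum_2 algebra_simps)

lemma mat2_mult: "mat2 a b c d ** mat2 a' b' c' d' = mat2 (a * a' + b * c') (a * b' + b * d') (c * a' + d * c') (c * b' + d * d')"
  by (simp add: vec_eq_iff mat2_def matrix_matrix_mult_def forall_2 sum_2)

lemmas quaternion_defs = B1_def B2_def B3_def C1_def C2_def C3_def

lemma B_mult:
  "B1 ** B1 = - mat 1" "B2 ** B2 = - mat 1" "B3 ** B3 = - mat 1"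
  "B1 ** B2 = B3" "B2 ** B1 = - B3" "B2 ** B3 = B1" "B3 ** B2 = - B1" "B3 ** B1 = B2" "B1 ** B3 = - B2"
  by (simp_all add: quaternion_defs kron_mult mat2_mult, simp_all add: vec_eq_iff kron_def mat2_def forall_2 mat_def)

lemma C_mult:
  "C1 ** C1 = - mat 1" "C2 ** C2 = - mat 1" "C3 ** C3 = - mat 1"
  "C1 ** C2 = C3" "C2 ** C1 = - C3" "C2 ** C3 = C1" "C3 ** C2 = - C1" "C3 ** C1 = C2" "C1 ** C3 = - C2"
  by (simp_all add: quaternion_defs kron_mult mat2_mult, simp_all add: vec_eq_iff kron_def mat2_def forall_2 mat_def)

lemma BC_transpose:
  "transpose B1 = - B1" "transpose B2 = - B2" "transpose B3 = - B3"
  "transpose C1 = - C1" "transpose C2 = - C2" "transpose C3 = - C3"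
  by (simp_all add: quaternion_defs vec_eq_iff kron_def mat2_def forall_2 transpose_def)

lemma linear_LL: "linear LL"
  by (intro linearI) (simp_all add: LL_def matrix_distribs scaleR_add_right algebra_simps)

text \<open>Write \<open>LL\<close> as half the sum of the identity and the three maps taking
  \<open>X\<close> to \<open>Bi ** X ** Ci\<close>. Each of these squares to the identity and the
  product of two is minus the third, so in the square the mixed terms cancel.\<close>

lemma LL_LL: "LL (LL X) = X"
proof -
  have reassoc: "A ** (A' ** X ** D) ** D' = (A ** A') ** X ** (D ** D')" for A A' X D D' :: "real^(2 \<times> 2)^(2 \<times> 2)"
    by (simp only: matrix_mul_assoc)
  show ?thesis
    by (simp add: LL_def matrix_distribs reassoc B_mult C_mult) (simp add: vec_eq_iff algebra_simps)
qed

lemma inner_LL: "LL X \<bullet> Y = X \<bullet> LL Y"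
  by (simp add: LL_def inner_add_left inner_add_right inner_conj BC_transpose matrix_distribs)

text \<open>A finite identity checked entrywise. \<open>mat 1 \<bullet> Y\<close> is the trace, so
  the left sides vanish on symmetric matrices of trace 0; they are the factors of
  \<open>x \<bullet> (Bi *v x')\<close> in \<open>LL_outer_product\<close>.\<close>

lemma quaternion_symmetric_identity:
  fixes Y :: "real^(2 \<times> 2)^(2 \<times> 2)"
  assumes "transpose Y = Y"
  shows "Y ** C1 + C1 ** Y + C2 ** Y ** C3 - C3 ** Y ** C2 = (mat 1 \<bullet> Y) *\<^sub>R C1"
    "Y ** C2 + C2 ** Y + C3 ** Y ** C1 - C1 ** Y ** C3 = (mat 1 \<bullet> Y) *\<^sub>R C2"
    "Y ** C3 + C3 ** Y + C1 ** Y ** C2 - C2 ** Y ** C1 = (mat 1 \<bullet> Y) *\<^sub>R C3"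
proof -
  have sym: "Y $ a $ b = Y $ b $ a" for a b
    using arg_cong[OF assms, of "\<lambda>M. M $ b $ a"] by (simp add: transpose_def)
  have sym': "Y $ (1, 2) $ (1, 1) = Y $ (1, 1) $ (1, 2)" "Y $ (2, 1) $ (1, 1) = Y $ (1, 1) $ (2, 1)"
    "Y $ (2, 2) $ (1, 1) = Y $ (1, 1) $ (2, 2)" "Y $ (2, 1) $ (1, 2) = Y $ (1, 2) $ (2, 1)"
    "Y $ (2, 2) $ (1, 2) = Y $ (1, 2) $ (2, 2)" "Y $ (2, 2) $ (2, 1) = Y $ (2, 1) $ (2, 2)"
    by (rule sym)+
  show "Y ** C1 + C1 ** Y + C2 ** Y ** C3 - C3 ** Y ** C2 = (mat 1 \<bullet> Y) *\<^sub>R C1"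
    "Y ** C2 + C2 ** Y + C3 ** Y ** C1 - C1 ** Y ** C3 = (mat 1 \<bullet> Y) *\<^sub>R C2"
    "Y ** C3 + C3 ** Y + C1 ** Y ** C2 - C2 ** Y ** C1 = (mat 1 \<bullet> Y) *\<^sub>R C3"
    by (simp_all add: vec_eq_iff forall_2 quaternion_defs kron_def mat2_def matrix_matrix_mult_def sum_22
        inner_matrix mat_def sym')
qed

lemma B_inner:
  fixes x y :: "real^(2 \<times> 2)"
  shows "(B1 *v x) \<bullet> y = - (x \<bullet> (B1 *v y))" "(B2 *v x) \<bullet> y = - (x \<bullet> (B2 *v y))" "(B3 *v x) \<bullet> y = - (x \<bullet> (B3 *v y))"
  by (simp_all add: vmult_inner_left BC_transpose minus_vmult)

lemma C_inner:
  fixes x y :: "real^(2 \<times> 2)"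
  shows "(C1 *v x) \<bullet> y = - (x \<bullet> (C1 *v y))" "(C2 *v x) \<bullet> y = - (x \<bullet> (C2 *v y))" "(C3 *v x) \<bullet> y = - (x \<bullet> (C3 *v y))"
  by (simp_all add: vmult_inner_left BC_transpose minus_vmult)

lemma C_self_inner:
  fixes x :: "real^(2 \<times> 2)"
  shows "x \<bullet> (C1 *v x) = 0" "x \<bullet> (C2 *v x) = 0" "x \<bullet> (C3 *v x) = 0"
  using C_inner[of x x] by (simp_all add: inner_commute)

lemma B_self_inner:
  fixes x :: "real^(2 \<times> 2)"
  shows "x \<bullet> (B1 *v x) = 0" "x \<bullet> (B2 *v x) = 0" "x \<bullet> (B3 *v x) = 0"
  using B_inner[of x x] by (simp_all add: inner_commute)

lemma LL_outer:
  "2 *\<^sub>R LL (outer x y) = outer x y - outer (B1 *v x) (C1 *v y) - outer (B2 *v x) (C2 *v y) - outer (B3 *v x) (C3 *v y)"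
  by (simp add: LL_def mult_outer outer_mult BC_transpose minus_vmult outer_minus_right)

text \<open>Of the sixteen products of outer products, the quaternion relations leave only four
  coefficients depending on \<open>x\<close> and \<open>x'\<close>.\<close>

lemma LL_outer_product:
  fixes x x' y y' :: "real^(2 \<times> 2)"
  defines "Y \<equiv> outer y y'"
  shows "transpose (2 *\<^sub>R LL (outer x y)) ** (2 *\<^sub>R LL (outer x' y')) =
      (x \<bullet> x') *\<^sub>R (Y - C1 ** Y ** C1 - C2 ** Y ** C2 - C3 ** Y ** C3)
    + (x \<bullet> (B1 *v x')) *\<^sub>R (Y ** C1 + C1 ** Y + C2 ** Y ** C3 - C3 ** Y ** C2)
    + (x \<bullet> (B2 *v x')) *\<^sub>R (Y ** C2 + C2 ** Y + C3 ** Y ** C1 - C1 ** Y ** C3)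
    + (x \<bullet> (B3 *v x')) *\<^sub>R (Y ** C3 + C3 ** Y + C1 ** Y ** C2 - C2 ** Y ** C1)"
proof -
  have "transpose (2 *\<^sub>R LL (outer x y)) ** (2 *\<^sub>R LL (outer x' y')) =
      (x \<bullet> x') *\<^sub>R (outer y y' + outer (C1 *v y) (C1 *v y') + outer (C2 *v y) (C2 *v y') + outer (C3 *v y) (C3 *v y'))
    + (x \<bullet> (B1 *v x')) *\<^sub>R (outer (C1 *v y) y' - outer y (C1 *v y') + outer (C3 *v y) (C2 *v y') - outer (C2 *v y) (C3 *v y'))
    + (x \<bullet> (B2 *v x')) *\<^sub>R (outer (C2 *v y) y' - outer y (C2 *v y') + outer (C1 *v y) (C3 *v y') - outer (C3 *v y) (C1 *v y'))
    + (x \<bullet> (B3 *v x')) *\<^sub>R (outer (C3 *v y) y' - outer y (C3 *v y') + outer (C2 *v y) (C1 *v y') - outer (C1 *v y) (C2 *v y'))"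
    unfolding LL_outer
    by (simp add: matrix_distribs outer_mult_outer B_inner matrix_vector_mul_assoc B_mult minus_vmult)
      (simp add: algebra_simps)
  then show ?thesis unfolding Y_def
    by (simp add: mult_outer outer_mult BC_transpose minus_vmult outer_minus_right outer_minus_left)
      (simp add: algebra_simps)
qed

lemma inner_outer_outer: "outer a b \<bullet> outer c d = (a \<bullet> c) * (b \<bullet> d)"
  by (simp add: inner_outer outer_vmult inner_commute)

text \<open>For \<open>x' = x\<close> the skew coefficients vanish. What remains is the sum of the
  projections onto \<open>y\<close>, \<open>C1 *v y\<close>, \<open>C2 *v y\<close> and
  \<open>C3 *v y\<close>, an orthonormal basis.\<close>

lemma orthogonal_LL_outer:
  fixes x y :: "real^(2 \<times> 2)"
  assumes "norm x = 1" "norm y = 1"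
  shows "orthogonal_matrix (2 *\<^sub>R LL (outer x y))"
proof -
  define Q where "Q = outer y y - C1 ** outer y y ** C1 - C2 ** outer y y ** C2 - C3 ** outer y y ** C3"
  have Q: "Q = outer y y + outer (C1 *v y) (C1 *v y) + outer (C2 *v y) (C2 *v y) + outer (C3 *v y) (C3 *v y)"
    by (simp add: Q_def mult_outer outer_mult BC_transpose minus_vmult outer_minus_right)
  have xx: "x \<bullet> x = 1" "y \<bullet> y = 1" using assms by (simp_all add: dot_square_norm)
  have "transpose (2 *\<^sub>R LL (outer x y)) ** (2 *\<^sub>R LL (outer x y)) = Q"
    unfolding LL_outer_product B_self_inner xx Q_def by simp
  moreover have "Q = mat 1"
  proof -
    have ip: "(C1 *v y) \<bullet> (C1 *v y) = 1" "(C2 *v y) \<bullet> (C2 *v y) = 1" "(C3 *v y) \<bullet> (C3 *v y) = 1"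
      "y \<bullet> (C1 *v y) = 0" "y \<bullet> (C2 *v y) = 0" "y \<bullet> (C3 *v y) = 0"
      "(C1 *v y) \<bullet> y = 0" "(C2 *v y) \<bullet> y = 0" "(C3 *v y) \<bullet> y = 0"
      "(C1 *v y) \<bullet> (C2 *v y) = 0" "(C1 *v y) \<bullet> (C3 *v y) = 0" "(C2 *v y) \<bullet> (C3 *v y) = 0"
      "(C2 *v y) \<bullet> (C1 *v y) = 0" "(C3 *v y) \<bullet> (C1 *v y) = 0" "(C3 *v y) \<bullet> (C2 *v y) = 0"
      by (simp_all add: C_inner matrix_vector_mul_assoc C_mult minus_vmult C_self_inner xx)
    \<comment> \<open>The completeness of the basis is obtained from the norm square of
      \<open>mat 1 - Q\<close>, which is 4 - 8 + 4.\<close>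
    have "Q \<bullet> Q = 4"
      by (simp add: Q inner_add_left inner_add_right inner_outer_outer ip xx)
    moreover have "mat 1 \<bullet> Q = 4"
      by (simp add: Q inner_add_right inner_commute[of "mat 1"] inner_outer ip xx)
    moreover have "mat 1 \<bullet> (mat 1 :: real^(2 \<times> 2)^(2 \<times> 2)) = 4"
      by (simp add: inner_matrix mat_def sum_22)
    ultimately have "(mat 1 - Q) \<bullet> (mat 1 - Q) = 0"
      by (simp add: inner_diff_left inner_diff_right inner_commute)
    then show ?thesis by simp
  qed
  ultimately show ?thesis by (simp add: orthogonal_matrix)
qed

text \<open>Orthogonality of \<open>x\<close> and \<open>x'\<close> removes the first term. Each
  remaining factor, as a function of \<open>Y\<close>, goes to minus its transpose when
  \<open>Y\<close> is transposed, and it vanishes at \<open>Y + transpose Y\<close>, which has trace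
  0; hence it is symmetric.\<close>

lemma symmetric_LL_outer_product:
  fixes x x' y y' :: "real^(2 \<times> 2)"
  assumes "x \<bullet> x' = 0" "y \<bullet> y' = 0"
  defines "Z \<equiv> transpose (2 *\<^sub>R LL (outer x y)) ** (2 *\<^sub>R LL (outer x' y'))"
  shows "transpose Z = Z"
proof -
  define Y where "Y = outer y y'"
  have sym: "transpose (Y + transpose Y) = Y + transpose Y" by (simp add: add.commute)
  have "mat 1 \<bullet> (Y + transpose Y) = 0"
    using assms by (simp add: Y_def inner_add_right inner_commute[of "mat 1"] inner_outer inner_commute[of y' y])
  note K = quaternion_symmetric_identity[OF sym, unfolded this, simplified]
  have 1: "transpose (Y ** C1 + C1 ** Y + C2 ** Y ** C3 - C3 ** Y ** C2) = Y ** C1 + C1 ** Y + C2 ** Y ** C3 - C3 ** Y ** C2"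
    using K(1) by (simp add: matrix_transpose_mul BC_transpose matrix_distribs matrix_mul_assoc algebra_simps)
  have 2: "transpose (Y ** C2 + C2 ** Y + C3 ** Y ** C1 - C1 ** Y ** C3) = Y ** C2 + C2 ** Y + C3 ** Y ** C1 - C1 ** Y ** C3"
    using K(2) by (simp add: matrix_transpose_mul BC_transpose matrix_distribs matrix_mul_assoc algebra_simps)
  have 3: "transpose (Y ** C3 + C3 ** Y + C1 ** Y ** C2 - C2 ** Y ** C1) = Y ** C3 + C3 ** Y + C1 ** Y ** C2 - C2 ** Y ** C1"
    using K(3) by (simp add: matrix_transpose_mul BC_transpose matrix_distribs matrix_mul_assoc algebra_simps)
  show ?thesis
    unfolding Z_def LL_outer_product assms(1) Y_def[symmetric]
    by (simp only: transpose_add transpose_scaleR 1 2 3 scaleR_zero_left transpose_0)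
qed

text \<open>A partial isometry of rank two is a sum of two outer products with orthonormal factors.
  Their images are half of orthogonal matrices \<open>M\<close> and \<open>M ** Z\<close> with
  \<open>Z\<close> a symmetric involution, so \<open>LL W\<close> is \<open>M\<close> times the
  projection \<open>(mat 1 + Z) / 2\<close>.\<close>

lemma LL_pisom:
  assumes W: "W \<in> pisom 2"
  shows "LL W \<in> pisom 2"
proof (rule pisomI_cubic)
  show "LL W \<bullet> LL W = real 2"
    using pisom_inner_self[OF W] by (simp add: inner_LL LL_LL)
  obtain U V J where *: "W = U ** diagm (indicator J) ** V"
      "orthogonal_matrix U" "orthogonal_matrix V" "card J = 2"
    using W unfolding pisom_def by auto
  obtain p q where pq: "J = {p, q}" "p \<noteq> q" using *(4) by (auto simp: card_2_iff)
  define x y x' y' where "x = U *v axis p 1" "y = transpose V *v axis p 1" "x' = U *v axis q 1" "y' = transpose V *v axis q 1"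
  note xy = this
  have "diagm (indicator J) = outer (axis p 1) (axis p 1) + outer (axis q 1) (axis q 1)"
    using pq by (auto simp: vec_eq_iff diagm_nth axis_component indicator_def)
  then have W_eq: "W = outer x y + outer x' y'"
    by (simp add: *(1) xy matrix_distribs mult_outer outer_mult)
  have V': "orthogonal_matrix (transpose V)" using * by simp
  have nrm: "norm x = 1" "norm y = 1" "norm x' = 1" "norm y' = 1" and orth: "x \<bullet> x' = 0" "y \<bullet> y' = 0"
    using pq by (simp_all add: xy norm_eq_sqrt_inner orthogonal_inner[OF *(2)] orthogonal_inner[OF V'] axis_component)
  define M where "M = 2 *\<^sub>R LL (outer x y)"
  define M' where "M' = 2 *\<^sub>R LL (outer x' y')"
  have M: "orthogonal_matrix M" "orthogonal_matrix M'"
    unfolding M_def M'_def by (intro orthogonal_LL_outer nrm)+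
  define Z where "Z = transpose M ** M'"
  have Z: "transpose Z = Z" unfolding Z_def M_def M'_def by (rule symmetric_LL_outer_product[OF orth])
  have "orthogonal_matrix Z" using M by (simp add: Z_def orthogonal_matrix_mul)
  then have ZZ: "Z ** Z = mat 1" using orthogonal_matrixD(1)[of Z] Z by simp
  have M'Z: "M' = M ** Z" using M by (simp add: Z_def orthogonal_cancel)
  have LW: "LL W = (1/2) *\<^sub>R (M ** (mat 1 + Z))"
    by (simp add: W_eq linear_add[OF linear_LL] matrix_add_ldistrib M'Z[symmetric]) (simp add: M_def M'_def scaleR_add_right)
  have "LL W ** transpose (LL W) ** LL W = (1/8) *\<^sub>R (M ** (mat 1 + Z) ** (mat 1 + Z) ** (transpose M ** M) ** (mat 1 + Z))"
    by (simp add: LW matrix_scaleR_left matrix_scaleR_right matrix_transpose_mul Z matrix_mul_assoc)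
  also have "\<dots> = (1/8) *\<^sub>R (M ** ((mat 1 + Z) ** (mat 1 + Z) ** (mat 1 + Z)))"
    using M by (simp add: orthogonal_matrixD matrix_mul_assoc)
  also have "(mat 1 + Z) ** (mat 1 + Z) ** (mat 1 + Z) = 4 *\<^sub>R (mat 1 + Z)"
  proof -
    have "(mat 1 + Z) ** (mat 1 + Z) = 2 *\<^sub>R (mat 1 + Z)"
      by (simp add: matrix_distribs ZZ scaleR_2)
    then show ?thesis by (simp add: matrix_scaleR_left)
  qed
  finally show "LL W ** transpose (LL W) ** LL W = LL W"
    by (simp add: LW matrix_scaleR_right)
qed

lemma ky_fan_LL: "ky_fan_norm 2 (LL X) = ky_fan_norm 2 X"
proof -
  have k: "2 \<le> CARD(2 \<times> 2)" by simp
  have le: "ky_fan_norm 2 (LL X) \<le> ky_fan_norm 2 X" for X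
  proof -
    obtain W where W: "W \<in> pisom 2" "LL X \<bullet> W = ky_fan_norm 2 (LL X)" using ky_fan_attained[OF k] by blast
    then show ?thesis using inner_le_ky_fan[OF k LL_pisom[OF W(1)], of X] by (simp add: inner_LL)
  qed
  from le[of X] le[of "LL X"] show ?thesis by (simp add: LL_LL)
qed

section \<open>Transport of \<open>LL\<close> to a four-element index type\<close>

context
  fixes e :: "'n::finite \<Rightarrow> 2 \<times> 2"
  assumes e: "bij e"
begin

lemma linear_LL_via: "linear (LL_via e)"
  unfolding LL_via_def
  by (intro linearI) (simp_all add: relabel_add relabel_scaleR linear_add[OF linear_LL] linear_scale[OF linear_LL])

lemma LL_via_LL_via: "LL_via e (LL_via e X) = X"
  by (simp add: LL_via_def relabel_inverse[OF e] LL_LL)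

lemma ky_fan_LL_via: "ky_fan_norm 2 (LL_via e X) = ky_fan_norm 2 X"
proof -
  have card: "CARD('n) = 4" using bij_betw_same_card[OF e] by simp
  show ?thesis
    unfolding LL_via_def
    using ky_fan_relabel[OF e, of 2 "LL (relabel (inv e) X)"]
      ky_fan_relabel[OF bij_imp_bij_inv[OF e], of 2 X] card by (simp add: ky_fan_LL)
qed

lemma orthogonal_LL_via_munit: "orthogonal_matrix (2 *\<^sub>R LL_via e (munit p p))"
proof -
  have m: "relabel (inv e) (munit p p) = outer (axis (e p) 1) (axis (e p) 1)"
  proof -
    have "inv e i = p \<longleftrightarrow> i = e p" for i using e by (metis bij_inv_eq_iff)
    then show ?thesis by (simp add: vec_eq_iff munit_nth axis_component)
  qed
  have eq: "2 *\<^sub>R LL_via e (munit p p) = relabel e (2 *\<^sub>R LL (outer (axis (e p) 1) (axis (e p) 1)))"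
    by (simp only: LL_via_def m relabel_scaleR)
  have o: "orthogonal_matrix (2 *\<^sub>R LL (outer (axis (e p) 1) (axis (e p) 1)))"
    by (rule orthogonal_LL_outer) simp_all
  have "relabel e (mat 1) = (mat 1 :: real^'n^'n)" using e by (auto simp: vec_eq_iff mat_def bij_def inj_eq)
  then show ?thesis unfolding eq orthogonal_matrix
    using orthogonal_matrixD(1)[OF o] by (simp flip: relabel_transpose relabel_mult[OF e])
qed

end

section \<open>The classification\<close>

lemma aligned_iso_of_parallel:
  fixes T :: "real^'n^'n \<Rightarrow> real^'n^'n" and k :: nat
  assumes k: "1 < k" "k \<le> CARD('n)" and T: "linear T" "bij T"
    and par: "\<And>A B. parallel_wrt (ky_fan_norm k) A B \<Longrightarrow> parallel_wrt (ky_fan_norm k) (T A) (T B)"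
  shows "aligned_iso k T (inv T)"
proof -
  have S: "linear (inv T)" by (rule inj_linear_imp_inv_linear[OF T(1) bij_is_inj[OF T(2)]])
  have ST: "inv T (T X) = X" "T (inv T X) = X" for X
    using T(2) by (simp_all add: bij_is_inj bij_is_surj surj_f_inv_f)
  have al: "aligned k (T A) (T B)" if "aligned k A B" for A B
    using aligned_if_parallel_preserving[OF k(2) _ T(1) bij_is_inj[OF T(2)] par that] k(1) by simp
  have "aligned k (inv T A) (inv T B)" if "aligned k A B" for A B
    using aligned_inv[OF k T(1) S ST al that] .
  then show ?thesis using k T(1) S ST al by (intro aligned_iso.intro)
qed

lemma isometry_preserves_aligned:
  fixes L :: "real^'n^'n \<Rightarrow> real^'n^'n"
  assumes "linear L" "\<And>X. ky_fan_norm k (L X) = ky_fan_norm k X" "aligned k A B"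
  shows "aligned k (L A) (L B)"
  using assms(2)[of "A + B"] assms(2,3) by (simp add: aligned_def linear_add[OF assms(1)])

text \<open>Composing with \<open>LL_via e\<close> and an orthogonal factor makes
  \<open>munit p p\<close> an eigenvector. This excludes the orthogonal alternative of the
  dichotomy, because \<open>munit p p\<close> is singular, and
  \<open>rank_one_preserver_form\<close> applies to the composed map.\<close>

lemma exceptional_form:
  fixes T :: "real^'n^'n \<Rightarrow> real^'n^'n" and e :: "'n \<Rightarrow> 2 \<times> 2"
  assumes iso: "aligned_iso 2 T S" and card: "CARD('n) = 4" and e: "bij e"
    and II: "\<And>x y. x \<noteq> 0 \<Longrightarrow> y \<noteq> 0 \<Longrightarrow> \<exists>c G. c > 0 \<and> orthogonal_matrix G \<and> T (outer x y) = c *\<^sub>R G"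
  shows "\<exists>\<gamma>>0. \<exists>U V P. orthogonal_matrix U \<and> orthogonal_matrix V \<and> orthogonal_matrix P \<and>
      ((\<forall>X. T X = \<gamma> *\<^sub>R (P ** LL_via e (U ** X ** V))) \<or>
       (\<forall>X. T X = \<gamma> *\<^sub>R (P ** LL_via e (U ** transpose X ** V))))"
proof -
  interpret T: aligned_iso 2 T S by (rule iso)
  note k = T.k1 T.k_le
  obtain p :: 'n where True by blast
  have ax: "axis p 1 \<noteq> (0 :: real^'n)" by (simp add: axis_eq_0_iff)
  obtain c G where cG: "c > 0" "orthogonal_matrix G" "T (munit p p) = c *\<^sub>R G"
    using II[OF ax ax] unfolding munit_def by blast
  define H where "H = 2 *\<^sub>R LL_via e (munit p p)"
  have H: "orthogonal_matrix H" unfolding H_def by (rule orthogonal_LL_via_munit[OF e])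
  \<comment> \<open>\<open>transpose P\<close> carries \<open>G\<close> to \<open>H\<close>, which
    is twice the image of \<open>munit p p\<close> under the involution
    \<open>LL_via e\<close>.\<close>
  define P where "P = G ** transpose H"
  have P: "orthogonal_matrix P" using cG H by (simp add: P_def orthogonal_matrix_mul)
  note L = linear_LL_via[OF e]
  define T' where "T' X = LL_via e (transpose P ** T X ** mat 1)" for X
  define S' where "S' X = S (P ** LL_via e X ** mat 1)" for X
  have P_L: "P ** LL_via e (T' X) = T X" for X
    using P by (simp add: T'_def LL_via_LL_via[OF e] orthogonal_cancel)
  have L_al: "aligned 2 (LL_via e A) (LL_via e B)" if "aligned 2 A B" for A B
    by (rule isometry_preserves_aligned[OF L ky_fan_LL_via[OF e] that])
  have I: "orthogonal_matrix (mat 1 :: real^'n^'n)" by (rule orthogonal_matrix_id)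
  have P': "orthogonal_matrix (transpose P)" using P by simp
  have iso': "aligned_iso 2 T' S'"
  proof (rule aligned_iso.intro)
    show "linear T'"
      unfolding T'_def by (intro linearI)
        (simp_all add: linear_add[OF T.linT] linear_scale[OF T.linT] matrix_distribs linear_add[OF L] linear_scale[OF L])
    show "linear S'"
      unfolding S'_def by (intro linearI)
        (simp_all add: linear_add[OF T.linS] linear_scale[OF T.linS] matrix_distribs linear_add[OF L] linear_scale[OF L])
    show "S' (T' X) = X" for X using P_L[of X] by (simp add: S'_def T.ST)
    show "T' (S' X) = X" for X
      using P by (simp add: S'_def T'_def T.TS orthogonal_cancel LL_via_LL_via[OF e])
    show "aligned 2 (T' A) (T' B)" if "aligned 2 A B" for A B
      unfolding T'_def using T.alT[OF that] by (intro L_al) (simp only: aligned_conj[OF k P' I])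
    show "aligned 2 (S' A) (S' B)" if "aligned 2 A B" for A B
      unfolding S'_def using L_al[OF that] by (intro T.alS) (simp only: aligned_conj[OF k P I])
  qed (rule k)+
  interpret T': aligned_iso 2 T' S' by (rule iso')
  have "T' (munit p p) = (c * 2) *\<^sub>R munit p p"
  proof -
    have "transpose P ** G = H"
      using cG(2) H by (simp add: P_def matrix_transpose_mul orthogonal_matrixD flip: matrix_mul_assoc)
    then have "T' (munit p p) = LL_via e (c *\<^sub>R H)"
      by (simp add: T'_def cG(3) matrix_distribs)
    then show ?thesis
      by (simp add: H_def linear_scale[OF L] LL_via_LL_via[OF e])
  qed
  note T'_p = this
  have "\<forall>x y. \<exists>u v. T' (outer x y) = outer u v"
  proof (rule ccontr)
    assume "\<not> (\<forall>x y. \<exists>u v. T' (outer x y) = outer u v)"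
    then obtain c' G' where cG': "c' > 0" "orthogonal_matrix G'" "T' (munit p p) = c' *\<^sub>R G'"
      using T'.rank_one_dichotomy ax unfolding munit_def by blast
    have "\<not> CARD('n) \<le> Suc 0" using card by simp
    then obtain q where q: "q \<noteq> p" using card_le_Suc0_iff_eq[of "UNIV :: 'n set"] by auto metis
    have "(T' (munit p p) *v axis q 1) = 0"
      unfolding T'_p using q by (simp add: munit_def outer_vmult axis_component flip: scaleR_matrix_vector_assoc)
    then have "G' *v axis q 1 = 0" using cG' by (simp flip: scaleR_matrix_vector_assoc)
    then show False using orthogonal_inner[OF cG'(2), of "axis q 1" "axis q 1"] by simp
  qed
  then obtain \<gamma> U V where form: "\<gamma> > 0" "orthogonal_matrix U" "orthogonal_matrix V"
      "(\<forall>X. T' X = \<gamma> *\<^sub>R (U ** X ** V)) \<or> (\<forall>X. T' X = \<gamma> *\<^sub>R (U ** transpose X ** V))"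
    using rank_one_preserver_form[OF k T'.linT T'.inj_T _ T'.alT] by metis
  have "T X = \<gamma> *\<^sub>R (P ** LL_via e Y)" if "T' X = \<gamma> *\<^sub>R Y" for X Y
    using P_L[of X] that by (simp add: linear_scale[OF L] matrix_scaleR_right)
  then show ?thesis using form P by metis
qed

lemma linear_conj_transpose: "linear (\<lambda>A. U ** transpose A ** V)" for U V :: "real^'n^'n"
  by (rule linearI) (simp_all add: matrix_distribs)

theorem theorem3p1:
  fixes T :: "real^'n^'n \<Rightarrow> real^'n^'n" and k :: nat
  assumes "1 < k" and "k \<le> CARD('n)"
    and "linear T" and "bij T"
    and "\<And>A B. parallel_wrt (ky_fan_norm k) A B \<Longrightarrow> parallel_wrt (ky_fan_norm k) (T A) (T B)"
  shows "(\<exists>c S. linear S \<and> (\<forall>X. ky_fan_norm k (S X) = ky_fan_norm k X) \<and> (\<forall>X. T X = c *\<^sub>R S X)) \<and>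
    ((k, CARD('n)) \<noteq> (2, 4) \<longrightarrow>
      (\<exists>\<gamma>>0. \<exists>U V. orthogonal_matrix U \<and> orthogonal_matrix V \<and>
        ((\<forall>X. T X = \<gamma> *\<^sub>R (U ** X ** V)) \<or>
         (\<forall>X. T X = \<gamma> *\<^sub>R (U ** transpose X ** V))))) \<and>
    ((k, CARD('n)) = (2, 4) \<longrightarrow>
      (\<forall>e :: 'n \<Rightarrow> 2 \<times> 2. bij e \<longrightarrow>
        (\<exists>\<gamma>>0. \<exists>U V P. orthogonal_matrix U \<and> orthogonal_matrix V \<and> orthogonal_matrix P \<and>
          ((\<forall>X. T X = \<gamma> *\<^sub>R (U ** X ** V)) \<or>
           (\<forall>X. T X = \<gamma> *\<^sub>R (U ** transpose X ** V)) \<or>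
           (\<forall>X. T X = \<gamma> *\<^sub>R (P ** LL_via e (U ** X ** V))) \<or>
           (\<forall>X. T X = \<gamma> *\<^sub>R (P ** LL_via e (U ** transpose X ** V)))))))"
proof -
  interpret aligned_iso k T "inv T" using assms by (rule aligned_iso_of_parallel)
  have isom: "ky_fan_norm k (U ** X ** V) = ky_fan_norm k X" "ky_fan_norm k (U ** transpose X ** V) = ky_fan_norm k X"
    if "orthogonal_matrix U" "orthogonal_matrix V" for U V X :: "real^'n^'n"
    by (simp_all add: ky_fan_orthogonal[OF k_le that] ky_fan_transpose[OF k_le])
  from rank_one_dichotomy show ?thesis
  proof
    assume "\<forall>x y. \<exists>u v. T (outer x y) = outer u v"
    then obtain \<gamma> U V where form: "\<gamma> > 0" "orthogonal_matrix U" "orthogonal_matrix V"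
      "(\<forall>X. T X = \<gamma> *\<^sub>R (U ** X ** V)) \<or> (\<forall>X. T X = \<gamma> *\<^sub>R (U ** transpose X ** V))"
      using rank_one_preserver_form[OF k1 k_le linT inj_T _ alT] by metis
    have "\<exists>c S. linear S \<and> (\<forall>X. ky_fan_norm k (S X) = ky_fan_norm k X) \<and> (\<forall>X. T X = c *\<^sub>R S X)"
      using form(4) isom[OF form(2,3)] linear_conj[of U V] linear_conj_transpose[of U V] by blast
    then show ?thesis using form by blast
  next
    assume "k < CARD('n) \<and> (\<forall>x y. x \<noteq> 0 \<longrightarrow> y \<noteq> 0 \<longrightarrow>
      (\<exists>c G. c > 0 \<and> orthogonal_matrix G \<and> T (outer x y) = c *\<^sub>R G))"
    then have II: "\<And>x y. x \<noteq> 0 \<Longrightarrow> y \<noteq> 0 \<Longrightarrow> \<exists>c G. c > 0 \<and> orthogonal_matrix G \<and> T (outer x y) = c *\<^sub>R G"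
      by blast
    have exc: "k = 2" "CARD('n) = 4" using all_orthogonal_imp_exceptional[OF II] by auto
    have iso2: "aligned_iso 2 T (inv T)" using aligned_iso_axioms by (simp add: exc)
    have form: "\<exists>\<gamma>>0. \<exists>U V P. orthogonal_matrix U \<and> orthogonal_matrix V \<and> orthogonal_matrix P \<and>
      ((\<forall>X. T X = \<gamma> *\<^sub>R (P ** LL_via e (U ** X ** V))) \<or>
       (\<forall>X. T X = \<gamma> *\<^sub>R (P ** LL_via e (U ** transpose X ** V))))" if "bij e" for e :: "'n \<Rightarrow> 2 \<times> 2"
      by (rule exceptional_form[OF iso2 exc(2) that II])
    \<comment> \<open>The isometry claim mentions no identification of the indices, so one has to be
      produced for it.\<close>
    have "\<exists>e :: 'n \<Rightarrow> 2 \<times> 2. bij e"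
      using finite_same_card_bij[of "UNIV :: 'n set" "UNIV :: (2 \<times> 2) set"] exc(2) by simp
    then obtain e :: "'n \<Rightarrow> 2 \<times> 2" where e: "bij e" by blast
    obtain \<gamma> U V P where f: "orthogonal_matrix U" "orthogonal_matrix V" "orthogonal_matrix P"
      "(\<forall>X. T X = \<gamma> *\<^sub>R (P ** LL_via e (U ** X ** V))) \<or> (\<forall>X. T X = \<gamma> *\<^sub>R (P ** LL_via e (U ** transpose X ** V)))"
      using form[OF e] by blast
    have P_L: "ky_fan_norm k (P ** LL_via e X) = ky_fan_norm k X" for X
      using ky_fan_orthogonal[OF k_le f(3) orthogonal_matrix_id, of "LL_via e X"] ky_fan_LL_via[OF e, of X]
      by (simp add: exc)
    have lin: "linear (\<lambda>X. P ** LL_via e (f X))" if "linear f" for f :: "real^'n^'n \<Rightarrow> real^'n^'n"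
      using that by (intro linearI)
        (simp_all add: linear_add[OF linear_LL_via[OF e]] linear_scale[OF linear_LL_via[OF e]]
          linear_add[OF that] linear_scale[OF that] matrix_distribs)
    have "\<exists>c S. linear S \<and> (\<forall>X. ky_fan_norm k (S X) = ky_fan_norm k X) \<and> (\<forall>X. T X = c *\<^sub>R S X)"
      using f(4)
    proof
      assume "\<forall>X. T X = \<gamma> *\<^sub>R (P ** LL_via e (U ** X ** V))"
      then show ?thesis using lin[OF linear_conj[of U V]] isom(1)[OF f(1,2)] P_L
        by (intro exI[of _ \<gamma>] exI[of _ "\<lambda>X. P ** LL_via e (U ** X ** V)"]) simp
    next
      assume "\<forall>X. T X = \<gamma> *\<^sub>R (P ** LL_via e (U ** transpose X ** V))"
      then show ?thesis using lin[OF linear_conj_transpose[of U V]] isom(2)[OF f(1,2)] P_L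
        by (intro exI[of _ \<gamma>] exI[of _ "\<lambda>X. P ** LL_via e (U ** transpose X ** V)"]) simp
    qed
    then show ?thesis using form exc by blast
  qed
qed

end
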